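(* Let $1<p<\infty$, $m,N\in\mathbb{N}$, let $(u_n)$ be a bounded sequence in $W^{m,p}(\mathbb{R}^N)$, let $N(n)$, $\Lambda$, $w^{(l)}$, $y^{(l)}_{N(n)}$ be a profile decomposition of $(u_n)$ in $W^{m,p}(\mathbb{R}^N)$ (as defined in the context), and let $\alpha\in\mathbb{N}_0^N$ with $|\alpha|<m$. Let $f_\alpha\in C(\mathbb{R}^N\times\mathbb{R};\mathbb{R})$ satisfy the uniform growth condition: for every $\varepsilon>0$ there exist $q=q_{\alpha,\varepsilon}\in\,]p,p^*_{m-|\alpha|}[$ and $C=C_{\alpha,\varepsilon}>0$ such that for all $s\in\mathbb{R}$, $\sup_{x\in\mathbb{R}^N}|f_\alpha(x,s)|\le\varepsilon(|s|^{p-1}+|s|^{p^*_{m-|\alpha|}-1})+C|s|^{q-1}$ if $p^*_{m-|\alpha|}<\infty$, and $\sup_x|f_\alpha(x,s)|\le\varepsilon|s|^{p-1}+C|s|^{q-1}$ if $p^*_{m-|\alpha|}=\infty$. Put $F_\alpha(x,s)=\int_0^sf_\alpha(x,t)\,dt$. (i) If moreover $f_\alpha(x+y,s)=f_\alpha(x,s)$ for all $y\in\mathbb{Z}^N$, $x\in\mathbb{R}^N$, $s\in\mathbb{R}$, then $$\lim_{n\to\infty}\int_{\mathbb{R}^N}F_\alpha(x,\partial^\alpha u_{N(n)})\,dx=\sum_{l=0}^\Lambda\int_{\mathbb{R}^N}F_\alpha(x,\partial^\alpha w^{(l)})\,dx.$$ (ii) If instead $f_{\alpha,\infty}(s):=\lim_{|x|\to\infty}f_\alpha(x,s)$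 exists for every $s\in\mathbb{R}$, then with $F_{\alpha,\infty}(s)=\int_0^sf_{\alpha,\infty}(t)\,dt$, $$\lim_{n\to\infty}\int_{\mathbb{R}^N}F_\alpha(x,\partial^\alpha u_{N(n)})\,dx=\int_{\mathbb{R}^N}F_\alpha(x,\partial^\alpha w^{(0)})\,dx+\sum_{l=1}^\Lambda\int_{\mathbb{R}^N}F_{\alpha,\infty}(\partial^\alpha w^{(l)})\,dx.$$
   Context: $W^{m,p}(\mathbb{R}^N)$ has norm $(\sum_{|\beta|\le m}\|\partial^\beta u\|_{L^p}^p)^{1/p}$; $p^*_k=pN/(N-kp)$ if $N>kp$, $=\infty$ if $N\le kp$. Profile decomposition of a bounded sequence $(u_n)$ in $W^{m,p}(\mathbb{R}^N)$: data consisting of $\Lambda\in\mathbb{N}\cup\{0,+\infty\}$, a subsequence $(u_{N(n)})_{n\in\mathbb{N}_0}$, $w^{(l)}\in W^{m,p}(\mathbb{R}^N)$ for $l\in\mathbb{N}_0^{<\Lambda+1}$ and $y^{(l)}_{N(n)}\in\mathbb{Z}^N$ for $l\in\mathbb{N}_0^{<\Lambda+1}$, $n\ge l$, such that: (i) $y^{(0)}_{N(n)}=0$ and $w^{(l)}\ne0$ for $l\ge1$; (ii) $|y^{(l)}_{N(n)}-y^{(k)}_{N(n)}|\to\infty$ as $n\to\infty$ for $l\ne k$; (iii) $u_{N(n)}(\cdot+y^{(l)}_{N(n)})\to w^{(l)}$ weakly in $W^{m,p}$ and a.e.; (iv) with $r^L_{N(n)}:=u_{N(n)}-\sum_{l=0}^Lw^{(l)}(\cdot-y^{(l)}_{N(n)})$,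 $r^L_{N(n)}(\cdot+y^{(l)}_{N(n)})\to0$ weakly in $W^{m,p}$ and a.e. for $0\le l\le L$; (v) $\lim_{L\to\Lambda}\limsup_{n\to\infty}\|\partial^\beta r^L_{N(n)}\|_{L^q(\mathbb{R}^N)}=0$ for every multi-index $|\beta|<m$ and every $q\in\,]p,p^*_{m-|\beta|}[$. (Such data exist for every bounded sequence, by the profile decomposition theorem in $W^{m,p}(\mathbb{R}^N)$.) Here $\mathbb{N}_0^{<\Lambda+1}=\{0,\dots,\Lambda\}$ if $\Lambda<\infty$, $=\mathbb{N}_0$ otherwise, and for $\Lambda<\infty$, $\lim_{L\to\Lambda}a_L$ means $a_\Lambda$. *)

theory Defs
  imports "HOL-Analysis.Analysis"
begin

text \<open>Points of R^N are elements of real^'n, N = CARD('n). Multi-indices are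
functions 'n \<Rightarrow> nat; the length |beta| is the sum of the entries.\<close>

definition mi_abs :: "('n::finite \<Rightarrow> nat) \<Rightarrow> nat" where
  "mi_abs \<beta> = (\<Sum>i\<in>UNIV. \<beta> i)"

definition pd :: "'n::finite \<Rightarrow> (real^'n \<Rightarrow> real) \<Rightarrow> real^'n \<Rightarrow> real" where
  "pd i f = (\<lambda>x. frechet_derivative f (at x) (axis i 1))"

fun iter_pd :: "'n::finite list \<Rightarrow> (real^'n \<Rightarrow> real) \<Rightarrow> real^'n \<Rightarrow> real" where
  "iter_pd [] f = f"
| "iter_pd (i # is) f = pd i (iter_pd is f)"

definition test_fun :: "(real^'n::finite \<Rightarrow> real) \<Rightarrow> bool" where
  "test_fun \<phi> \<longleftrightarrow> (\<forall>is x. iter_pd is \<phi> differentiable (at x))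
                   \<and> compact (closure {x. \<phi> x \<noteq> 0})"

definition loc_int :: "(real^'n::finite \<Rightarrow> real) \<Rightarrow> bool" where
  "loc_int u \<longleftrightarrow> u \<in> borel_measurable lebesgue \<and>
     (\<forall>K. compact K \<longrightarrow> set_integrable lebesgue K u)"

text \<open>v is the weak (distributional) derivative of order beta of u.
The classical derivative of the test function is taken along any ordering of
the coordinate directions with multiplicities beta.\<close>
definition is_wderiv :: "('n::finite \<Rightarrow> nat) \<Rightarrow> (real^'n \<Rightarrow> real) \<Rightarrow> (real^'n \<Rightarrow> real) \<Rightarrow> bool" where
  "is_wderiv \<beta> u v \<longleftrightarrow> loc_int u \<and> loc_int v \<and>
     (\<forall>\<phi> is. test_fun \<phi> \<longrightarrow> (\<forall>i. count_list is i = \<beta> i) \<longrightarrow>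
        (\<integral>x. u x * iter_pd is \<phi> x \<partial>lebesgue) = (-1) ^ mi_abs \<beta> * (\<integral>x. v x * \<phi> x \<partial>lebesgue))"

definition wd :: "('n::finite \<Rightarrow> nat) \<Rightarrow> (real^'n \<Rightarrow> real) \<Rightarrow> real^'n \<Rightarrow> real" where
  "wd \<beta> u = (SOME v. is_wderiv \<beta> u v)"

definition in_Lp :: "real \<Rightarrow> (real^'n::finite \<Rightarrow> real) \<Rightarrow> bool" where
  "in_Lp p f \<longleftrightarrow> f \<in> borel_measurable lebesgue \<and> integrable lebesgue (\<lambda>x. \<bar>f x\<bar> powr p)"

definition Lp_norm :: "real \<Rightarrow> (real^'n::finite \<Rightarrow> real) \<Rightarrow> real" where
  "Lp_norm p f = (\<integral>x. \<bar>f x\<bar> powr p \<partial>lebesgue) powr (1 / p)"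

definition W :: "nat \<Rightarrow> real \<Rightarrow> (real^'n::finite \<Rightarrow> real) set" where
  "W m p = {u. \<forall>\<beta>::'n \<Rightarrow> nat. mi_abs \<beta> \<le> m \<longrightarrow> (\<exists>v. is_wderiv \<beta> u v \<and> in_Lp p v)}"

definition W_norm :: "nat \<Rightarrow> real \<Rightarrow> (real^'n::finite \<Rightarrow> real) \<Rightarrow> real" where
  "W_norm m p u = (\<Sum>\<beta>\<in>{\<beta>::'n \<Rightarrow> nat. mi_abs \<beta> \<le> m}. Lp_norm p (wd \<beta> u) powr p) powr (1 / p)"

definition W_bounded_seq :: "nat \<Rightarrow> real \<Rightarrow> (nat \<Rightarrow> real^'n::finite \<Rightarrow> real) \<Rightarrow> bool" where
  "W_bounded_seq m p u \<longleftrightarrow> (\<forall>n. u n \<in> W m p) \<and> (\<exists>C. \<forall>n. W_norm m p (u n) \<le> C)"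

definition W_functional :: "nat \<Rightarrow> real \<Rightarrow> ((real^'n::finite \<Rightarrow> real) \<Rightarrow> real) \<Rightarrow> bool" where
  "W_functional m p lf \<longleftrightarrow>
     (\<forall>u v a b. u \<in> W m p \<longrightarrow> v \<in> W m p \<longrightarrow>
        lf (\<lambda>x. a * u x + b * v x) = a * lf u + b * lf v) \<and>
     (\<exists>C. \<forall>u \<in> W m p. \<bar>lf u\<bar> \<le> C * W_norm m p u)"

definition W_weak_conv :: "nat \<Rightarrow> real \<Rightarrow> (nat \<Rightarrow> real^'n::finite \<Rightarrow> real) \<Rightarrow> (real^'n \<Rightarrow> real) \<Rightarrow> bool" where
  "W_weak_conv m p u w \<longleftrightarrow> (\<forall>lf. W_functional m p lf \<longrightarrow> (\<lambda>n. lf (u n)) \<longlonglongrightarrow> lf w)"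

definition ae_conv :: "(nat \<Rightarrow> real^'n::finite \<Rightarrow> real) \<Rightarrow> (real^'n \<Rightarrow> real) \<Rightarrow> bool" where
  "ae_conv u w \<longleftrightarrow> (AE x in lebesgue. (\<lambda>n. u n x) \<longlonglongrightarrow> w x)"

definition sob_exp :: "real \<Rightarrow> nat \<Rightarrow> nat \<Rightarrow> ereal" where
  "sob_exp p N k = (if real N > real k * p then ereal (p * real N / (real N - real k * p)) else \<infinity>)"

definition int_lattice :: "(real^'n::finite) set" where
  "int_lattice = {y. \<forall>i. y $ i \<in> \<int>}"

text \<open>Remainder r^L_{N(n)} = u_{N(n)} - sum_{l=0}^L w^(l)(. - y^(l)_{N(n)}).
Here y l n stands for y^(l)_{N(n)}.\<close>
definition remainder :: "(nat \<Rightarrow> real^'n::finite \<Rightarrow> real) \<Rightarrow> (nat \<Rightarrow> nat) \<Rightarrow>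
    (nat \<Rightarrow> real^'n \<Rightarrow> real) \<Rightarrow> (nat \<Rightarrow> nat \<Rightarrow> real^'n) \<Rightarrow> nat \<Rightarrow> nat \<Rightarrow> real^'n \<Rightarrow> real" where
  "remainder u N w y L n = (\<lambda>x. u (N n) x - (\<Sum>l\<le>L. w l (x - y l n)))"

definition profile_decomp :: "nat \<Rightarrow> real \<Rightarrow> (nat \<Rightarrow> real^'n::finite \<Rightarrow> real) \<Rightarrow> enat \<Rightarrow> (nat \<Rightarrow> nat) \<Rightarrow>
    (nat \<Rightarrow> real^'n \<Rightarrow> real) \<Rightarrow> (nat \<Rightarrow> nat \<Rightarrow> real^'n) \<Rightarrow> bool" where
  "profile_decomp m p u \<Lambda> N w y \<longleftrightarrow>
     strict_mono N \<and>
     (\<forall>l. enat l \<le> \<Lambda> \<longrightarrow> w l \<in> W m p) \<and>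
     (\<forall>l n. enat l \<le> \<Lambda> \<longrightarrow> l \<le> n \<longrightarrow> y l n \<in> int_lattice) \<and>
     \<comment> \<open>(i)\<close>
     (\<forall>n. y 0 n = 0) \<and>
     (\<forall>l. 1 \<le> l \<longrightarrow> enat l \<le> \<Lambda> \<longrightarrow> \<not> (AE x in lebesgue. w l x = 0)) \<and>
     \<comment> \<open>(ii)\<close>
     (\<forall>l k. enat l \<le> \<Lambda> \<longrightarrow> enat k \<le> \<Lambda> \<longrightarrow> l \<noteq> k \<longrightarrow>
        filterlim (\<lambda>n. norm (y l n - y k n)) at_top sequentially) \<and>
     \<comment> \<open>(iii)\<close>
     (\<forall>l. enat l \<le> \<Lambda> \<longrightarrow>
        W_weak_conv m p (\<lambda>n. \<lambda>x. u (N n) (x + y l n)) (w l) \<and>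
        ae_conv (\<lambda>n. \<lambda>x. u (N n) (x + y l n)) (w l)) \<and>
     \<comment> \<open>(iv)\<close>
     (\<forall>L l. enat L \<le> \<Lambda> \<longrightarrow> l \<le> L \<longrightarrow>
        W_weak_conv m p (\<lambda>n. \<lambda>x. remainder u N w y L n (x + y l n)) (\<lambda>x. 0) \<and>
        ae_conv (\<lambda>n. \<lambda>x. remainder u N w y L n (x + y l n)) (\<lambda>x. 0)) \<and>
     \<comment> \<open>(v)\<close>
     (\<forall>\<beta>::'n \<Rightarrow> nat. \<forall>q. mi_abs \<beta> < m \<longrightarrow> ereal p < ereal q \<longrightarrow>
        ereal q < sob_exp p CARD('n) (m - mi_abs \<beta>) \<longrightarrow>
        (case \<Lambda> of
           enat K \<Rightarrow> limsup (\<lambda>n. ereal (Lp_norm q (wd \<beta> (remainder u N w y K n)))) = 0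
         | \<infinity> \<Rightarrow> (\<lambda>L. limsup (\<lambda>n. ereal (Lp_norm q (wd \<beta> (remainder u N w y L n)))))
                   \<longlonglongrightarrow> 0))"

definition sum_upto :: "enat \<Rightarrow> (nat \<Rightarrow> real) \<Rightarrow> real \<Rightarrow> bool" where
  "sum_upto \<Lambda> a S \<longleftrightarrow> (case \<Lambda> of enat K \<Rightarrow> S = (\<Sum>l\<le>K. a l) | \<infinity> \<Rightarrow> a sums S)"

end

theory Submission
  imports Defs
begin

text \<open>Write \<open>\<partial>\<^sup>\<alpha> u = \<Sum>l\<le>L. \<partial>\<^sup>\<alpha> w l (\<cdot> - y l n) + r\<close>. The primitive of \<open>f\<close> satisfies
\<open>\<bar>F x a - F x b\<bar> \<le> \<epsilon> (T powr p + T powr R) + \<delta> T powr q + C \<bar>a - b\<bar> powr q\<close> with \<open>T = \<bar>a\<bar> + \<bar>b\<bar>\<close>,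
\<open>R\<close> the critical exponent and \<open>q\<close> subcritical, so that \<open>r\<close>, which is small in \<open>L\<^sup>q\<close>, may be dropped
as soon as all terms are bounded in \<open>L\<^sup>p\<close>, \<open>L\<^sup>q\<close> and \<open>L\<^sup>R\<close> uniformly in \<open>L\<close>. For \<open>u\<close> this is the
Sobolev embedding; for the sum of profiles, and \<open>s\<close> any of these exponents, it follows from
\<open>\<Sum>l \<parallel>\<partial>\<^sup>\<alpha> w l\<parallel>\<^sup>s \<le> sup\<^sub>n \<parallel>\<partial>\<^sup>\<alpha> u\<^sub>n\<parallel>\<^sup>s\<close>, a consequence of
the weak convergence of the translates by duality. On the sum of profiles the integral splits, since the
translates drift apart. The Sobolev inequality itself is obtained without mollification: a function
with a weak partial derivative is absolutely continuous on almost every line in that direction, and the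
resulting one-dimensional bounds are combined by integrating out one coordinate at a time.\<close>

section \<open>Smooth bump functions\<close>

text \<open>The remainder is small only in subcritical spaces, whereas the growth bound contains the
  p-th and the critical power. These two carry a coefficient \<epsilon> fixed in advance, so
  boundedness is enough for them; but L is chosen last, and the triangle inequality would give
  bounds growing with L. The way out is to apply the splitting of integrals twice: to the powers
  \<open>\<bar>s\<bar> powr r\<close> themselves, which makes the norm of a sum of translates
  asymptotically additive and hence bounded independently of L, and to the primitive F. The exponent
  q depends on \<epsilon>, so all estimates are kept for a whole set Q of exponents. Convergence of
  the series of profile integrals comes out of the same estimate: late partial sums are close to the
  integrals of u for all large n, hence form a Cauchy sequence. Since \<open>wd\<close> is a choice,
  a derivative is known only up to null sets and only as a Lebesgue measurable function. The
  analysis is done with Borel representatives over \<open>lborel\<close>, where Fubini and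
  coordinatewise integration are at hand, and is transferred back at the end.\<close>

fun Ck :: "nat \<Rightarrow> (real \<Rightarrow> real) \<Rightarrow> bool" where
  "Ck 0 f = True"
| "Ck (Suc k) f = (\<exists>f'. (\<forall>t. (f has_real_derivative f' t) (at t)) \<and> Ck k f')"

lemma Ck_SucI: "(\<And>t. (f has_real_derivative f' t) (at t)) \<Longrightarrow> Ck k f' \<Longrightarrow> Ck (Suc k) f"
  by auto

lemma Ck_SucD: "Ck (Suc k) f \<Longrightarrow> Ck k f"
  by (induction k arbitrary: f) (use Ck.simps in blast)+

lemma Ck_const: "Ck k (\<lambda>t. c)"
proof (induction k arbitrary: c)
  case (Suc k)
  then show ?case by (auto intro!: exI[of _ "\<lambda>t. 0::real"])
qed auto

lemma Ck_add: "Ck k f \<Longrightarrow> Ck k g \<Longrightarrow> Ck k (\<lambda>t. f t + g t)"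
proof (induction k arbitrary: f g)
  case (Suc k)
  then obtain f' g' where "\<forall>t. (f has_real_derivative f' t) (at t)" "Ck k f'"
     "\<forall>t. (g has_real_derivative g' t) (at t)" "Ck k g'" by auto
  with Suc.IH show ?case
    by (auto intro!: exI[of _ "\<lambda>t. f' t + g' t"] derivative_intros)
qed auto

lemma Ck_mult: "Ck k f \<Longrightarrow> Ck k g \<Longrightarrow> Ck k (\<lambda>t. f t * g t)"
proof (induction k arbitrary: f g)
  case (Suc k)
  then obtain f' g' where d: "\<And>t. (f has_real_derivative f' t) (at t)" "Ck k f'"
     "\<And>t. (g has_real_derivative g' t) (at t)" "Ck k g'" by auto
  have "((\<lambda>t. f t * g t) has_real_derivative f' t * g t + f t * g' t) (at t)" for t
    using DERIV_mult[OF d(1)[of t] d(3)[of t]] by (simp add: algebra_simps)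
  moreover have "Ck k (\<lambda>t. f' t * g t + f t * g' t)"
    using Suc Ck_SucD d by (intro Ck_add) auto
  ultimately show ?case by (rule Ck_SucI)
qed auto

lemma Ck_affine: "Ck k f \<Longrightarrow> Ck k (\<lambda>t. f (a * t + b))"
proof (induction k arbitrary: f)
  case (Suc k)
  then obtain f' where d: "\<And>t. (f has_real_derivative f' t) (at t)" "Ck k f'" by auto
  have "((\<lambda>t. f (a * t + b)) has_real_derivative f' (a * t + b) * a) (at t)" for t
    by (rule DERIV_chain2[OF d(1)]) (auto intro!: derivative_eq_intros)
  moreover have "Ck k (\<lambda>t. f' (a * t + b) * a)"
    using Suc.IH[OF d(2)] Ck_const by (intro Ck_mult) auto
  ultimately show ?case by (rule Ck_SucI)
qed auto

text \<open>\<open>Ck\<close> asks for k successive derivatives and leaves continuity of the last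
  one open; quantified over all k this is ordinary smoothness.\<close>

definition smooth1 :: "(real \<Rightarrow> real) \<Rightarrow> bool" where
  "smooth1 f \<longleftrightarrow> (\<forall>k. Ck k f)"

lemma smooth1_deriv:
  assumes "smooth1 f"
  shows "(f has_real_derivative deriv f t) (at t)" "smooth1 (deriv f)"
proof -
  have *: "\<exists>f'. (\<forall>t. (f has_real_derivative f' t) (at t)) \<and> Ck k f'" for k
    using assms Ck.simps(2) unfolding smooth1_def by blast
  then show "(f has_real_derivative deriv f t) (at t)"
    using DERIV_imp_deriv by metis
  have "Ck k (deriv f)" for k
  proof -
    obtain f' where f': "\<And>t. (f has_real_derivative f' t) (at t)" "Ck k f'" using * by blast
    then have "deriv f = f'" by (auto simp: DERIV_imp_deriv)
    with f' show ?thesis by simp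
  qed
  then show "smooth1 (deriv f)" by (simp add: smooth1_def)
qed

text \<open>The factor \<open>(1/t)^n\<close> in front of the usual flat function makes the family
  closed under differentiation up to linear combinations, so smoothness is an induction on the order
  with n varying.\<close>

definition invexp :: "nat \<Rightarrow> real \<Rightarrow> real" where
  "invexp n t = (if t \<le> 0 then 0 else (1/t)^n * exp (- (1/t)))"

lemma invexp_tendsto_0: "(invexp n \<longlongrightarrow> 0) (at_right 0)"
proof -
  have "((\<lambda>s::real. s ^ n / exp s) \<longlongrightarrow> 0) at_top" by (rule tendsto_power_div_exp_0)
  then have "((\<lambda>t::real. (inverse t) ^ n / exp (inverse t)) \<longlongrightarrow> 0) (at_right 0)"
    by (rule filterlim_compose[OF _ filterlim_inverse_at_top_right])
  moreover have "eventually (\<lambda>t::real. (inverse t) ^ n / exp (inverse t) = invexp n t) (at_right 0)"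
    by (auto simp: eventually_at_filter invexp_def exp_minus field_simps intro!: always_eventually)
  ultimately show ?thesis by (rule Lim_transform_eventually)
qed

lemma invexp_DERIV:
  "(invexp n has_real_derivative invexp (n+2) t - real n * invexp (n+1) t) (at t)"
proof -
  consider "t < 0" | "t = 0" | "t > 0" by linarith
  then show ?thesis
  proof cases
    case 1
    have "((\<lambda>t. 0) has_real_derivative 0) (at t)" by simp
    then have "(invexp n has_real_derivative 0) (at t)"
      by (rule DERIV_cong_ev[THEN iffD1, rotated 3]) (use 1 in \<open>auto simp: invexp_def
          intro!: eventually_mono[OF order_tendstoD(2)[OF tendsto_ident_at 1]] eventually_nhds_in_open
          simp: eventually_nhds intro!: exI[of _ "{..<0}"]\<close>)
    then show ?thesis using 1 by (simp add: invexp_def)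
  next
    case 2
    have "((\<lambda>h. invexp n h / h) \<longlongrightarrow> 0) (at 0)"
      unfolding filterlim_at_split
    proof
      show "((\<lambda>h. invexp n h / h) \<longlongrightarrow> 0) (at_left 0)"
        by (rule Lim_transform_eventually[of "\<lambda>_. 0"])
          (auto simp: eventually_at_filter invexp_def intro!: always_eventually)
      \<comment> \<open>For h > 0 the difference quotient at 0 is \<open>invexp (n+1) h\<close>,
        another member of the family.\<close>
      show "((\<lambda>h. invexp n h / h) \<longlongrightarrow> 0) (at_right 0)"
        by (rule Lim_transform_eventually[OF invexp_tendsto_0[of "n+1"]])
          (auto simp: eventually_at_filter invexp_def intro!: always_eventually)
    qed
    moreover have "invexp m 0 = 0" for m by (simp add: invexp_def)
    ultimately show ?thesis using 2 by (simp add: has_field_derivative_iff)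
  next
    case 3
    have "((\<lambda>t. (1/t)^n * exp (- (1/t))) has_real_derivative invexp (n+2) t - real n * invexp (n+1) t) (at t)"
    proof -
      \<comment> \<open>For n = 0 the exponent \<open>n - Suc 0\<close> is truncated to 0, but then
        the factor \<open>real n\<close> vanishes.\<close>
      have e: "real n * (1/t)^(n - Suc 0) * (- (1/t)\<^sup>2) = - (real n * (1/t)^(n+1))"
        by (cases n) (auto simp: power2_eq_square)
      have "((\<lambda>t. (1/t)^n * exp (- (1/t))) has_real_derivative
         (real n * (1/t)^(n - Suc 0) * (- (1/t)\<^sup>2)) * exp (- (1/t)) + (1/t)^n * (exp (- (1/t)) * (1/t)\<^sup>2)) (at t)"
        using 3 by (auto intro!: derivative_eq_intros simp: power2_eq_square)
      then show ?thesis using 3 unfolding e by (simp add: invexp_def algebra_simps power_add power2_eq_square)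
    qed
    then show ?thesis
      by (rule DERIV_cong_ev[THEN iffD1, rotated 3]) (use 3 in \<open>auto simp: invexp_def eventually_nhds intro!: exI[of _ "{0<..}"]\<close>)
  qed
qed

lemma smooth1_invexp: "smooth1 (invexp n)"
proof -
  have "Ck k (invexp n)" for k
  proof (induction k arbitrary: n)
    case (Suc k)
    have "Ck k (\<lambda>t. invexp (n+2) t + (- real n) * invexp (n+1) t)"
      by (intro Ck_add Ck_mult Ck_const Suc)
    then show ?case using invexp_DERIV[of n] by (intro Ck_SucI[of _ "\<lambda>t. invexp (n+2) t + (- real n) * invexp (n+1) t"]) auto
  qed auto
  then show ?thesis by (simp add: smooth1_def)
qed

lemma smooth1_mult: "smooth1 f \<Longrightarrow> smooth1 g \<Longrightarrow> smooth1 (\<lambda>t. f t * g t)"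
  and smooth1_affine: "smooth1 f \<Longrightarrow> smooth1 (\<lambda>t. f (a * t + b))"
  by (simp_all add: smooth1_def Ck_mult Ck_affine)

text \<open>A partial derivative changes only one factor, so products of smooth functions of one
  variable are stable under all iterated derivatives; this is how the condition on all lists in
  \<open>test_fun\<close> becomes checkable.\<close>

lemma pd_prod:
  fixes h :: "'n::finite \<Rightarrow> real \<Rightarrow> real"
  assumes "\<And>i. smooth1 (h i)"
  shows "pd j (\<lambda>x. \<Prod>i\<in>UNIV. h i (x $ i)) = (\<lambda>x. \<Prod>i\<in>UNIV. (h(j := deriv (h j))) i (x $ i))"
    and "(\<lambda>x::real^'n. \<Prod>i\<in>UNIV. h i (x $ i)) differentiable (at x)"
proof -
  have d: "((\<lambda>x::real^'n. \<Prod>i\<in>UNIV. h i (x $ i)) has_derivative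
     (\<lambda>y. \<Sum>i\<in>UNIV. deriv (h i) (x$i) * (y $ i) * (\<Prod>j\<in>UNIV - {i}. h j (x $ j)))) (at x)" for x
  proof (rule has_derivative_prod)
    fix i
    have "(h i has_derivative (\<lambda>y. deriv (h i) (x$i) * y)) (at (x$i))"
      using smooth1_deriv(1)[OF assms] by (simp add: has_field_derivative_def)
    moreover have "((\<lambda>x::real^'n. x $ i) has_derivative (\<lambda>y. y $ i)) (at x)"
      by (rule bounded_linear_imp_has_derivative) (rule bounded_linear_vec_nth)
    ultimately show "((\<lambda>x. h i (x $ i)) has_derivative (\<lambda>y. deriv (h i) (x$i) * y $ i)) (at x)"
      by (rule has_derivative_compose[rotated])
  qed
  then show "(\<lambda>x::real^'n. \<Prod>i\<in>UNIV. h i (x $ i)) differentiable (at x)"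
    by (rule differentiableI)
  show "pd j (\<lambda>x. \<Prod>i\<in>UNIV. h i (x $ i)) = (\<lambda>x. \<Prod>i\<in>UNIV. (h(j := deriv (h j))) i (x $ i))"
  proof
    fix x :: "real^'n"
    have "pd j (\<lambda>x. \<Prod>i\<in>UNIV. h i (x $ i)) x
       = (\<Sum>i\<in>UNIV. deriv (h i) (x$i) * (axis j 1 $ i) * (\<Prod>j\<in>UNIV - {i}. h j (x $ j)))"
      unfolding pd_def by (subst frechet_derivative_at[OF d, symmetric]) simp
    also have "\<dots> = (\<Sum>i\<in>{j}. deriv (h i) (x$i) * (axis j 1 $ i) * (\<Prod>j\<in>UNIV - {i}. h j (x $ j)))"
      by (rule sum.mono_neutral_right) (auto simp: axis_def)
    also have "\<dots> = (\<Prod>i\<in>UNIV. (h(j := deriv (h j))) i (x $ i))"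
      by (subst prod.remove[of _ j]) (auto simp: axis_def intro!: prod.cong)
    finally show "pd j (\<lambda>x. \<Prod>i\<in>UNIV. h i (x $ i)) x = (\<Prod>i\<in>UNIV. (h(j := deriv (h j))) i (x $ i))" .
  qed
qed

lemma test_fun_prod:
  fixes h :: "'n::finite \<Rightarrow> real \<Rightarrow> real"
  assumes h: "\<And>i. smooth1 (h i)" and supp: "\<And>i t. t \<notin> {a i..b i} \<Longrightarrow> h i t = 0"
  shows "test_fun (\<lambda>x::real^'n. \<Prod>i\<in>UNIV. h i (x $ i))"
proof -
  have *: "\<exists>k. (\<forall>i. smooth1 (k i)) \<and> iter_pd is (\<lambda>x. \<Prod>i\<in>UNIV. h i (x $ i)) = (\<lambda>x. \<Prod>i\<in>UNIV. k i (x $ i))" for "is"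
  proof (induction "is")
    case Nil
    then show ?case using h by auto
  next
    case (Cons j js)
    then obtain k where k: "\<And>i. smooth1 (k i)" "iter_pd js (\<lambda>x. \<Prod>i\<in>UNIV. h i (x $ i)) = (\<lambda>x. \<Prod>i\<in>UNIV. k i (x $ i))" by auto
    have "iter_pd (j#js) (\<lambda>x. \<Prod>i\<in>UNIV. h i (x $ i)) = (\<lambda>x. \<Prod>i\<in>UNIV. (k(j := deriv (k j))) i (x $ i))"
      unfolding iter_pd.simps k(2) by (rule pd_prod(1)[OF k(1)])
    moreover have "smooth1 ((k(j := deriv (k j))) i)" for i
      using k(1) smooth1_deriv(2) by simp
    ultimately show ?case by blast
  qed
  have "iter_pd is (\<lambda>x. \<Prod>i\<in>UNIV. h i (x $ i)) differentiable (at x)" for "is" x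
    using *[of "is"] pd_prod(2) by fastforce
  moreover have "compact (closure {x::real^'n. (\<Prod>i\<in>UNIV. h i (x $ i)) \<noteq> 0})"
  proof -
    have "{x::real^'n. (\<Prod>i\<in>UNIV. h i (x $ i)) \<noteq> 0} \<subseteq> cbox (\<chi> i. a i) (\<chi> i. b i)"
    proof safe
      fix x :: "real^'n" assume "(\<Prod>i\<in>UNIV. h i (x $ i)) \<noteq> 0"
      then have "h i (x$i) \<noteq> 0" for i by simp
      then have "x $ i \<in> {a i..b i}" for i using supp by blast
      then show "x \<in> cbox (\<chi> i. a i) (\<chi> i. b i)" by (simp add: mem_box_cart)
    qed
    then show ?thesis by (meson bounded_cbox bounded_subset compact_closure)
  qed
  ultimately show ?thesis by (simp add: test_fun_def)
qed

section \<open>Test functions and the fundamental lemma\<close>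

lemma iter_pd_append: "iter_pd (is @ js) f = iter_pd is (iter_pd js f)"
  by (induction "is") auto

lemma pd_eq_0:
  assumes "open S" "x \<in> S" "\<And>y. y \<in> S \<Longrightarrow> f y = 0"
  shows "pd i f x = 0"
proof -
  have "((\<lambda>y. 0) has_derivative (\<lambda>h. 0)) (at x)" by simp
  then have "(f has_derivative (\<lambda>h. 0)) (at x)"
    by (rule has_derivative_transform_within_open[OF _ assms(1,2)]) (use assms(3) in auto)
  then show ?thesis unfolding pd_def by (simp add: frechet_derivative_at[symmetric])
qed

lemma iter_pd_eq_0:
  assumes "open S" "\<And>y. y \<in> S \<Longrightarrow> f y = 0" "x \<in> S"
  shows "iter_pd is f x = 0"
  using assms(3)
  by (induction "is" arbitrary: x) (auto intro!: pd_eq_0[OF assms(1)] assms(2))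

text \<open>The complement of the closed support is open, so every iterated derivative vanishes
  there and supports do not grow.\<close>

lemma test_fun_iter_pd:
  assumes "test_fun \<phi>" shows "test_fun (iter_pd is \<phi>)"
proof -
  let ?C = "closure {x. \<phi> x \<noteq> 0}"
  have "iter_pd is \<phi> x = 0" if "x \<in> - ?C" for x
  proof (rule iter_pd_eq_0[of "- ?C"])
    show "\<phi> y = 0" if "y \<in> - ?C" for y using that closure_subset[of "{x. \<phi> x \<noteq> 0}"] by blast
  qed (use that in \<open>auto simp: open_Compl\<close>)
  then have "{x. iter_pd is \<phi> x \<noteq> 0} \<subseteq> ?C" by auto
  then have "closure {x. iter_pd is \<phi> x \<noteq> 0} \<subseteq> ?C" by (rule closure_minimal) simp
  then have "compact (closure {x. iter_pd is \<phi> x \<noteq> 0})"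
    using assms unfolding test_fun_def compact_eq_bounded_closed
    by (meson bounded_subset closed_closure)
  then show ?thesis using assms
    by (auto simp: test_fun_def iter_pd_append[symmetric])
qed

lemma test_fun_pd: "test_fun \<phi> \<Longrightarrow> test_fun (pd i \<phi>)"
  using test_fun_iter_pd[of \<phi> "[i]"] by simp

lemma test_fun_differentiable: "test_fun \<phi> \<Longrightarrow> \<phi> differentiable (at x)"
  unfolding test_fun_def by (metis iter_pd.simps(1))

lemma test_fun_continuous: "test_fun \<phi> \<Longrightarrow> continuous_on S \<phi>"
  using test_fun_differentiable[THEN differentiable_imp_continuous_within]
  by (auto intro: continuous_at_imp_continuous_on)

lemma test_fun_compact_supp:
  assumes "test_fun \<phi>"
  obtains K B where "compact K" "\<And>x. x \<notin> K \<Longrightarrow> \<phi> x = 0" "\<And>x. \<bar>\<phi> x\<bar> \<le> B"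
proof -
  let ?K = "closure {x. \<phi> x \<noteq> 0}"
  have K: "compact ?K" using assms by (simp add: test_fun_def)
  have z: "\<phi> x = 0" if "x \<notin> ?K" for x using that closure_subset[of "{x. \<phi> x \<noteq> 0}"] by blast
  have "compact (\<phi> ` ?K)" by (intro compact_continuous_image test_fun_continuous assms K)
  then obtain B where B: "\<And>y. y \<in> \<phi> ` ?K \<Longrightarrow> \<bar>y\<bar> \<le> B"
    by (metis compact_imp_bounded bounded_iff real_norm_def)
  have "\<bar>\<phi> x\<bar> \<le> max B 0" for x
    using B[of "\<phi> x"] z[of x] by (cases "x \<in> ?K") auto
  with K z show thesis using that by blast
qed

lemma loc_int_iff:
  "loc_int u \<longleftrightarrow> u \<in> borel_measurable lebesgue \<and> (\<forall>K. compact K \<longrightarrow> integrable lebesgue (\<lambda>x. indicator K x * u x))"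
  by (simp add: loc_int_def set_integrable_def)

lemma loc_int_mult_integrable:
  assumes v: "loc_int v" and K: "compact K" "\<And>x. x \<notin> K \<Longrightarrow> \<phi> x = 0" and B: "\<And>x. \<bar>\<phi> x\<bar> \<le> B"
    and m: "\<phi> \<in> borel_measurable lebesgue"
  shows "integrable lebesgue (\<lambda>x. v x * \<phi> x)"
proof (rule Bochner_Integration.integrable_bound)
  show "integrable lebesgue (\<lambda>x. B * (indicator K x * v x))"
    using v K by (intro integrable_mult_right) (simp add: loc_int_iff)
  show "(\<lambda>x. v x * \<phi> x) \<in> borel_measurable lebesgue"
    using v m by (auto simp: loc_int_iff)
  have "\<bar>v x * \<phi> x\<bar> \<le> \<bar>B * (indicator K x * v x)\<bar>" for x
  proof (cases "x \<in> K")
    case True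
    have "\<bar>v x\<bar> * \<bar>\<phi> x\<bar> \<le> \<bar>v x\<bar> * B" by (intro mult_left_mono B) auto
    also have "\<dots> \<le> \<bar>B * v x\<bar>" by (simp add: abs_mult mult.commute mult_right_mono)
    finally show ?thesis using True by (simp add: abs_mult)
  qed (use K in auto)
  then show "AE x in lebesgue. norm (v x * \<phi> x) \<le> norm (B * (indicator K x * v x))" by simp
qed

lemma test_fun_measurable: "test_fun \<phi> \<Longrightarrow> \<phi> \<in> borel_measurable borel"
  by (intro borel_measurable_continuous_onI test_fun_continuous)

lemma test_fun_measurable_lebesgue: "test_fun \<phi> \<Longrightarrow> \<phi> \<in> borel_measurable lebesgue"
  by (rule measurable_completion) (simp add: test_fun_measurable)

lemma loc_int_test_integrable:
  assumes v: "loc_int v" and t: "test_fun \<phi>"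
  shows "integrable lebesgue (\<lambda>x. v x * \<phi> x)"
proof -
  obtain K B where "compact K" "\<And>x. x \<notin> K \<Longrightarrow> \<phi> x = 0" "\<And>x. \<bar>\<phi> x\<bar> \<le> B"
    using test_fun_compact_supp[OF t] by blast
  then show ?thesis using loc_int_mult_integrable[OF v] test_fun_measurable_lebesgue[OF t] by blast
qed

text \<open>Open boxes form an intersection-stable generator of the Borel sets, so a Dynkin argument
  carries the vanishing of the integrals to all Borel sets. That \<open>F\<close> lives in one box
  gives the integral over the whole space, which the complement step consumes.\<close>

lemma integral_boxes_zero_imp_AE_zero:
  fixes F :: "'a::euclidean_space \<Rightarrow> real"
  assumes F: "integrable lborel F" and U: "\<And>x. x \<notin> box c d \<Longrightarrow> F x = 0"
    and box: "\<And>a b. (\<integral>x. indicator (box a b) x * F x \<partial>lborel) = 0"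
  shows "AE x in lborel. F x = 0"
proof (rule density_unique_real)
  show "integrable lborel F" "integrable lborel (\<lambda>x. 0)" using F by auto
  fix A :: "'a set" assume "A \<in> sets lborel"
  then have A: "A \<in> sigma_sets UNIV (range (\<lambda>(a, b). box a b :: 'a set))"
    by (simp add: borel_eq_box)
  have iS: "Int_stable (range (\<lambda>(a, b). box a b :: 'a set))"
    by (auto simp: Int_stable_def box_Int_box)
  have sub: "range (\<lambda>(a, b). box a b :: 'a set) \<subseteq> Pow UNIV" by simp
  have i: "integrable lborel (\<lambda>x. indicator A x * F x)" if "A \<in> sets borel" for A
    using integrable_mult_indicator[of A lborel F] F that by simp
  have UNIV: "(\<integral>x. F x \<partial>lborel) = 0"
  proof -
    have "(\<integral>x. F x \<partial>lborel) = (\<integral>x. indicator (box c d) x * F x \<partial>lborel)"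
      by (rule Bochner_Integration.integral_cong) (use U in \<open>auto simp: indicator_def\<close>)
    then show ?thesis using box by simp
  qed
  have sb: "sigma_sets UNIV (range (\<lambda>(a, b). box a b :: 'a set)) = sets borel"
    by (simp add: borel_eq_box)
  have "(\<integral>x. indicator A x * F x \<partial>lborel) = 0"
    using iS sub A
  proof (induction rule: sigma_sets_induct_disjoint)
    case (basic A) then show ?case using box by auto
  next
    case empty then show ?case by simp
  next
    case (compl A)
    then have [measurable]: "A \<in> sets borel" using sb by auto
    have "(\<integral>x. indicator (UNIV - A) x * F x \<partial>lborel) = (\<integral>x. F x - indicator A x * F x \<partial>lborel)"
      by (rule Bochner_Integration.integral_cong) (auto simp: indicator_def)
    also have "\<dots> = 0" using compl UNIV by (subst Bochner_Integration.integral_diff) (auto intro: F i)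
    finally show ?case .
  next
    case (union A)
    then have m: "A i \<in> sets lborel" for i using sb by auto
    have "set_integrable lborel (\<Union>i. A i) F"
      unfolding set_integrable_def using i[of "\<Union>i. A i"] m by auto
    then have "set_lebesgue_integral lborel (\<Union>i. A i) F = (\<Sum>i. set_lebesgue_integral lborel (A i) F)"
      using union(1) by (intro lebesgue_integral_countable_add m) (auto simp: disjoint_family_on_def)
    then show ?case using union by (simp add: set_lebesgue_integral_def)
  qed
  then show "set_lebesgue_integral lborel A F = set_lebesgue_integral lborel A (\<lambda>x. 0)"
    by (simp add: set_lebesgue_integral_def)
qed

text \<open>\<open>invexp 0 (c * s)\<close> vanishes for s \<le> 0 and tends to 1 as c grows for s >
  0. A product of such factors, one for each side of the box, stays between 0 and 1 and converges
  pointwise to the indicator of the open box.\<close>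

lemma bump_approx_box:
  fixes a b :: "real^'n::finite"
  obtains \<phi> :: "nat \<Rightarrow> real^'n \<Rightarrow> real" where "\<And>k. test_fun (\<phi> k)" "\<And>k x. \<bar>\<phi> k x\<bar> \<le> indicator (cbox a b) x"
    "\<And>x. (\<lambda>k. \<phi> k x) \<longlonglongrightarrow> indicator (box a b) x"
proof -
  \<comment> \<open>Both arguments are spelled in the shape \<open>a * t + b\<close> that
    \<open>smooth1_affine\<close> expects.\<close>
  define h where "h k i t = invexp 0 (real (Suc k) * t + - real (Suc k) * a $ i) * invexp 0 (- real (Suc k) * t + real (Suc k) * b $ i)" for k i t
  define \<phi> :: "nat \<Rightarrow> real^'n \<Rightarrow> real" where "\<phi> k x = (\<Prod>i\<in>UNIV. h k i (x $ i))" for k x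
  have sm: "smooth1 (h k i)" for k i
    unfolding h_def by (intro smooth1_mult smooth1_affine smooth1_invexp)
  have inv01: "0 \<le> invexp 0 t" "invexp 0 t \<le> 1" for t by (auto simp: invexp_def)
  have i0: "invexp 0 t = 0" if "t \<le> 0" for t using that by (simp add: invexp_def)
  have z1: "real (Suc k) * t + - real (Suc k) * s \<le> 0" if "t \<le> s" for k t s
    using mult_left_mono[OF that, of "real (Suc k)"] by (auto simp: algebra_simps)
  have z2: "- real (Suc k) * t + real (Suc k) * s \<le> 0" if "s \<le> t" for k t s
    using mult_left_mono[OF that, of "real (Suc k)"] by (auto simp: algebra_simps)
  have h0: "h k i t = 0" if "t \<le> a $ i \<or> b $ i \<le> t" for k i t
    using that i0[OF z1[of t "a$i" k]] i0[OF z2[of "b$i" t k]] unfolding h_def by auto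
  have h01: "0 \<le> h k i t" "h k i t \<le> 1" for k i t
    unfolding h_def using inv01 by (auto intro: mult_le_one)
  have conv: "(\<lambda>k. invexp 0 (real (Suc k) * s)) \<longlonglongrightarrow> 1" if "s > 0" for s
  proof -
    have "(\<lambda>k. exp (- (1 / s * inverse (real (Suc k))))) \<longlonglongrightarrow> exp (- (1 / s * 0))"
      by (intro tendsto_intros LIMSEQ_inverse_real_of_nat)
    moreover have "invexp 0 (real (Suc k) * s) = exp (- (1 / s * inverse (real (Suc k))))" for k
      using mult_pos_pos[OF that, of "real (Suc k)"] by (simp add: invexp_def divide_inverse mult.commute del: of_nat_Suc)
    ultimately show ?thesis by simp
  qed
  have hc: "(\<lambda>k. h k i t) \<longlonglongrightarrow> 1" if "a $ i < t" "t < b $ i" for i t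
  proof -
    have "(\<lambda>k. invexp 0 (real (Suc k) * (t - a $ i)) * invexp 0 (real (Suc k) * (b $ i - t))) \<longlonglongrightarrow> 1 * 1"
      by (intro tendsto_mult conv) (use that in auto)
    then show ?thesis by (simp add: h_def algebra_simps)
  qed
  have "test_fun (\<phi> k)" for k
    unfolding \<phi>_def by (rule test_fun_prod[OF sm, of "\<lambda>i. a $ i" "\<lambda>i. b $ i"]) (auto intro: h0)
  moreover have "\<bar>\<phi> k x\<bar> \<le> indicator (cbox a b) x" for k x
  proof (cases "x \<in> cbox a b")
    case True
    have "\<bar>\<phi> k x\<bar> \<le> 1" unfolding \<phi>_def abs_prod by (rule prod_le_1) (use h01 in auto)
    then show ?thesis using True by simp
  next
    case False
    then obtain i where "\<not> (a $ i \<le> x $ i \<and> x $ i \<le> b $ i)" by (auto simp: mem_box_cart)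
    then have "h k i (x $ i) = 0" using h0 by auto
    then show ?thesis unfolding \<phi>_def using False by (subst prod_zero_iff[THEN iffD2]) auto
  qed
  moreover have "(\<lambda>k. \<phi> k x) \<longlonglongrightarrow> indicator (box a b) x" for x
  proof (cases "x \<in> box a b")
    case True
    have "(\<lambda>k. \<phi> k x) \<longlonglongrightarrow> (\<Prod>i\<in>(UNIV::'n set). 1)"
      unfolding \<phi>_def using True by (intro tendsto_prod hc) (auto simp: mem_box_cart)
    then show ?thesis using True by simp
  next
    case False
    then obtain i where "\<not> (a $ i < x $ i \<and> x $ i < b $ i)" by (auto simp: mem_box_cart)
    then have "h k i (x $ i) = 0" for k using h0 by auto
    then have "\<phi> k x = 0" for k unfolding \<phi>_def by (subst prod_zero_iff) auto
    then show ?thesis using False by simp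
  qed
  ultimately show thesis using that by blast
qed

text \<open>The bumps of \<open>bump_approx_box\<close> are test functions, so dominated convergence
  gives vanishing integrals over all boxes, and those determine the function. Boxes are handled over
  \<open>lborel\<close>, hence the Borel representative \<open>G\<close>.\<close>

lemma AE_zero_if_test_integrals_zero:
  fixes F :: "real^'n::finite \<Rightarrow> real"
  assumes F: "loc_int F" and z: "\<And>\<phi>. test_fun \<phi> \<Longrightarrow> (\<integral>x. F x * \<phi> x \<partial>lebesgue) = 0"
  shows "AE x in lebesgue. F x = 0"
proof -
  obtain G where G[measurable]: "G \<in> borel_measurable lborel" and FG: "AE x in lborel. F x = G x"
    using completion_ex_borel_measurable_real[of F lborel] F unfolding loc_int_def by auto
  have FG': "AE x in lebesgue. F x = G x" using FG by (rule AE_completion)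
  have Gl[measurable]: "G \<in> borel_measurable lebesgue" using measurable_completion[OF G] .
  have Fm[measurable]: "F \<in> borel_measurable lebesgue" using F by (simp add: loc_int_def)
  have ic: "integrable lborel (\<lambda>x. indicator (cbox a b) x * G x)" for a b
  proof -
    have "integrable lebesgue (\<lambda>x. indicator (cbox a b) x * F x)" using F by (simp add: loc_int_iff)
    moreover have "integrable lebesgue (\<lambda>x. indicator (cbox a b) x * F x) \<longleftrightarrow> integrable lebesgue (\<lambda>x. indicator (cbox a b) x * G x)"
    proof (rule integrable_cong_AE)
      show "(\<lambda>x. indicator (cbox a b) x * F x) \<in> borel_measurable lebesgue"
        "(\<lambda>x. indicator (cbox a b) x * G x) \<in> borel_measurable lebesgue"
        by (intro borel_measurable_times borel_measurable_indicator Fm Gl; simp)+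
    qed (use FG' in auto)
    ultimately show ?thesis by (subst (asm) integrable_completion) auto
  qed
  have box0: "(\<integral>x. indicator (box a b) x * G x \<partial>lborel) = 0" for a b
  proof -
    obtain \<phi> where \<phi>: "\<And>k. test_fun (\<phi> k)" "\<And>k x. \<bar>\<phi> k x\<bar> \<le> indicator (cbox a b) x"
      "\<And>x. (\<lambda>k. \<phi> k x) \<longlonglongrightarrow> indicator (box a b) x" using bump_approx_box[of a b] by metis
    have [measurable]: "\<phi> k \<in> borel_measurable borel" for k by (rule test_fun_measurable[OF \<phi>(1)])
    have "(\<lambda>k. \<integral>x. \<phi> k x * G x \<partial>lborel) \<longlonglongrightarrow> (\<integral>x. indicator (box a b) x * G x \<partial>lborel)"
    proof (rule integral_dominated_convergence[where w="\<lambda>x. \<bar>indicator (cbox a b) x * G x\<bar>"])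
      show "integrable lborel (\<lambda>x. \<bar>indicator (cbox a b) x * G x\<bar>)" using ic by (intro integrable_abs)
      show "AE x in lborel. (\<lambda>k. \<phi> k x * G x) \<longlonglongrightarrow> indicator (box a b) x * G x"
        by (intro AE_I2 tendsto_mult \<phi> tendsto_const)
      show "AE x in lborel. norm (\<phi> k x * G x) \<le> \<bar>indicator (cbox a b) x * G x\<bar>" for k
        using mult_right_mono[OF \<phi>(2)] by (auto simp: abs_mult)
    qed auto
    moreover have "(\<integral>x. \<phi> k x * G x \<partial>lborel) = 0" for k
    proof -
      have "(\<integral>x. \<phi> k x * G x \<partial>lborel) = (\<integral>x. \<phi> k x * G x \<partial>lebesgue)"
        by (subst integral_completion) auto
      also have "\<dots> = (\<integral>x. F x * \<phi> k x \<partial>lebesgue)"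
        by (rule integral_cong_AE) (use FG' test_fun_measurable_lebesgue[OF \<phi>(1)] in auto)
      finally show ?thesis using z \<phi>(1) by simp
    qed
    ultimately show ?thesis by (simp add: LIMSEQ_const_iff)
  qed
  \<comment> \<open>\<open>G\<close> is only locally integrable, so the lemma on boxes is used on an
    exhausting sequence of boxes and the countably many null sets are united.\<close>
  have "AE x in lborel. \<forall>k::nat. indicator (box (- (real k *\<^sub>R One)) (real k *\<^sub>R One)) x * G x = 0"
    unfolding AE_all_countable
  proof
    fix k :: nat
    let ?B = "box (- (real k *\<^sub>R One)) (real k *\<^sub>R One) :: (real^'n) set"
    show "AE x in lborel. indicator ?B x * G x = 0"
    proof (rule integral_boxes_zero_imp_AE_zero)
      show "integrable lborel (\<lambda>x. indicator ?B x * G x)"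
        using ic[of "- (real k *\<^sub>R One)" "real k *\<^sub>R One"]
      proof (rule Bochner_Integration.integrable_bound)
        show "AE x in lborel. norm (indicator ?B x * G x) \<le> norm (indicator (cbox (- (real k *\<^sub>R One)) (real k *\<^sub>R One)) x * G x)"
          using box_subset_cbox[of "- (real k *\<^sub>R One)" "real k *\<^sub>R One :: real^'n"]
          by (intro AE_I2) (simp add: indicator_def subset_iff)
      qed simp
      show "indicator ?B x * G x = 0" if "x \<notin> ?B" for x using that by simp
      fix a b :: "real^'n"
      show "(\<integral>x. indicator (box a b) x * (indicator ?B x * G x) \<partial>lborel) = 0"
        using box0 by (simp add: box_Int_box mult.assoc[symmetric] indicator_inter_arith[symmetric])
    qed
  qed
  then have "AE x in lborel. G x = 0"
  proof eventually_elim
    case (elim x)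
    obtain k :: nat where k: "norm x < real k" using reals_Archimedean2 by blast
    have "- real k < x \<bullet> i \<and> x \<bullet> i < real k" if "i \<in> Basis" for i
      using k Basis_le_norm[OF that, of x] by linarith
    then have "x \<in> box (- (real k *\<^sub>R One)) (real k *\<^sub>R One)"
      by (simp add: mem_box)
    then show ?case using elim[rule_format, of k] by simp
  qed
  then have "AE x in lebesgue. G x = 0" by (rule AE_completion)
  with FG' show ?thesis by eventually_elim simp
qed

section \<open>Weak derivatives\<close>

lemma distr_lebesgue_plus: "distr lebesgue lebesgue (\<lambda>x. x + c) = (lebesgue :: 'a::euclidean_space measure)"
  and measurable_lebesgue_plus: "(\<lambda>x. x + c) \<in> lebesgue \<rightarrow>\<^sub>M (lebesgue :: 'a::euclidean_space measure)"
proof -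
  have *: "(\<lambda>x. c + (\<Sum>j\<in>Basis. (1 * (x \<bullet> j)) *\<^sub>R j)) = (\<lambda>x. x + c)"
    by (simp add: euclidean_representation add.commute)
  show "(\<lambda>x. x + c) \<in> lebesgue \<rightarrow>\<^sub>M (lebesgue :: 'a::euclidean_space measure)"
    using lebesgue_affine_measurable[of "\<lambda>_. 1" c] unfolding * by simp
  show "distr lebesgue lebesgue (\<lambda>x. x + c) = (lebesgue :: 'a::euclidean_space measure)"
    using lebesgue_affine_euclidean[of "\<lambda>_. 1" c] unfolding * by (simp add: density_1)
qed

lemma lebesgue_shift:
  fixes f :: "'a::euclidean_space \<Rightarrow> real"
  assumes f: "f \<in> borel_measurable lebesgue"
  shows "(\<lambda>x. f (x + c)) \<in> borel_measurable lebesgue"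
    and "integral\<^sup>L lebesgue (\<lambda>x. f (x + c)) = integral\<^sup>L lebesgue f"
    and "integrable lebesgue (\<lambda>x. f (x + c)) \<longleftrightarrow> integrable lebesgue f"
proof -
  show "(\<lambda>x. f (x + c)) \<in> borel_measurable lebesgue"
    using measurable_compose[OF measurable_lebesgue_plus f] .
  show "integral\<^sup>L lebesgue (\<lambda>x. f (x + c)) = integral\<^sup>L lebesgue f"
    using integral_distr[OF measurable_lebesgue_plus f] by (simp add: distr_lebesgue_plus)
  show "integrable lebesgue (\<lambda>x. f (x + c)) \<longleftrightarrow> integrable lebesgue f"
    using integrable_distr_eq[OF measurable_lebesgue_plus f] by (simp add: distr_lebesgue_plus)
qed

lemma AE_lebesgue_shift:
  assumes "AE x in lebesgue. P x"
  shows "AE x in (lebesgue :: 'a::euclidean_space measure). P (x + c)"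
proof -
  have "AE x in distr lebesgue lebesgue (\<lambda>x. x + c). P x"
    using assms unfolding distr_lebesgue_plus .
  then show ?thesis by (rule AE_distrD[OF measurable_lebesgue_plus])
qed

text \<open>\<open>frechet_derivative\<close> chooses some derivative, also where none exists. The
  equation holds at every point because both sides choose from the same set of candidates.\<close>

lemma pd_shift: "pd i (\<lambda>x. f (x + c)) = (\<lambda>x. pd i f (x + c))"
proof
  fix x
  have "((\<lambda>x. f (x + c)) has_derivative D) (at x) \<longleftrightarrow> (f has_derivative D) (at (x + c))" for D
  proof
    assume "((\<lambda>x. f (x + c)) has_derivative D) (at x)"
    then have "((\<lambda>x. f (x + c)) has_derivative D) (at ((x + c) + - c))" by simp
    moreover have "((\<lambda>x. x + - c) has_derivative (\<lambda>h. h)) (at (x + c))"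
      by (auto intro!: derivative_eq_intros)
    ultimately show "(f has_derivative D) (at (x + c))"
      using has_derivative_compose[of "\<lambda>x. x + - c" "\<lambda>h. h" "x + c" UNIV "\<lambda>x. f (x + c)" D] by simp
  next
    assume f: "(f has_derivative D) (at (x + c))"
    have "((\<lambda>x. x + c) has_derivative (\<lambda>h. h)) (at x)"
      by (auto intro!: derivative_eq_intros)
    from has_derivative_compose[OF this f]
    show "((\<lambda>x. f (x + c)) has_derivative D) (at x)" .
  qed
  then show "pd i (\<lambda>x. f (x + c)) x = pd i f (x + c)"
    by (simp add: pd_def frechet_derivative_def)
qed

lemma iter_pd_shift: "iter_pd is (\<lambda>x. f (x + c)) = (\<lambda>x. iter_pd is f (x + c))"
  by (induction "is") (simp_all add: pd_shift)

lemma test_fun_shift: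
  assumes "test_fun \<phi>" shows "test_fun (\<lambda>x. \<phi> (x + c))"
proof -
  have "(\<lambda>x. iter_pd is \<phi> (x + c)) differentiable (at x)" for "is" x
    using assms unfolding test_fun_def
    by (intro differentiable_compose[of "iter_pd is \<phi>" "\<lambda>x. x + c"]) (auto intro!: derivative_intros)
  moreover have "{x. \<phi> (x + c) \<noteq> 0} = (\<lambda>x. - c + x) ` {x. \<phi> x \<noteq> 0}"
    by (force simp: image_iff)
  then have "compact (closure {x. \<phi> (x + c) \<noteq> 0})"
    using assms compact_translation[of "closure {x. \<phi> x \<noteq> 0}" "- c"]
    unfolding test_fun_def by (metis closure_translation)
  ultimately show ?thesis by (simp add: test_fun_def iter_pd_shift)
qed

text \<open>If no list had multiplicities \<beta>, the equation in \<open>is_wderiv\<close> would be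
  vacuous and would not determine the derivative.\<close>

lemma ex_count_list:
  fixes \<beta> :: "'n::finite \<Rightarrow> nat"
  shows "\<exists>is. \<forall>i. count_list is i = \<beta> i"
proof -
  obtain xs where "mset xs = Abs_multiset \<beta>" using ex_mset by blast
  then have "count_list xs i = \<beta> i" for i
    by (metis count_Abs_multiset count_mset finite)
  then show ?thesis by blast
qed

lemma loc_int_lin:
  assumes "loc_int u" "loc_int v" shows "loc_int (\<lambda>x. a * u x + b * v x)"
proof -
  have "integrable lebesgue (\<lambda>x. indicator K x * (a * u x + b * v x))" if "compact K" for K
  proof -
    have "integrable lebesgue (\<lambda>x. a * (indicator K x * u x) + b * (indicator K x * v x))"
      using assms that by (auto simp: loc_int_iff)
    then show ?thesis by (simp add: algebra_simps)
  qed
  with assms show ?thesis by (auto simp: loc_int_iff)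
qed

lemma loc_int_shift:
  assumes u: "loc_int u" shows "loc_int (\<lambda>x. u (x + c))"
proof -
  have m: "u \<in> borel_measurable lebesgue" using u by (simp add: loc_int_def)
  have "integrable lebesgue (\<lambda>x. indicator K x * u (x + c))" if K: "compact K" for K
  proof -
    let ?K = "(\<lambda>x. c + x) ` K"
    have K': "compact ?K" using K by (rule compact_translation)
    then have "integrable lebesgue (\<lambda>x. indicator ?K x * u x)" using u by (simp add: loc_int_iff)
    moreover have "(\<lambda>x. indicator ?K x * u x) \<in> borel_measurable lebesgue"
      using K' m by (intro borel_measurable_times borel_measurable_indicator) (auto simp: compact_imp_closed borel_closed)
    ultimately have "integrable lebesgue (\<lambda>x. indicator ?K (x + c) * u (x + c))"
      by (subst lebesgue_shift(3)[of "\<lambda>x. indicator ?K x * u x"]) auto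
    moreover have "indicator ?K (x + c) = (indicator K x :: real)" for x
      by (auto simp: indicator_def image_iff add.commute)
    ultimately show ?thesis by simp
  qed
  then show ?thesis using lebesgue_shift(1)[OF m] by (simp add: loc_int_iff)
qed

lemma loc_int_cong_AE:
  assumes "loc_int u" "AE x in lebesgue. u x = u' x" shows "loc_int u'"
proof -
  have m: "u \<in> borel_measurable lebesgue" using assms by (simp add: loc_int_def)
  have m': "u' \<in> borel_measurable lebesgue" by (rule borel_measurable_AE[OF m assms(2)])
  have "integrable lebesgue (\<lambda>x. indicator K x * u' x)" if "compact K" for K
  proof -
    have K: "K \<in> sets lebesgue" using that by (simp add: compact_imp_closed borel_closed)
    have "integrable lebesgue (\<lambda>x. indicator K x * u x)" using that assms by (simp add: loc_int_iff)
    moreover have "integrable lebesgue (\<lambda>x. indicator K x * u x) \<longleftrightarrow> integrable lebesgue (\<lambda>x. indicator K x * u' x)"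
      by (rule integrable_cong_AE) (use assms(2) K m m' in auto)
    ultimately show ?thesis by simp
  qed
  with m' show ?thesis by (simp add: loc_int_iff)
qed

text \<open>This is what permits the passage between the choice \<open>wd\<close> and Borel
  representatives.\<close>

lemma is_wderiv_cong_AE:
  fixes u :: "real^'n::finite \<Rightarrow> real"
  assumes "is_wderiv \<beta> u v" "AE x in lebesgue. u x = u' x" "AE x in lebesgue. v x = v' x"
  shows "is_wderiv \<beta> u' v'"
proof -
  have l: "loc_int u" "loc_int v" "loc_int u'" "loc_int v'"
    using assms loc_int_cong_AE by (auto simp: is_wderiv_def)
  have eq: "(\<integral>x. f x * \<phi> x \<partial>lebesgue) = (\<integral>x. f' x * \<phi> x \<partial>lebesgue)"
    if "AE x in lebesgue. f x = f' x" "loc_int f" "loc_int f'" "test_fun \<phi>" for f f' \<phi>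
    using loc_int_test_integrable[OF that(2,4)] loc_int_test_integrable[OF that(3,4)] that(1)
    by (intro integral_cong_AE) auto
  show ?thesis unfolding is_wderiv_def
  proof (intro conjI allI impI l)
    fix \<phi> :: "real^'n \<Rightarrow> real" and "is" assume t: "test_fun \<phi>" "\<forall>i. count_list is i = \<beta> i"
    then have "(\<integral>x. u x * iter_pd is \<phi> x \<partial>lebesgue) = (-1) ^ mi_abs \<beta> * (\<integral>x. v x * \<phi> x \<partial>lebesgue)"
      using assms by (simp add: is_wderiv_def)
    then show "(\<integral>x. u' x * iter_pd is \<phi> x \<partial>lebesgue) = (-1) ^ mi_abs \<beta> * (\<integral>x. v' x * \<phi> x \<partial>lebesgue)"
      using eq[OF assms(2) l(1,3) test_fun_iter_pd[OF t(1)]] eq[OF assms(3) l(2,4) t(1)] by simp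
  qed
qed

lemma is_wderiv_lin:
  fixes u :: "real^'n::finite \<Rightarrow> real"
  assumes "is_wderiv \<beta> u v" "is_wderiv \<beta> u' v'"
  shows "is_wderiv \<beta> (\<lambda>x. a * u x + b * u' x) (\<lambda>x. a * v x + b * v' x)"
proof -
  have l: "loc_int u" "loc_int v" "loc_int u'" "loc_int v'"
    using assms by (auto simp: is_wderiv_def)
  have eq: "(\<integral>x. (a * f x + b * f' x) * \<phi> x \<partial>lebesgue) = a * (\<integral>x. f x * \<phi> x \<partial>lebesgue) + b * (\<integral>x. f' x * \<phi> x \<partial>lebesgue)"
    if "loc_int f" "loc_int f'" "test_fun \<phi>" for f f' \<phi>
  proof -
    have "(\<integral>x. (a * f x + b * f' x) * \<phi> x \<partial>lebesgue) = (\<integral>x. a * (f x * \<phi> x) + b * (f' x * \<phi> x) \<partial>lebesgue)"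
      by (simp add: algebra_simps)
    then show ?thesis using loc_int_test_integrable[OF that(1,3)] loc_int_test_integrable[OF that(2,3)] by simp
  qed
  show ?thesis unfolding is_wderiv_def
  proof (intro conjI allI impI loc_int_lin l)
    fix \<phi> :: "real^'n \<Rightarrow> real" and "is" assume t: "test_fun \<phi>" "\<forall>i. count_list is i = \<beta> i"
    then have "(\<integral>x. u x * iter_pd is \<phi> x \<partial>lebesgue) = (-1) ^ mi_abs \<beta> * (\<integral>x. v x * \<phi> x \<partial>lebesgue)"
      "(\<integral>x. u' x * iter_pd is \<phi> x \<partial>lebesgue) = (-1) ^ mi_abs \<beta> * (\<integral>x. v' x * \<phi> x \<partial>lebesgue)"
      using assms by (simp_all add: is_wderiv_def)
    then show "(\<integral>x. (a * u x + b * u' x) * iter_pd is \<phi> x \<partial>lebesgue) = (-1) ^ mi_abs \<beta> * (\<integral>x. (a * v x + b * v' x) * \<phi> x \<partial>lebesgue)"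
      using eq[OF l(1,3) test_fun_iter_pd[OF t(1)]] eq[OF l(2,4) t(1)] by (simp add: algebra_simps)
  qed
qed

lemma is_wderiv_shift:
  fixes u :: "real^'n::finite \<Rightarrow> real"
  assumes "is_wderiv \<beta> u v"
  shows "is_wderiv \<beta> (\<lambda>x. u (x + c)) (\<lambda>x. v (x + c))"
proof -
  have l: "loc_int u" "loc_int v" using assms by (auto simp: is_wderiv_def)
  have eq: "(\<integral>x. f (x + c) * \<phi> x \<partial>lebesgue) = (\<integral>x. f x * \<phi> (x + - c) \<partial>lebesgue)"
    if "loc_int f" "test_fun \<phi>" for f \<phi> :: "real^'n \<Rightarrow> real"
  proof -
    have "(\<lambda>x. f x * \<phi> (x + - c)) \<in> borel_measurable lebesgue"
      using loc_int_test_integrable[OF that(1) test_fun_shift[OF that(2)], of "- c"] by (rule borel_measurable_integrable)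
    from lebesgue_shift(2)[OF this, of c] show ?thesis by simp
  qed
  show ?thesis unfolding is_wderiv_def
  proof (intro conjI allI impI loc_int_shift l)
    fix \<phi> :: "real^'n \<Rightarrow> real" and "is" assume t: "test_fun \<phi>" "\<forall>i. count_list is i = \<beta> i"
    have "(\<integral>x. u x * iter_pd is (\<lambda>x. \<phi> (x + - c)) x \<partial>lebesgue) = (-1) ^ mi_abs \<beta> * (\<integral>x. v x * \<phi> (x + - c) \<partial>lebesgue)"
      using assms test_fun_shift[OF t(1)] t(2) unfolding is_wderiv_def by blast
    then show "(\<integral>x. u (x + c) * iter_pd is \<phi> x \<partial>lebesgue) = (-1) ^ mi_abs \<beta> * (\<integral>x. v (x + c) * \<phi> x \<partial>lebesgue)"
      using eq[OF l(1) test_fun_iter_pd[OF t(1)]] eq[OF l(2) t(1)] unfolding iter_pd_shift by simp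
  qed
qed

text \<open>Two candidates have equal integrals against every test function, so the fundamental
  lemma applies to their difference.\<close>

lemma is_wderiv_unique:
  fixes u :: "real^'n::finite \<Rightarrow> real"
  assumes "is_wderiv \<beta> u v" "is_wderiv \<beta> u v'"
  shows "AE x in lebesgue. v x = v' x"
proof -
  obtain "is" where "is": "\<forall>i. count_list is i = \<beta> i" using ex_count_list by blast
  have l: "loc_int v" "loc_int v'" using assms by (auto simp: is_wderiv_def)
  have "AE x in lebesgue. 1 * v x + (-1) * v' x = 0"
  proof (rule AE_zero_if_test_integrals_zero[OF loc_int_lin[OF l]])
    fix \<phi> :: "real^'n \<Rightarrow> real" assume t: "test_fun \<phi>"
    have "(-1) ^ mi_abs \<beta> * (\<integral>x. v x * \<phi> x \<partial>lebesgue) = (-1) ^ mi_abs \<beta> * (\<integral>x. v' x * \<phi> x \<partial>lebesgue)"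
    proof -
      have "(-1) ^ mi_abs \<beta> * (\<integral>x. f x * \<phi> x \<partial>lebesgue) = (\<integral>x. u x * iter_pd is \<phi> x \<partial>lebesgue)"
        if "is_wderiv \<beta> u f" for f
        using that[unfolded is_wderiv_def] t "is" by simp
      from this[OF assms(1)] this[OF assms(2)] show ?thesis by simp
    qed
    then have "(\<integral>x. v x * \<phi> x \<partial>lebesgue) = (\<integral>x. v' x * \<phi> x \<partial>lebesgue)" by simp
    moreover have "(\<integral>x. (1 * v x + (-1) * v' x) * \<phi> x \<partial>lebesgue) = (\<integral>x. v x * \<phi> x - v' x * \<phi> x \<partial>lebesgue)"
      by (simp add: algebra_simps)
    ultimately show "(\<integral>x. (1 * v x + (-1) * v' x) * \<phi> x \<partial>lebesgue) = 0"
      using loc_int_test_integrable[OF l(1) t] loc_int_test_integrable[OF l(2) t] by simp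
  qed
  then show ?thesis by eventually_elim simp
qed

lemma wd_is_wderiv: "is_wderiv \<beta> u v \<Longrightarrow> is_wderiv \<beta> u (wd \<beta> u)"
  unfolding wd_def by (rule someI[of "is_wderiv \<beta> u"])

lemma wd_AE_eq: "is_wderiv \<beta> u v \<Longrightarrow> AE x in lebesgue. wd \<beta> u x = v x"
  using is_wderiv_unique wd_is_wderiv by blast

text \<open>The derivative of order \<open>\<alpha>\<close> of a test function is again a test function, so it may be used
to test the equation for \<open>v\<close>.\<close>

lemma is_wderiv_deriv:
  fixes u :: "real^'n::finite \<Rightarrow> real"
  assumes "is_wderiv \<alpha> u v" "is_wderiv (\<lambda>i. \<alpha> i + \<beta> i) u g"
  shows "is_wderiv \<beta> v g"
proof -
  obtain js where js: "\<forall>i. count_list js i = \<alpha> i" using ex_count_list by blast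
  have mi: "mi_abs (\<lambda>i. \<alpha> i + \<beta> i) = mi_abs \<alpha> + mi_abs \<beta>" by (simp add: mi_abs_def sum.distrib)
  show ?thesis unfolding is_wderiv_def
  proof (intro conjI allI impI)
    show "loc_int v" "loc_int g" using assms by (auto simp: is_wderiv_def)
    fix \<phi> :: "real^'n \<Rightarrow> real" and "is" assume t: "test_fun \<phi>" "\<forall>i. count_list is i = \<beta> i"
    have "(\<integral>x. u x * iter_pd js (iter_pd is \<phi>) x \<partial>lebesgue) = (-1) ^ mi_abs \<alpha> * (\<integral>x. v x * iter_pd is \<phi> x \<partial>lebesgue)"
      using assms(1) test_fun_iter_pd[OF t(1), of "is"] js unfolding is_wderiv_def by blast
    moreover have "(\<integral>x. u x * iter_pd (js @ is) \<phi> x \<partial>lebesgue) = (-1) ^ mi_abs (\<lambda>i. \<alpha> i + \<beta> i) * (\<integral>x. g x * \<phi> x \<partial>lebesgue)"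
      using assms(2) t js unfolding is_wderiv_def by (simp add: count_list_append)
    ultimately have "(-1) ^ mi_abs \<alpha> * (\<integral>x. v x * iter_pd is \<phi> x \<partial>lebesgue) = (-1) ^ mi_abs \<alpha> * ((-1) ^ mi_abs \<beta> * (\<integral>x. g x * \<phi> x \<partial>lebesgue))"
      unfolding mi iter_pd_append by (simp add: power_add)
    then show "(\<integral>x. v x * iter_pd is \<phi> x \<partial>lebesgue) = (-1) ^ mi_abs \<beta> * (\<integral>x. g x * \<phi> x \<partial>lebesgue)"
      by simp
  qed
qed

lemma in_Lp_cong_AE:
  assumes "in_Lp p u" "AE x in lebesgue. u x = v x" shows "in_Lp p v"
proof -
  have m: "u \<in> borel_measurable lebesgue" using assms by (simp add: in_Lp_def)
  have m': "v \<in> borel_measurable lebesgue" by (rule borel_measurable_AE[OF m assms(2)])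
  have "integrable lebesgue (\<lambda>x. \<bar>u x\<bar> powr p) \<longleftrightarrow> integrable lebesgue (\<lambda>x. \<bar>v x\<bar> powr p)"
    by (rule integrable_cong_AE) (use assms m m' in auto)
  with assms m' show ?thesis by (simp add: in_Lp_def)
qed

section \<open>Hoelder's inequality and the grid-line inequality\<close>

text \<open>The convention \<open>x powr 0 = 1\<close> also at \<open>x = 0\<close> and \<open>x = top\<close> keeps the exponents
law valid for all nonnegative exponents.\<close>

definition epow :: "ennreal \<Rightarrow> real \<Rightarrow> ennreal" where
  "epow x a = (if a = 0 then 1 else if x = top then top else ennreal (enn2real x powr a))"

lemma epow_0 [simp]: "epow x 0 = 1"
  and epow_top: "a \<noteq> 0 \<Longrightarrow> epow top a = top"
  and epow_zero: "a \<noteq> 0 \<Longrightarrow> epow 0 a = 0"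
  and epow_ennreal: "0 \<le> r \<Longrightarrow> a \<noteq> 0 \<Longrightarrow> epow (ennreal r) a = ennreal (r powr a)"
  by (auto simp: epow_def)

lemma epow_1 [simp]: "epow x 1 = x"
  by (cases x) (auto simp: epow_def)

lemma epow_add:
  assumes "0 \<le> a" "0 \<le> b" shows "epow x (a + b) = epow x a * epow x b"
proof (cases "a = 0 \<or> b = 0")
  case False
  then have "a > 0" "b > 0" using assms by auto
  then show ?thesis
    by (cases x) (auto simp: epow_top epow_ennreal powr_add ennreal_mult[symmetric])
qed auto

lemma epow_mult:
  assumes "0 \<le> a" "x \<noteq> top" "y \<noteq> top" shows "epow (x * y) a = epow x a * epow y a"
  using assms
  by (cases x; cases y; cases "a = 0") (auto simp: ennreal_mult[symmetric] epow_ennreal powr_mult)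

lemma epow_mono:
  assumes "0 \<le> a" "x \<le> y" shows "epow x a \<le> epow y a"
proof (cases "a = 0 \<or> y = top")
  case True
  then show ?thesis by (cases "a = 0") (auto simp: epow_top)
next
  case False
  then obtain r s where "x = ennreal r" "y = ennreal s" "0 \<le> r" "0 \<le> s" "r \<le> s"
    using assms(2) by (cases x; cases y) (auto simp: top_unique)
  then show ?thesis using False assms by (auto simp: epow_ennreal intro!: ennreal_leI powr_mono2)
qed

lemma epow_eq_0_iff: "0 \<le> a \<Longrightarrow> epow x a = 0 \<longleftrightarrow> x = 0 \<and> a \<noteq> 0"
  by (cases x; cases "a = 0") (auto simp: epow_top epow_ennreal)

lemma borel_measurable_epow [measurable]: "(\<lambda>x. epow x a) \<in> borel_measurable borel"
  unfolding epow_def by measurable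

lemma measurable_epow [measurable (raw)]:
  "f \<in> borel_measurable M \<Longrightarrow> (\<lambda>x. epow (f x) a) \<in> borel_measurable M"
  by (rule measurable_compose[OF _ borel_measurable_epow])

section \<open>Weighted means and Hoelder's inequality for several factors\<close>

lemma weighted_amgm_pos:
  fixes x :: "'i \<Rightarrow> real"
  assumes "finite S" "\<And>i. i \<in> S \<Longrightarrow> 0 \<le> a i" "(\<Sum>i\<in>S. a i) = 1" "\<And>i. i \<in> S \<Longrightarrow> 0 < x i"
  shows "(\<Prod>i\<in>S. x i powr a i) \<le> (\<Sum>i\<in>S. a i * x i)"
proof -
  have "(\<Prod>i\<in>S. x i powr a i) = (\<Prod>i\<in>S. exp (a i * ln (x i)))"
    using assms(4) by (intro prod.cong refl) (metis powr_def less_irrefl)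
  also have "\<dots> = exp (\<Sum>i\<in>S. a i *\<^sub>R ln (x i))"
    using assms(1) by (simp add: exp_sum)
  \<comment> \<open>Jensen's inequality for exp at the points \<open>ln (x i)\<close>.\<close>
  also have "\<dots> \<le> (\<Sum>i\<in>S. a i * exp (ln (x i)))"
    using assms by (intro convex_on_sum[OF _ _ exp_convex]) auto
  also have "\<dots> = (\<Sum>i\<in>S. a i * x i)" using assms(4) by (intro sum.cong) auto
  finally show ?thesis .
qed

text \<open>Strict positivity of the weights settles the boundary values: a zero factor annihilates
  the product, and an infinite entry makes the sum infinite.\<close>

lemma weighted_amgm_epow:
  assumes S: "finite S" "\<And>i. i \<in> S \<Longrightarrow> 0 < a i" "(\<Sum>i\<in>S. a i) = 1"
  shows "(\<Prod>i\<in>S. epow (x i) (a i)) \<le> (\<Sum>i\<in>S. ennreal (a i) * x i)"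
proof -
  consider i where "i \<in> S" "x i = 0" | i where "i \<in> S" "x i = top" | "\<forall>i\<in>S. x i \<noteq> 0 \<and> x i \<noteq> top" by blast
  then show ?thesis
  proof cases
    case (1 i)
    then have "epow (x i) (a i) = 0" using S(2)[of i] by (simp add: epow_zero)
    then have "(\<Prod>i\<in>S. epow (x i) (a i)) = 0" using 1 S(1) by (intro prod_zero bexI[of _ i]) auto
    then show ?thesis by (simp only: zero_le)
  next
    case (2 i)
    then have "ennreal (a i) * x i = top" using S(2)[of i] by (simp add: ennreal_mult_top)
    then have "(\<Sum>i\<in>S. ennreal (a i) * x i) = top" using 2 S(1) by (subst sum.remove[of _ i]) auto
    then show ?thesis by simp
  next
    case 3
    define r where "r i = enn2real (x i)" for i
    have r: "x i = ennreal (r i)" "r i > 0" if "i \<in> S" for i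
      using 3 that unfolding r_def by (auto simp: enn2real_positive_iff top.not_eq_extremum zero_less_iff_neq_zero)
    have "(\<Prod>i\<in>S. epow (x i) (a i)) = (\<Prod>i\<in>S. ennreal (r i powr a i))"
      by (intro prod.cong refl) (use r S(2) in \<open>fastforce simp: epow_ennreal\<close>)
    also have "\<dots> = ennreal (\<Prod>i\<in>S. r i powr a i)" by (rule prod_ennreal) auto
    also have "\<dots> \<le> ennreal (\<Sum>i\<in>S. a i * r i)"
      using S r by (intro ennreal_leI weighted_amgm_pos) (auto intro: less_imp_le)
    also have "\<dots> = (\<Sum>i\<in>S. ennreal (a i * r i))" using S r by (intro sum_ennreal[symmetric]) (auto intro: less_imp_le)
    also have "\<dots> = (\<Sum>i\<in>S. ennreal (a i) * x i)"
      using S r by (intro sum.cong refl) (auto simp: ennreal_mult less_imp_le)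
    finally show ?thesis .
  qed
qed

text \<open>After normalising every factor to integral 1, the inequality is the integrated weighted
  mean inequality. What remains are the cases in which some integral is 0 or infinite.\<close>

lemma Holder_nn_integral_prod:
  fixes F :: "'i \<Rightarrow> 'a \<Rightarrow> ennreal"
  assumes S: "finite S" "\<And>i. i \<in> S \<Longrightarrow> 0 \<le> a i" "(\<Sum>i\<in>S. a i) = 1"
    and F[measurable]: "\<And>i. i \<in> S \<Longrightarrow> F i \<in> borel_measurable M"
  shows "(\<integral>\<^sup>+x. (\<Prod>i\<in>S. epow (F i x) (a i)) \<partial>M) \<le> (\<Prod>i\<in>S. epow (\<integral>\<^sup>+x. F i x \<partial>M) (a i))"
proof -
  \<comment> \<open>Factors of weight 0 equal 1 on both sides by the convention for
    \<open>epow\<close>, so only positive weights are kept.\<close>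
  define T where "T = {i\<in>S. a i > 0}"
  have T: "finite T" "T \<subseteq> S" "\<And>i. i \<in> T \<Longrightarrow> 0 < a i" using S(1) by (auto simp: T_def)
  have az: "a i = 0" if "i \<in> S - T" for i using that S(2)[of i] by (auto simp: T_def)
  have sT: "(\<Sum>i\<in>T. a i) = 1"
    using S(3) sum.mono_neutral_left[OF S(1) T(2), of a] az by simp
  have pT: "(\<Prod>i\<in>S. epow (g i) (a i)) = (\<Prod>i\<in>T. epow (g i) (a i))" for g :: "'i \<Rightarrow> ennreal"
    by (rule prod.mono_neutral_right[OF S(1) T(2)]) (simp add: az)
  define I where "I i = (\<integral>\<^sup>+x. F i x \<partial>M)" for i
  have "(\<integral>\<^sup>+x. (\<Prod>i\<in>T. epow (F i x) (a i)) \<partial>M) \<le> (\<Prod>i\<in>T. epow (I i) (a i))"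
  proof -
    consider (zero) i where "i \<in> T" "I i = 0" | (top) i where "i \<in> T" "I i = top" "\<forall>i\<in>T. I i \<noteq> 0"
      | (fin) "\<forall>i\<in>T. I i \<noteq> 0 \<and> I i \<noteq> top" by blast
    then show ?thesis
    proof cases
      case zero
      then have [measurable]: "F i \<in> borel_measurable M" using T by auto
      have "AE x in M. F i x = 0" using zero unfolding I_def by (subst (asm) nn_integral_0_iff_AE) auto
      then have "AE x in M. (\<Prod>i\<in>T. epow (F i x) (a i)) = 0"
      proof eventually_elim
        case (elim x)
        then show ?case using zero T(1) T(3)[of i] by (intro prod_zero) (auto simp: epow_zero intro!: bexI[of _ i])
      qed
      then have "(\<integral>\<^sup>+x. (\<Prod>i\<in>T. epow (F i x) (a i)) \<partial>M) = (\<integral>\<^sup>+x. 0 \<partial>M)"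
        by (intro nn_integral_cong_AE) auto
      then show ?thesis by simp
    next
      case top
      have "epow (I j) (a j) \<noteq> 0" if "j \<in> T" for j using top that T(3)[of j] by (simp add: epow_eq_0_iff)
      then have "(\<Prod>j\<in>T - {i}. epow (I j) (a j)) \<noteq> 0" using T(1) by (simp add: prod_zero_iff)
      then have "(\<Prod>i\<in>T. epow (I i) (a i)) = top"
        using top T(3)[of i] by (subst prod.remove[OF T(1), of i]) (auto simp: epow_top ennreal_top_mult)
      then show ?thesis by simp
    next
      case fin
      \<comment> \<open>Normalising constants: \<open>c i * F i\<close> has integral 1, so the
        integral of the weighted sum is the sum of the weights.\<close>
      define c where "c i = inverse (I i)" for i
      have c: "I i * c i = 1" "c i \<noteq> top" if i: "i \<in> T" for i
      proof -
        obtain r where "I i = ennreal r" "0 < r"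
          using fin[THEN bspec, OF i] by (cases "I i") (auto simp: ennreal_eq_0_iff not_le)
        then show "I i * c i = 1" "c i \<noteq> top"
          unfolding c_def by (simp_all add: inverse_ennreal ennreal_mult[symmetric])
      qed
      have "(\<Prod>i\<in>T. epow (F i x) (a i)) \<le> (\<Prod>i\<in>T. epow (I i) (a i)) * (\<Sum>i\<in>T. ennreal (a i) * (c i * F i x))" for x
      proof -
        \<comment> \<open>\<open>epow_mult\<close> is limited to finite arguments; where
          \<open>F i x\<close> is infinite both sides are infinite.\<close>
        have eq: "epow (F i x) (a i) = epow (I i) (a i) * epow (c i * F i x) (a i)" if "i \<in> T" for i
        proof (cases "F i x = top")
          case True
          have "c i \<noteq> 0" using c(1)[OF that] by auto
          then have "c i * F i x = top" using True by (simp add: ennreal_mult_top)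
          moreover have "epow (I i) (a i) \<noteq> 0" using fin that T(3)[OF that] by (simp add: epow_eq_0_iff)
          ultimately show ?thesis using True T(3)[OF that] by (simp add: epow_top ennreal_mult_top)
        next
          case False
          have "F i x = I i * (c i * F i x)" using c(1)[OF that] by (simp add: mult.assoc[symmetric])
          also have "epow \<dots> (a i) = epow (I i) (a i) * epow (c i * F i x) (a i)"
            using False fin c that T(3)[OF that] by (intro epow_mult) (auto simp: ennreal_mult_eq_top_iff)
          finally show ?thesis .
        qed
        have "(\<Prod>i\<in>T. epow (F i x) (a i)) = (\<Prod>i\<in>T. epow (I i) (a i)) * (\<Prod>i\<in>T. epow (c i * F i x) (a i))"
          unfolding prod.distrib[symmetric] by (intro prod.cong refl eq)
        also have "\<dots> \<le> (\<Prod>i\<in>T. epow (I i) (a i)) * (\<Sum>i\<in>T. ennreal (a i) * (c i * F i x))"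
          by (intro mult_left_mono weighted_amgm_epow T sT) auto
        finally show ?thesis .
      qed
      then have "(\<integral>\<^sup>+x. (\<Prod>i\<in>T. epow (F i x) (a i)) \<partial>M)
         \<le> (\<integral>\<^sup>+x. (\<Prod>i\<in>T. epow (I i) (a i)) * (\<Sum>i\<in>T. ennreal (a i) * (c i * F i x)) \<partial>M)"
        by (intro nn_integral_mono) auto
      also have "\<dots> = (\<Prod>i\<in>T. epow (I i) (a i)) * (\<integral>\<^sup>+x. (\<Sum>i\<in>T. ennreal (a i) * (c i * F i x)) \<partial>M)"
        using F T(2) by (intro nn_integral_cmult borel_measurable_sum borel_measurable_times) auto
      also have "(\<integral>\<^sup>+x. (\<Sum>i\<in>T. ennreal (a i) * (c i * F i x)) \<partial>M) = (\<Sum>i\<in>T. \<integral>\<^sup>+x. ennreal (a i) * (c i * F i x) \<partial>M)"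
        using F T(2) by (intro nn_integral_sum borel_measurable_times) auto
      also have "\<dots> = (\<Sum>i\<in>T. ennreal (a i) * (c i * I i))"
        using F T(2) unfolding I_def
        by (intro sum.cong refl) (auto simp: nn_integral_cmult subset_iff)
      also have "\<dots> = (\<Sum>i\<in>T. ennreal (a i))"
        by (intro sum.cong refl) (simp add: c mult.commute)
      also have "\<dots> = ennreal 1" using T sT by (subst sum_ennreal) (auto intro: less_imp_le)
      finally show ?thesis by simp
    qed
  qed
  then show ?thesis unfolding pT I_def .
qed

section \<open>Integration over a set of coordinates\<close>

interpretation lborel_real: product_sigma_finite "\<lambda>_::'i. lborel :: real measure"
  by unfold_locales

definition subst_comp :: "'a::euclidean_space set \<Rightarrow> ('a \<Rightarrow> real) \<Rightarrow> 'a \<Rightarrow> 'a" where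
  "subst_comp s z x = (\<Sum>b\<in>Basis. (if b \<in> s then z b else x \<bullet> b) *\<^sub>R b)"

text \<open>The result is again a function on the full space, constant in the coordinates of
  \<open>s\<close>. Thus the induction on \<open>s\<close> stays within one type, and
  \<open>s = Basis\<close> gives the full integral.\<close>

definition marginal :: "'a::euclidean_space set \<Rightarrow> ('a \<Rightarrow> ennreal) \<Rightarrow> 'a \<Rightarrow> ennreal" where
  "marginal s f x = (\<integral>\<^sup>+z. f (subst_comp s z x) \<partial>(\<Pi>\<^sub>M b\<in>s. lborel))"

text \<open>The line is parametrised from x itself; by translation invariance the value does not
  depend on the position of x along \<open>b\<close>, as \<open>line_int_shift\<close>
  records.\<close>

definition line_int :: "'a::euclidean_space \<Rightarrow> ('a \<Rightarrow> ennreal) \<Rightarrow> 'a \<Rightarrow> ennreal" where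
  "line_int b f x = (\<integral>\<^sup>+t. f (x + t *\<^sub>R b) \<partial>lborel)"

lemma subst_comp_inner: "b \<in> Basis \<Longrightarrow> subst_comp s z x \<bullet> b = (if b \<in> s then z b else x \<bullet> b)"
  unfolding subst_comp_def by simp

lemma measurable_subst_comp [measurable]:
  "(\<lambda>z. subst_comp s z x) \<in> (\<Pi>\<^sub>M b\<in>s. lborel) \<rightarrow>\<^sub>M (borel :: 'a::euclidean_space measure)"
  unfolding subst_comp_def
proof (intro borel_measurable_sum borel_measurable_scaleR borel_measurable_const)
  fix b :: 'a
  show "(\<lambda>z. if b \<in> s then z b else x \<bullet> b) \<in> borel_measurable (\<Pi>\<^sub>M b\<in>s. lborel)"
    using measurable_component_singleton[of b s "\<lambda>_. lborel :: real measure"] by (cases "b \<in> s") auto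
qed

lemma marginal_Basis: 
  fixes f :: "'a::euclidean_space \<Rightarrow> ennreal"
  assumes [measurable]: "f \<in> borel_measurable borel"
  shows "marginal Basis f x = (\<integral>\<^sup>+x. f x \<partial>lborel)"
proof -
  have "(\<integral>\<^sup>+x. f x \<partial>lborel) = (\<integral>\<^sup>+z. f (\<Sum>b\<in>Basis. z b *\<^sub>R b) \<partial>(\<Pi>\<^sub>M b\<in>(Basis::'a set). lborel))"
    by (subst lborel_eq, subst nn_integral_distr) auto
  then show ?thesis by (simp add: marginal_def subst_comp_def cong: sum.cong)
qed

lemma marginal_empty: "marginal {} f x = f x"
  by (simp add: marginal_def subst_comp_def euclidean_representation space_PiM_empty)

lemma measurable_line_int [measurable]:
  assumes [measurable]: "f \<in> borel_measurable borel"
  shows "line_int b f \<in> borel_measurable borel"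
  unfolding line_int_def by measurable

lemma line_int_shift:
  assumes [measurable]: "f \<in> borel_measurable borel"
  shows "line_int b f (x + c *\<^sub>R b) = line_int b f x"
proof -
  have "line_int b f x = (\<integral>\<^sup>+t. f (x + t *\<^sub>R b) \<partial>distr lborel borel ((+) c))"
    unfolding line_int_def lborel_distr_plus ..
  also have "\<dots> = (\<integral>\<^sup>+t. f (x + (c + t) *\<^sub>R b) \<partial>lborel)"
    by (rule nn_integral_distr) auto
  finally show ?thesis by (simp add: line_int_def algebra_simps scaleR_add_left)
qed

lemma line_int_commute:
  assumes [measurable]: "f \<in> borel_measurable borel"
  shows "line_int a (line_int b f) x = line_int b (line_int a f) x"
proof -
  have "(\<integral>\<^sup>+t. (\<integral>\<^sup>+s. f (x + t *\<^sub>R a + s *\<^sub>R b) \<partial>lborel) \<partial>lborel) = (\<integral>\<^sup>+s. (\<integral>\<^sup>+t. f (x + t *\<^sub>R a + s *\<^sub>R b) \<partial>lborel) \<partial>lborel)"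
    by (rule lborel_pair.Fubini') measurable
  then show ?thesis by (simp add: line_int_def add.assoc add.commute add.left_commute)
qed

lemma marginal_insert:
  assumes [measurable]: "f \<in> borel_measurable borel" and s: "b \<notin> s" "insert b s \<subseteq> Basis"
  shows "marginal (insert b s) f x = marginal s (line_int b f) x"
proof -
  have fin: "finite s" using s finite_subset[OF _ finite_Basis] by auto
  have "marginal (insert b s) f x = (\<integral>\<^sup>+z. (\<integral>\<^sup>+t. f (subst_comp (insert b s) (z(b := t)) x) \<partial>lborel) \<partial>(\<Pi>\<^sub>M b\<in>s. lborel))"
    unfolding marginal_def by (rule lborel_real.product_nn_integral_insert[OF fin s(1)]) measurable
  also have "\<dots> = (\<integral>\<^sup>+z. line_int b f (subst_comp s z x) \<partial>(\<Pi>\<^sub>M b\<in>s. lborel))"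
  proof (rule nn_integral_cong)
    fix z
    \<comment> \<open>Replacing the coordinate along \<open>b\<close> by t is a translation along
      \<open>b\<close>, which \<open>line_int\<close> does not see.\<close>
    have "subst_comp (insert b s) (z(b := t)) x = (subst_comp s z x + (- (x \<bullet> b)) *\<^sub>R b) + t *\<^sub>R b" for t
      by (rule euclidean_eqI) (use s in \<open>auto simp: subst_comp_inner inner_add_left inner_diff_left inner_Basis\<close>)
    then have "(\<integral>\<^sup>+t. f (subst_comp (insert b s) (z(b := t)) x) \<partial>lborel) = line_int b f (subst_comp s z x + (- (x \<bullet> b)) *\<^sub>R b)"
      unfolding line_int_def by simp
    then show "(\<integral>\<^sup>+t. f (subst_comp (insert b s) (z(b := t)) x) \<partial>lborel) = line_int b f (subst_comp s z x)"
      using line_int_shift[OF assms(1)] by metis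
  qed
  finally show ?thesis by (simp add: marginal_def)
qed

lemma marginal_mono: "(\<And>x. f x \<le> g x) \<Longrightarrow> marginal s f x \<le> marginal s g x"
  unfolding marginal_def by (intro nn_integral_mono) auto

text \<open>The induction integrates out one coordinate at a time; all the factors that
do not depend on it come out, and Hoelder's inequality applies to the others.\<close>

lemma marginal_grid_lines:
  fixes f :: "'a::euclidean_space \<Rightarrow> ennreal"
  assumes "finite s" "s \<subseteq> Basis" "0 \<le> \<kappa>" "(real (card s) - 1) * \<kappa> \<le> 1" "f \<in> borel_measurable borel"
  shows "marginal s (\<lambda>x. epow (f x) (1 - (real (card s) - 1) * \<kappa>) * (\<Prod>b\<in>s. epow (line_int b f x) \<kappa>)) x
    \<le> epow (marginal s f x) (1 + \<kappa>)"
  using assms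
proof (induction s arbitrary: f rule: finite_induct)
  case empty
  then show ?case by (simp add: marginal_empty)
next
  case (insert b s)
  note [measurable] = insert.prems(4)
  let ?k = "real (card s)"
  have k: "?k * \<kappa> \<le> 1" using insert by simp
  have k1: "(?k - 1) * \<kappa> \<le> 1" using k insert.prems(2) by (simp add: algebra_simps)
  have b: "b \<in> Basis" and s: "s \<subseteq> Basis" using insert by auto
  define G where "G x = epow (f x) (1 - ?k * \<kappa>) * (\<Prod>c\<in>insert b s. epow (line_int c f x) \<kappa>)" for x
  have Gm[measurable]: "G \<in> borel_measurable borel" unfolding G_def by measurable
  have "line_int b G x \<le> epow (line_int b f x) (1 - (?k - 1) * \<kappa>) * (\<Prod>c\<in>s. epow (line_int c (line_int b f) x) \<kappa>)" for x
  proof -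
    \<comment> \<open>\<open>None\<close> stands for f with exponent 1 - k \<kappa>,
      \<open>Some c\<close> for the line integral in direction c with exponent \<kappa>. There are k
      of the latter, so the exponents sum to 1.\<close>
    define F where "F i = (\<lambda>t. case i of None \<Rightarrow> f (x + t *\<^sub>R b) | Some c \<Rightarrow> line_int c f (x + t *\<^sub>R b))" for i
    define e where "e i = (case i of None \<Rightarrow> 1 - ?k * \<kappa> | Some (c::'a) \<Rightarrow> \<kappa>)" for i
    let ?S = "insert None (Some ` s)"
    have Fm: "F i \<in> borel_measurable lborel" for i
      unfolding F_def by (cases i) (simp_all, measurable)
    have p: "(\<Prod>i\<in>?S. epow (g i) (e i)) = epow (g None) (1 - ?k * \<kappa>) * (\<Prod>c\<in>s. epow (g (Some c)) \<kappa>)"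
      for g :: "'a option \<Rightarrow> ennreal"
      using insert.hyps(1) by (subst prod.insert) (auto simp: prod.reindex e_def)
    have "line_int b G x = (\<integral>\<^sup>+t. epow (line_int b f x) \<kappa> * (\<Prod>i\<in>?S. epow (F i t) (e i)) \<partial>lborel)"
      unfolding line_int_def[of b G] G_def p F_def using insert.hyps
      by (intro nn_integral_cong) (simp add: line_int_shift mult_ac)
    also have "\<dots> = epow (line_int b f x) \<kappa> * (\<integral>\<^sup>+t. (\<Prod>i\<in>?S. epow (F i t) (e i)) \<partial>lborel)"
      using Fm by (intro nn_integral_cmult borel_measurable_prod_ennreal measurable_epow)
    also have "\<dots> \<le> epow (line_int b f x) \<kappa> * (\<Prod>i\<in>?S. epow (\<integral>\<^sup>+t. F i t \<partial>lborel) (e i))"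
    proof (intro mult_left_mono Holder_nn_integral_prod Fm)
      show "finite ?S" using insert by simp
      show "0 \<le> e i" if "i \<in> ?S" for i using that k insert.prems(2) by (auto simp: e_def)
      show "(\<Sum>i\<in>?S. e i) = 1"
        using insert.hyps(1) by (subst sum.insert) (auto simp: sum.reindex e_def)
    qed simp
    also have "\<dots> = epow (line_int b f x) \<kappa> * epow (line_int b f x) (1 - ?k * \<kappa>) * (\<Prod>c\<in>s. epow (line_int c (line_int b f) x) \<kappa>)"
      unfolding p using line_int_commute[OF insert.prems(4), of b] by (simp add: F_def line_int_def mult.assoc)
    \<comment> \<open>The factor in direction \<open>b\<close> is constant along the line and was
      taken out before Hoelder. Its exponent \<kappa> is added back here, which produces the
      exponent of the induction hypothesis for \<open>line_int b f\<close>.\<close>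
    also have "epow (line_int b f x) \<kappa> * epow (line_int b f x) (1 - ?k * \<kappa>) = epow (line_int b f x) (1 - (?k - 1) * \<kappa>)"
      using k insert.prems(2) by (subst epow_add[symmetric]) (auto simp: algebra_simps)
    finally show ?thesis .
  qed
  then have "marginal s (line_int b G) x \<le> marginal s (\<lambda>x. epow (line_int b f x) (1 - (?k - 1) * \<kappa>) * (\<Prod>c\<in>s. epow (line_int c (line_int b f) x) \<kappa>)) x"
    by (rule marginal_mono)
  also have "\<dots> \<le> epow (marginal s (line_int b f) x) (1 + \<kappa>)"
    by (rule insert.IH[OF s insert.prems(2) k1]) measurable
  finally have "marginal (insert b s) G x \<le> epow (marginal (insert b s) f x) (1 + \<kappa>)"
    using insert by (simp add: marginal_insert)
  then show ?case using insert.hyps by (simp add: G_def[abs_def])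
qed

text \<open>With \<kappa> = 1/(N-1) and all N coordinates the exponent 1 - (N-1) \<kappa> of f
  itself is 0, so that only the line integrals are left.\<close>

lemma Gagliardo_Nirenberg_grid:
  fixes f :: "'a::euclidean_space \<Rightarrow> ennreal"
  assumes N: "2 \<le> DIM('a)" and [measurable]: "f \<in> borel_measurable borel"
  shows "(\<integral>\<^sup>+x. (\<Prod>b\<in>Basis. epow (line_int b f x) (1 / (real DIM('a) - 1))) \<partial>lborel)
     \<le> epow (\<integral>\<^sup>+x. f x \<partial>lborel) (real DIM('a) / (real DIM('a) - 1))"
proof -
  let ?N = "real DIM('a)"
  have "(\<integral>\<^sup>+x. (\<Prod>b\<in>Basis. epow (line_int b f x) (1 / (?N - 1))) \<partial>lborel)
    = marginal Basis (\<lambda>x. epow (f x) (1 - (?N - 1) * (1 / (?N - 1))) * (\<Prod>b\<in>Basis. epow (line_int b f x) (1 / (?N - 1)))) 0"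
    using N by (subst marginal_Basis) auto
  also have "\<dots> \<le> epow (marginal Basis f 0) (1 + 1 / (?N - 1))"
    using N by (intro marginal_grid_lines) auto
  also have "\<dots> = epow (\<integral>\<^sup>+x. f x \<partial>lborel) (?N / (?N - 1))"
    using N by (simp add: marginal_Basis field_simps)
  finally show ?thesis .
qed

lemma lborel_shift_nn:
  fixes f :: "'a::euclidean_space \<Rightarrow> ennreal"
  assumes [measurable]: "f \<in> borel_measurable borel"
  shows "(\<integral>\<^sup>+x. f (x + c) \<partial>lborel) = (\<integral>\<^sup>+x. f x \<partial>lborel)"
proof -
  have "(\<integral>\<^sup>+x. f x \<partial>lborel) = (\<integral>\<^sup>+x. f x \<partial>distr lborel borel ((+) c))" unfolding lborel_distr_plus ..
  also have "\<dots> = (\<integral>\<^sup>+x. f (c + x) \<partial>lborel)" by (rule nn_integral_distr) auto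
  finally show ?thesis by (simp add: add.commute)
qed

lemma lborel_shift:
  fixes f :: "'a::euclidean_space \<Rightarrow> real"
  assumes [measurable]: "f \<in> borel_measurable borel"
  shows "(\<integral>x. f (x + c) \<partial>lborel) = (\<integral>x. f x \<partial>lborel)"
    and "integrable lborel (\<lambda>x. f (x + c)) \<longleftrightarrow> integrable lborel f"
proof -
  have "(\<integral>x. f x \<partial>lborel) = (\<integral>x. f x \<partial>distr lborel borel ((+) c))" unfolding lborel_distr_plus ..
  also have "\<dots> = (\<integral>x. f (c + x) \<partial>lborel)" by (rule integral_distr) auto
  finally show "(\<integral>x. f (x + c) \<partial>lborel) = (\<integral>x. f x \<partial>lborel)" by (simp add: add.commute)
  have "integrable lborel f \<longleftrightarrow> integrable (distr lborel borel ((+) c)) f" unfolding lborel_distr_plus ..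
  also have "\<dots> \<longleftrightarrow> integrable lborel (\<lambda>x. f (c + x))" by (rule integrable_distr_eq) auto
  finally show "integrable lborel (\<lambda>x. f (x + c)) \<longleftrightarrow> integrable lborel f" by (simp add: add.commute)
qed

text \<open>Mean value theorem on the interval between A and B; interior points are positive, where
  \<open>powr\<close> is differentiable.\<close>

lemma powr_diff_bound:
  fixes A B c :: real
  assumes "0 \<le> A" "0 \<le> B" "1 < c"
  shows "\<bar>A powr c - B powr c\<bar> \<le> \<bar>A - B\<bar> * (c * max A B powr (c - 1))"
proof -
  have *: "\<bar>A powr c - B powr c\<bar> \<le> \<bar>A - B\<bar> * (c * B powr (c - 1))" if AB: "0 \<le> A" "A < B" for A B
  proof -
    have "continuous_on {A..B} (\<lambda>x. x powr c)"
      using assms AB by (intro continuous_on_powr') (auto intro!: continuous_intros)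
    moreover have d: "((\<lambda>x. x powr c) has_real_derivative c * x powr (c - 1)) (at x)" if "A < x" for x
      using that AB by (intro has_real_derivative_powr) auto
    ultimately obtain l z where z: "A < z" "z < B" "DERIV (\<lambda>x. x powr c) z :> l" "B powr c - A powr c = (B - A) * l"
      using MVT[of A B "\<lambda>x. x powr c"] AB by (meson differentiableI has_field_derivative_imp_has_derivative real_differentiable_def)
    have l: "l = c * z powr (c - 1)" using DERIV_unique[OF z(3) d[OF z(1)]] .
    have "l \<le> c * B powr (c - 1)"
      unfolding l using z AB assms by (intro mult_left_mono powr_mono2) auto
    moreover have "0 \<le> l" unfolding l using assms by simp
    ultimately show ?thesis using z(4) AB
      by (smt (verit, best) mult_left_mono mult_nonneg_nonneg)
  qed
  consider "A < B" | "B < A" | "A = B" by linarith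
  then show ?thesis
    using *[of A B] *[of B A] assms by cases (auto simp: max_def abs_minus_commute)
qed

section \<open>Absolute continuity along lines\<close>

text \<open>A one-sided chain rule for \<Phi> along the absolutely continuous h, where \<Phi> has
  only the local Lipschitz weight \<psi>. On intervals so short that \<psi> composed with h varies
  by less than e, the Lipschitz bound gives the claim with \<psi> + e. The left side telescopes and
  the right side is additive, so bisection glues the short intervals; at the end e tends to
  0.\<close>

lemma chain_inequality:
  fixes g \<Phi> \<psi> h :: "real \<Rightarrow> real"
  assumes T: "0 \<le> T" and g: "g absolutely_integrable_on {0..T}"
    and h: "\<And>t. 0 \<le> t \<Longrightarrow> t \<le> T \<Longrightarrow> h t = h0 + integral {0..t} g"
    and \<Phi>: "\<And>a b. \<bar>\<Phi> a - \<Phi> b\<bar> \<le> \<bar>a - b\<bar> * max (\<psi> a) (\<psi> b)"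
    and \<psi>: "continuous_on UNIV \<psi>" "\<And>s. 0 \<le> \<psi> s"
  shows "(\<lambda>s. \<psi> (h s) * \<bar>g s\<bar>) integrable_on {0..T}"
    and "\<Phi> (h 0) - \<Phi> (h T) \<le> integral {0..T} (\<lambda>s. \<psi> (h s) * \<bar>g s\<bar>)"
proof -
  have gi: "g integrable_on {0..T}" using g by (rule absolutely_integrable_on_def[THEN iffD1, THEN conjunct1])
  have ag: "(\<lambda>s. \<bar>g s\<bar>) absolutely_integrable_on {0..T}" using absolutely_integrable_norm[OF g] by (simp add: o_def)
  have "continuous_on {0..T} (\<lambda>t. h0 + integral {0..t} g)"
    by (intro continuous_intros indefinite_integral_continuous_1 gi)
  then have ch: "continuous_on {0..T} h"
    by (rule continuous_on_eq) (use h in auto)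
  have c\<psi>: "continuous_on {0..T} (\<lambda>s. \<psi> (h s))"
    using continuous_on_compose[OF ch continuous_on_subset[OF \<psi>(1)]] by (simp add: o_def)
  have int: "(\<lambda>s. (\<psi> (h s) + e) * \<bar>g s\<bar>) integrable_on {0..T}" for e
  proof -
    have "(\<lambda>s. (\<psi> (h s) + e) * \<bar>g s\<bar>) absolutely_integrable_on {0..T}"
    proof (rule absolutely_integrable_bounded_measurable_product_real[OF _ _ _ ag])
      have c: "continuous_on {0..T} (\<lambda>s. \<psi> (h s) + e)" by (intro continuous_intros c\<psi>)
      then show "(\<lambda>s. \<psi> (h s) + e) \<in> borel_measurable (lebesgue_on {0..T})"
        by (rule continuous_imp_measurable_on_sets_lebesgue) simp
      show "bounded ((\<lambda>s. \<psi> (h s) + e) ` {0..T})"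
        using compact_continuous_image[OF c] compact_imp_bounded by blast
    qed simp
    then show ?thesis by (rule absolutely_integrable_on_def[THEN iffD1, THEN conjunct1])
  qed
  show int0: "(\<lambda>s. \<psi> (h s) * \<bar>g s\<bar>) integrable_on {0..T}" using int[of 0] by simp
  have hd: "\<bar>h a - h b\<bar> \<le> integral {a..b} (\<lambda>s. \<bar>g s\<bar>)" if "0 \<le> a" "a \<le> b" "b \<le> T" for a b
  proof -
    have sub: "{a..b} \<subseteq> {0..T}" "{0..b} \<subseteq> {0..T}" using that by auto
    have "integral {0..a} g + integral {a..b} g = integral {0..b} g"
      by (intro Henstock_Kurzweil_Integration.integral_combine integrable_subinterval_real[OF gi] that sub)
    then have "\<bar>h a - h b\<bar> = \<bar>integral {a..b} g\<bar>" using that h[of a] h[of b] by simp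
    also have "\<dots> \<le> integral {a..b} (\<lambda>s. \<bar>g s\<bar>)"
      using integral_norm_bound_integral[of g "{a..b}" "\<lambda>s. \<bar>g s\<bar>"] integrable_subinterval_real[OF gi sub(1)]
        integrable_subinterval_real[OF absolutely_integrable_on_def[THEN iffD1, THEN conjunct1, OF ag] sub(1)] by simp
    finally show ?thesis .
  qed
  have main: "\<Phi> (h 0) - \<Phi> (h T) \<le> integral {0..T} (\<lambda>s. (\<psi> (h s) + e) * \<bar>g s\<bar>)" if e: "e > 0" for e
  proof -
    \<comment> \<open>The guards 0 \<le> a and b \<le> T are part of \<open>P\<close> because the
      bisection principle asks for the local property on all short intervals, including those that
      leave {0..T}.\<close>
    define P where "P a b \<longleftrightarrow> (0 \<le> a \<longrightarrow> b \<le> T \<longrightarrow> \<Phi> (h a) - \<Phi> (h b) \<le> integral {a..b} (\<lambda>s. (\<psi> (h s) + e) * \<bar>g s\<bar>))" for a b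
    have "P 0 T"
      using T
    proof (induction rule: Bolzano[where P=P])
      case (trans a b c)
      show ?case unfolding P_def
      proof (intro impI)
        assume b: "0 \<le> a" "c \<le> T"
        have "integral {a..b} (\<lambda>s. (\<psi> (h s) + e) * \<bar>g s\<bar>) + integral {b..c} (\<lambda>s. (\<psi> (h s) + e) * \<bar>g s\<bar>)
           = integral {a..c} (\<lambda>s. (\<psi> (h s) + e) * \<bar>g s\<bar>)"
          using b trans by (intro Henstock_Kurzweil_Integration.integral_combine integrable_subinterval_real[OF int]) auto
        then show "\<Phi> (h a) - \<Phi> (h c) \<le> integral {a..c} (\<lambda>s. (\<psi> (h s) + e) * \<bar>g s\<bar>)"
          using trans b by (auto simp: P_def)
      qed
    next
      case (local x)
      obtain d where d: "d > 0" "\<And>y. y \<in> {0..T} \<Longrightarrow> dist y x < d \<Longrightarrow> dist (\<psi> (h y)) (\<psi> (h x)) < e / 2"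
        using c\<psi> local e unfolding continuous_on_iff by (metis atLeastAtMost_iff half_gt_zero)
      show ?case unfolding P_def
      proof (intro exI conjI allI impI)
        fix a b assume ab: "a \<le> x \<and> x \<le> b \<and> b - a < d" and b: "0 \<le> a" "b \<le> T"
        have sub: "{a..b} \<subseteq> {0..T}" using b by auto
        have near: "\<bar>\<psi> (h y) - \<psi> (h x)\<bar> < e / 2" if "y \<in> {a..b}" for y
          using d(2)[of y] that ab b by (auto simp: dist_real_def)
        define m where "m = max (\<psi> (h a)) (\<psi> (h b))"
        \<comment> \<open>The endpoints and s are all within e/2 of the value at x, so the maximum
          over the endpoints exceeds the value at s by less than e.\<close>
        have m: "m \<le> \<psi> (h s) + e" if "s \<in> {a..b}" for s
        proof -
          have "a \<in> {a..b}" "b \<in> {a..b}" using ab by auto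
          then show ?thesis using near[of a] near[of b] near[OF that] unfolding m_def by linarith
        qed
        have "\<Phi> (h a) - \<Phi> (h b) \<le> \<bar>h a - h b\<bar> * m" using \<Phi>[of "h a" "h b"] unfolding m_def by linarith
        also have "\<dots> \<le> integral {a..b} (\<lambda>s. \<bar>g s\<bar>) * m"
          using ab b \<psi>(2) by (intro mult_right_mono hd) (auto simp: m_def le_max_iff_disj)
        also have "\<dots> = integral {a..b} (\<lambda>s. \<bar>g s\<bar> * m)" by simp
        also have "\<dots> \<le> integral {a..b} (\<lambda>s. (\<psi> (h s) + e) * \<bar>g s\<bar>)"
        proof (rule integral_le)
          show "(\<lambda>s. \<bar>g s\<bar> * m) integrable_on {a..b}"
            using integrable_subinterval_real[OF absolutely_integrable_on_def[THEN iffD1, THEN conjunct1, OF ag] sub]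
            by (intro integrable_on_mult_left)
          show "(\<lambda>s. (\<psi> (h s) + e) * \<bar>g s\<bar>) integrable_on {a..b}"
            by (rule integrable_subinterval_real[OF int sub])
          show "\<bar>g s\<bar> * m \<le> (\<psi> (h s) + e) * \<bar>g s\<bar>" if "s \<in> {a..b}" for s
            using mult_right_mono[OF m[OF that], of "\<bar>g s\<bar>"] by (simp add: mult.commute)
        qed
        finally show "\<Phi> (h a) - \<Phi> (h b) \<le> integral {a..b} (\<lambda>s. (\<psi> (h s) + e) * \<bar>g s\<bar>)" .
      qed (use d in auto)
    qed
    then show ?thesis by (simp add: P_def)
  qed
  show "\<Phi> (h 0) - \<Phi> (h T) \<le> integral {0..T} (\<lambda>s. \<psi> (h s) * \<bar>g s\<bar>)"
  proof (rule field_le_epsilon)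
    fix \<delta> :: real assume \<delta>: "0 < \<delta>"
    define G where "G = integral {0..T} (\<lambda>s. \<bar>g s\<bar>)"
    have agi: "(\<lambda>s. \<bar>g s\<bar>) integrable_on {0..T}" by (rule absolutely_integrable_on_def[THEN iffD1, THEN conjunct1, OF ag])
    have G: "0 \<le> G" unfolding G_def by (intro integral_nonneg agi) auto
    define e where "e = \<delta> / (G + 1)"
    have e: "e > 0" "e * G \<le> \<delta>" using G \<delta> by (auto simp: e_def field_simps)
    have "integral {0..T} (\<lambda>s. (\<psi> (h s) + e) * \<bar>g s\<bar>) = integral {0..T} (\<lambda>s. \<psi> (h s) * \<bar>g s\<bar> + e * \<bar>g s\<bar>)"
      by (simp add: algebra_simps)
    also have "\<dots> = integral {0..T} (\<lambda>s. \<psi> (h s) * \<bar>g s\<bar>) + e * G"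
      unfolding G_def using int0 agi by (subst integral_add) (auto intro: integrable_on_mult_right)
    finally show "\<Phi> (h 0) - \<Phi> (h T) \<le> integral {0..T} (\<lambda>s. \<psi> (h s) * \<bar>g s\<bar>) + \<delta>"
      using main[OF e(1)] e(2) by linarith
  qed
qed

text \<open>Justifies Fubini on a strip of translates. The parameter c is 1 or 0, so the statement
  covers both a majorant that moves with s and one that stays fixed.\<close>

lemma strip_integrable:
  fixes F :: "real \<Rightarrow> 'a::euclidean_space \<Rightarrow> real" and a :: "'a \<Rightarrow> real"
  assumes m[measurable]: "(\<lambda>(s, x). F s x) \<in> borel_measurable (lborel \<Otimes>\<^sub>M lborel)"
    and a: "integrable lborel a"
    and F: "\<And>s x. \<bar>F s x\<bar> \<le> indicator {0..t} s * \<bar>a (x + (c * s) *\<^sub>R e)\<bar>"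
  shows "integrable (lborel \<Otimes>\<^sub>M lborel) (\<lambda>(s, x). F s x)"
proof (rule integrableI_bounded)
  have [measurable]: "a \<in> borel_measurable borel" using a by auto
  show "(\<lambda>(s, x). F s x) \<in> borel_measurable (lborel \<Otimes>\<^sub>M lborel)" by (rule m)
  have "(\<integral>\<^sup>+z. ennreal (norm (case z of (s, x) \<Rightarrow> F s x)) \<partial>(lborel \<Otimes>\<^sub>M lborel))
      = (\<integral>\<^sup>+s. \<integral>\<^sup>+x. ennreal (norm (F s x)) \<partial>lborel \<partial>lborel)"
    by (subst lborel.nn_integral_fst[symmetric]) (auto simp: case_prod_beta)
  also have "\<dots> \<le> (\<integral>\<^sup>+s. \<integral>\<^sup>+x. indicator {0..t} s * ennreal \<bar>a (x + (c * s) *\<^sub>R e)\<bar> \<partial>lborel \<partial>lborel)"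
  proof (intro nn_integral_mono)
    fix s x
    show "ennreal (norm (F s x)) \<le> indicator {0..t} s * ennreal \<bar>a (x + (c * s) *\<^sub>R e)\<bar>"
      using ennreal_leI[OF F[of s x]] by (auto simp: indicator_def split: if_splits)
  qed
  also have "\<dots> = (\<integral>\<^sup>+s. indicator {0..t} s * (\<integral>\<^sup>+x. ennreal \<bar>a x\<bar> \<partial>lborel) \<partial>lborel)"
    by (intro nn_integral_cong) (simp add: nn_integral_cmult lborel_shift_nn[of "\<lambda>x. ennreal \<bar>a x\<bar>"])
  also have "\<dots> = emeasure lborel {0..t} * (\<integral>\<^sup>+x. ennreal \<bar>a x\<bar> \<partial>lborel)"
    by (subst nn_integral_multc) auto
  also have "\<dots> < \<infinity>"
    using a by (auto simp: ennreal_mult_less_top integrable_iff_bounded emeasure_lborel_Icc_eq)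
  finally show "(\<integral>\<^sup>+z. ennreal (norm (case z of (s, x) \<Rightarrow> F s x)) \<partial>(lborel \<Otimes>\<^sub>M lborel)) < \<infinity>" .
qed

lemma test_fun_axis_deriv:
  assumes "test_fun \<phi>"
  shows "((\<lambda>s. \<phi> (x - s *\<^sub>R axis i 1)) has_vector_derivative - pd i \<phi> (x - s *\<^sub>R axis i 1)) (at s within S)"
proof -
  let ?D = "frechet_derivative \<phi> (at (x - s *\<^sub>R axis i 1))"
  have D: "(\<phi> has_derivative ?D) (at (x - s *\<^sub>R axis i 1))"
    using test_fun_differentiable[OF assms] frechet_derivative_works by blast
  have "((\<lambda>s. x - s *\<^sub>R axis i 1) has_derivative (\<lambda>h. - (h *\<^sub>R axis i 1))) (at s within S)"
    by (auto intro!: derivative_eq_intros)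
  from has_derivative_compose[OF this D]
  have "((\<lambda>s. \<phi> (x - s *\<^sub>R axis i 1)) has_derivative (\<lambda>h. ?D (- (h *\<^sub>R axis i 1)))) (at s within S)" .
  moreover have "?D (- (h *\<^sub>R axis i 1)) = h *\<^sub>R (- pd i \<phi> (x - s *\<^sub>R axis i 1))" for h
    using has_derivative_linear[OF D] by (simp add: pd_def linear_neg linear_scale)
  ultimately show ?thesis by (simp add: has_vector_derivative_def)
qed

text \<open>Only the equation of order one, over \<open>lborel\<close>; local integrability is
  stated separately where it is used or follows from integrability of the p-th power.\<close>

definition wderiv_dir :: "'n::finite \<Rightarrow> (real^'n \<Rightarrow> real) \<Rightarrow> (real^'n \<Rightarrow> real) \<Rightarrow> bool" where
  "wderiv_dir i v g \<longleftrightarrow> (\<forall>\<phi>. test_fun \<phi> \<longrightarrow>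
      (\<integral>x. v x * pd i \<phi> x \<partial>lborel) = - (\<integral>x. g x * \<phi> x \<partial>lborel))"

text \<open>Tested against \<phi>, the right side becomes by Fubini an s-integral of pairings of g
  with translates of \<phi>. The weak equation turns these into pairings of v with derivatives of
  \<phi>, and the fundamental theorem of calculus in s leaves the difference of two translates,
  which is the tested left side. The exceptional null set depends on t.\<close>

lemma translate_difference_AE:
  fixes v g :: "real^'n::finite \<Rightarrow> real"
  assumes [measurable]: "v \<in> borel_measurable borel" "g \<in> borel_measurable borel"
    and v: "\<And>K. compact K \<Longrightarrow> integrable lborel (\<lambda>x. indicator K x * v x)"
    and g: "\<And>K. compact K \<Longrightarrow> integrable lborel (\<lambda>x. indicator K x * g x)"
    and wd: "wderiv_dir i v g" and t: "0 \<le> t"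
  shows "AE x in lborel. v (x + t *\<^sub>R axis i 1) - v x = (\<integral>s. indicator {0..t} s * g (x + s *\<^sub>R axis i 1) \<partial>lborel)"
proof -
  let ?e = "axis i 1 :: real^'n"
  define G where "G x = (\<integral>s. indicator {0..t} s * g (x + s *\<^sub>R ?e) \<partial>lborel)" for x
  have [measurable]: "G \<in> borel_measurable borel" unfolding G_def by measurable
  have P1: "integrable (lborel \<Otimes>\<^sub>M lborel) (\<lambda>(s, x). indicator {0..t} s * (g (x + s *\<^sub>R ?e) * \<psi> x))"
    if [measurable]: "\<psi> \<in> borel_measurable borel" and K: "compact K" "\<And>x. x \<notin> K \<Longrightarrow> \<psi> x = 0" and B: "\<And>x. \<bar>\<psi> x\<bar> \<le> B" for \<psi> K B
  proof -
    obtain R where R: "\<And>x. x \<in> K \<Longrightarrow> norm x \<le> R" using compact_imp_bounded[OF K(1)] bounded_iff by blast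
    \<comment> \<open>Contains every translate of the support by a vector of length at most t, so
      one majorant serves for all s in {0..t}.\<close>
    let ?K = "cball 0 (R + t) :: (real^'n) set"
    have "integrable lborel (\<lambda>x. B * (indicator ?K x * g x))" using g[of ?K] by simp
    then show ?thesis
    proof (rule strip_integrable[where c=1 and e="?e" and t=t, rotated])
      fix s x
      have B0: "0 \<le> B" using B[of 0] by linarith
      show "\<bar>indicator {0..t} s * (g (x + s *\<^sub>R ?e) * \<psi> x)\<bar>
         \<le> indicator {0..t} s * \<bar>B * (indicator ?K (x + (1 * s) *\<^sub>R ?e) * g (x + (1 * s) *\<^sub>R ?e))\<bar>"
      proof (cases "s \<in> {0..t} \<and> x \<in> K")
        case True
        then have "norm (x + s *\<^sub>R ?e) \<le> R + t"
          using R[of x] norm_triangle_ineq[of x "s *\<^sub>R ?e"] by (auto simp: norm_axis_1)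
        then show ?thesis using True B[of x] B0
          by (auto simp: abs_mult mult.commute intro!: mult_right_mono)
      qed (use K in auto)
    qed measurable
  qed
  have P2: "integrable (lborel \<Otimes>\<^sub>M lborel) (\<lambda>(s, x). indicator {0..t} s * (v x * \<psi> (x - s *\<^sub>R ?e)))"
    if [measurable]: "\<psi> \<in> borel_measurable borel" and K: "compact K" "\<And>x. x \<notin> K \<Longrightarrow> \<psi> x = 0" and B: "\<And>x. \<bar>\<psi> x\<bar> \<le> B" for \<psi> K B
  proof -
    obtain R where R: "\<And>x. x \<in> K \<Longrightarrow> norm x \<le> R" using compact_imp_bounded[OF K(1)] bounded_iff by blast
    let ?K = "cball 0 (R + t) :: (real^'n) set"
    have "integrable lborel (\<lambda>x. B * (indicator ?K x * v x))" using v[of ?K] by simp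
    then show ?thesis
    proof (rule strip_integrable[where c=0 and e="?e" and t=t, rotated])
      fix s x
      have B0: "0 \<le> B" using B[of 0] by linarith
      show "\<bar>indicator {0..t} s * (v x * \<psi> (x - s *\<^sub>R ?e))\<bar>
         \<le> indicator {0..t} s * \<bar>B * (indicator ?K (x + (0 * s) *\<^sub>R ?e) * v (x + (0 * s) *\<^sub>R ?e))\<bar>"
      proof (cases "s \<in> {0..t} \<and> x - s *\<^sub>R ?e \<in> K")
        case True
        then have "norm x \<le> R + t"
          using R[of "x - s *\<^sub>R ?e"] norm_triangle_ineq[of "x - s *\<^sub>R ?e" "s *\<^sub>R ?e"] by (auto simp: norm_axis_1)
        then show ?thesis using True B[of "x - s *\<^sub>R ?e"] B0
          by (auto simp: abs_mult mult.commute[of B] intro!: mult_left_mono)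
      qed (use K in auto)
    qed measurable
  qed
  have to_leb: "loc_int f" if [measurable]: "f \<in> borel_measurable borel" and "\<And>K. compact K \<Longrightarrow> integrable lborel (\<lambda>x. indicator K x * f x)" for f :: "real^'n \<Rightarrow> real"
    unfolding loc_int_iff
  proof (intro conjI allI impI)
    show "f \<in> borel_measurable lebesgue" by (rule measurable_completion) simp
    fix K :: "(real^'n) set" assume "compact K"
    then show "integrable lebesgue (\<lambda>x. indicator K x * f x)"
      using that(2) by (subst integrable_completion) (auto simp: compact_imp_closed borel_closed)
  qed
  have Gi: "integrable lborel (\<lambda>x. indicator K x * G x)" if "compact K" for K
  proof -
    have [measurable]: "K \<in> sets borel" using that by (simp add: compact_imp_closed borel_closed)
    have "integrable (lborel \<Otimes>\<^sub>M lborel) (\<lambda>(s, x). indicator {0..t} s * (g (x + s *\<^sub>R ?e) * indicator K x))"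
      by (rule P1[OF _ that, of _ 1]) auto
    from lborel_pair.integrable_snd[OF this] show ?thesis by (simp add: G_def mult_ac)
  qed
  have lv: "loc_int (\<lambda>x. v (x + t *\<^sub>R ?e))" "loc_int v" "loc_int G"
    using loc_int_shift[OF to_leb[OF assms(1) v]] to_leb v Gi by auto
  have l1: "loc_int (\<lambda>x. 1 * v (x + t *\<^sub>R ?e) + (-1) * v x)" by (rule loc_int_lin[OF lv(1,2)])
  have l2: "loc_int (\<lambda>x. 1 * (1 * v (x + t *\<^sub>R ?e) + (-1) * v x) + (-1) * G x)" by (rule loc_int_lin[OF l1 lv(3)])
  have "AE x in lebesgue. 1 * (1 * v (x + t *\<^sub>R ?e) + (-1) * v x) + (-1) * G x = 0"
  proof (rule AE_zero_if_test_integrals_zero[OF l2])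
    fix \<phi> :: "real^'n \<Rightarrow> real" assume tf: "test_fun \<phi>"
    note [measurable] = test_fun_measurable[OF tf] test_fun_measurable[OF test_fun_pd[OF tf, of i]]
    obtain K B where KB: "compact K" "\<And>x. x \<notin> K \<Longrightarrow> \<phi> x = 0" "\<And>x. \<bar>\<phi> x\<bar> \<le> B"
      using test_fun_compact_supp[OF tf] by blast
    obtain K' B' where KB': "compact K'" "\<And>x. x \<notin> K' \<Longrightarrow> pd i \<phi> x = 0" "\<And>x. \<bar>pd i \<phi> x\<bar> \<le> B'"
      using test_fun_compact_supp[OF test_fun_pd[OF tf]] by blast
    have i_lb: "integrable lborel (\<lambda>x. f x * \<theta> x)" if "loc_int f" "f \<in> borel_measurable borel" "test_fun \<theta>" for f \<theta> :: "real^'n \<Rightarrow> real"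
      using loc_int_test_integrable[OF that(1,3)] that(2) test_fun_measurable[OF that(3)]
      by (subst (asm) integrable_completion) auto
    have "(\<integral>x. G x * \<phi> x \<partial>lborel) = (\<integral>x. (\<integral>s. indicator {0..t} s * (g (x + s *\<^sub>R ?e) * \<phi> x) \<partial>lborel) \<partial>lborel)"
      unfolding G_def by (simp add: mult.assoc[symmetric])
    also have "\<dots> = (\<integral>s. (\<integral>x. indicator {0..t} s * (g (x + s *\<^sub>R ?e) * \<phi> x) \<partial>lborel) \<partial>lborel)"
      by (rule lborel_pair.Fubini_integral[OF P1[OF _ KB]]) measurable
    also have "\<dots> = (\<integral>s. (\<integral>x. - (indicator {0..t} s * (v x * pd i \<phi> (x - s *\<^sub>R ?e))) \<partial>lborel) \<partial>lborel)"
    proof (rule Bochner_Integration.integral_cong[OF refl])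
      fix s
      have "(\<integral>x. g (x + s *\<^sub>R ?e) * \<phi> x \<partial>lborel) = (\<integral>x. g x * \<phi> (x + - (s *\<^sub>R ?e)) \<partial>lborel)"
        using lborel_shift(1)[of "\<lambda>x. g x * \<phi> (x + - (s *\<^sub>R ?e))" "s *\<^sub>R ?e"] by simp
      also have "\<dots> = - (\<integral>x. v x * pd i \<phi> (x + - (s *\<^sub>R ?e)) \<partial>lborel)"
      proof -
        have "(\<integral>x. v x * pd i (\<lambda>x. \<phi> (x + - (s *\<^sub>R ?e))) x \<partial>lborel) = - (\<integral>x. g x * \<phi> (x + - (s *\<^sub>R ?e)) \<partial>lborel)"
          using wd test_fun_shift[OF tf] unfolding wderiv_dir_def by blast
        then show ?thesis unfolding pd_shift by simp
      qed
      finally show "(\<integral>x. indicator {0..t} s * (g (x + s *\<^sub>R ?e) * \<phi> x) \<partial>lborel) = (\<integral>x. - (indicator {0..t} s * (v x * pd i \<phi> (x - s *\<^sub>R ?e))) \<partial>lborel)"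
        by simp
    qed
    also have "\<dots> = - (\<integral>s. (\<integral>x. indicator {0..t} s * (v x * pd i \<phi> (x - s *\<^sub>R ?e)) \<partial>lborel) \<partial>lborel)" by simp
    also have "\<dots> = - (\<integral>x. (\<integral>s. indicator {0..t} s * (v x * pd i \<phi> (x - s *\<^sub>R ?e)) \<partial>lborel) \<partial>lborel)"
      by (subst lborel_pair.Fubini_integral[OF P2[OF test_fun_measurable[OF test_fun_pd[OF tf]] KB']]) simp_all
    also have "\<dots> = - (\<integral>x. v x * \<phi> x - v x * \<phi> (x + - (t *\<^sub>R ?e)) \<partial>lborel)"
    proof -
      have "(\<integral>s. indicator {0..t} s * (v x * pd i \<phi> (x - s *\<^sub>R ?e)) \<partial>lborel) = v x * \<phi> x - v x * \<phi> (x + - (t *\<^sub>R ?e))" for x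
      proof -
        have "(\<integral>s. indicator {0..t} s *\<^sub>R (- pd i \<phi> (x - s *\<^sub>R ?e)) \<partial>lborel) = \<phi> (x - t *\<^sub>R ?e) - \<phi> (x - 0 *\<^sub>R ?e)"
        proof (rule integral_FTC_atLeastAtMost[OF t test_fun_axis_deriv[OF tf]])
          show "continuous_on {0..t} (\<lambda>s. - pd i \<phi> (x - s *\<^sub>R ?e))"
            by (intro continuous_intros continuous_on_compose2[OF test_fun_continuous[OF test_fun_pd[OF tf], of UNIV]]) auto
        qed
        then have "(\<integral>s. indicator {0..t} s * pd i \<phi> (x - s *\<^sub>R ?e) \<partial>lborel) = \<phi> x - \<phi> (x - t *\<^sub>R ?e)" by simp
        moreover have "(\<integral>s. indicator {0..t} s * (v x * pd i \<phi> (x - s *\<^sub>R ?e)) \<partial>lborel) = v x * (\<integral>s. indicator {0..t} s * pd i \<phi> (x - s *\<^sub>R ?e) \<partial>lborel)"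
          by (simp add: mult.left_commute)
        ultimately have "(\<integral>s. indicator {0..t} s * (v x * pd i \<phi> (x - s *\<^sub>R ?e)) \<partial>lborel) = v x * (\<phi> x - \<phi> (x - t *\<^sub>R ?e))"
          by simp
        then show ?thesis by (simp add: right_diff_distrib)
      qed
      then show ?thesis by simp
    qed
    also have "\<dots> = - ((\<integral>x. v x * \<phi> x \<partial>lborel) - (\<integral>x. v x * \<phi> (x + - (t *\<^sub>R ?e)) \<partial>lborel))"
      using i_lb[OF lv(2) assms(1) tf] i_lb[OF lv(2) assms(1) test_fun_shift[OF tf, of "- (t *\<^sub>R ?e)"]] by simp
    also have "(\<integral>x. v x * \<phi> (x + - (t *\<^sub>R ?e)) \<partial>lborel) = (\<integral>x. v (x + t *\<^sub>R ?e) * \<phi> x \<partial>lborel)"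
      using lborel_shift(1)[of "\<lambda>x. v x * \<phi> (x + - (t *\<^sub>R ?e))" "t *\<^sub>R ?e"] by simp
    finally have eq: "(\<integral>x. G x * \<phi> x \<partial>lborel) = (\<integral>x. v (x + t *\<^sub>R ?e) * \<phi> x \<partial>lborel) - (\<integral>x. v x * \<phi> x \<partial>lborel)" by simp
    have "(\<integral>x. (1 * (1 * v (x + t *\<^sub>R ?e) + (-1) * v x) + (-1) * G x) * \<phi> x \<partial>lebesgue)
      = (\<integral>x. v (x + t *\<^sub>R ?e) * \<phi> x - v x * \<phi> x - G x * \<phi> x \<partial>lborel)"
      by (subst integral_completion) (auto simp: algebra_simps)
    also have "\<dots> = 0"
      using i_lb[OF lv(1) _ tf] i_lb[OF lv(2) _ tf] i_lb[OF lv(3) _ tf] eq by simp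
    finally show "(\<integral>x. (1 * (1 * v (x + t *\<^sub>R ?e) + (-1) * v x) + (-1) * G x) * \<phi> x \<partial>lebesgue) = 0" .
  qed
  then have "AE x in lborel. 1 * (1 * v (x + t *\<^sub>R ?e) + (-1) * v x) + (-1) * G x = 0"
    by (simp add: AE_completion_iff)
  then show ?thesis unfolding G_def by eventually_elim simp
qed

text \<open>A line integral is constant along \<open>e\<close>, so its integral over the whole space
  is 0 or infinite. Over the slab of points with coordinate at most n in modulus it equals 2n times
  the integral of f, and the slabs exhaust the space.\<close>

lemma line_int_finite_AE:
  fixes f :: "'a::euclidean_space \<Rightarrow> ennreal"
  assumes [measurable]: "f \<in> borel_measurable borel" and f: "(\<integral>\<^sup>+x. f x \<partial>lborel) < top" and e: "e \<in> Basis"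
  shows "AE x in lborel. line_int e f x < top"
proof -
  have "AE x in lborel. indicator {x. \<bar>x \<bullet> e\<bar> \<le> real n} x * line_int e f x \<noteq> \<infinity>" for n
  proof (rule nn_integral_PInf_AE)
    have [measurable]: "Measurable.pred borel (\<lambda>x. \<bar>x \<bullet> e\<bar> \<le> real n)" by measurable
    let ?i = "\<lambda>y::real. indicator {- real n..real n} y :: ennreal"
    have "(\<integral>\<^sup>+x. indicator {x. \<bar>x \<bullet> e\<bar> \<le> real n} x * line_int e f x \<partial>lborel)
      = (\<integral>\<^sup>+x. (\<integral>\<^sup>+t. ?i (x \<bullet> e) * f (x + t *\<^sub>R e) \<partial>lborel) \<partial>lborel)"
      unfolding line_int_def by (intro nn_integral_cong) (auto simp: nn_integral_cmult indicator_def abs_le_iff)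
    also have "\<dots> = (\<integral>\<^sup>+t. (\<integral>\<^sup>+x. ?i (x \<bullet> e) * f (x + t *\<^sub>R e) \<partial>lborel) \<partial>lborel)"
      by (rule lborel_pair.Fubini'[symmetric]) measurable
    also have "\<dots> = (\<integral>\<^sup>+t. (\<integral>\<^sup>+x. ?i (x \<bullet> e - t) * f x \<partial>lborel) \<partial>lborel)"
    proof (rule nn_integral_cong)
      fix t :: real
      show "(\<integral>\<^sup>+x. ?i (x \<bullet> e) * f (x + t *\<^sub>R e) \<partial>lborel) = (\<integral>\<^sup>+x. ?i (x \<bullet> e - t) * f x \<partial>lborel)"
        using lborel_shift_nn[of "\<lambda>x. ?i (x \<bullet> e - t) * f x" "t *\<^sub>R e"] e by (simp add: inner_add_left)
    qed
    also have "\<dots> = (\<integral>\<^sup>+x. (\<integral>\<^sup>+t. ?i (x \<bullet> e - t) * f x \<partial>lborel) \<partial>lborel)"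
      by (rule lborel_pair.Fubini') measurable
    also have "\<dots> = (\<integral>\<^sup>+x. ennreal (2 * real n) * f x \<partial>lborel)"
    proof (rule nn_integral_cong)
      fix x
      have "(\<integral>\<^sup>+t. ?i (x \<bullet> e - t) \<partial>lborel) = (\<integral>\<^sup>+t. indicator {x \<bullet> e - real n..x \<bullet> e + real n} t \<partial>lborel)"
        by (intro nn_integral_cong) (auto simp: indicator_def)
      then show "(\<integral>\<^sup>+t. ?i (x \<bullet> e - t) * f x \<partial>lborel) = ennreal (2 * real n) * f x"
        by (subst nn_integral_multc) auto
    qed
    also have "\<dots> = ennreal (2 * real n) * (\<integral>\<^sup>+x. f x \<partial>lborel)" by (rule nn_integral_cmult) simp
    finally show "(\<integral>\<^sup>+x. indicator {x. \<bar>x \<bullet> e\<bar> \<le> real n} x * line_int e f x \<partial>lborel) \<noteq> \<infinity>"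
      using f by (simp add: ennreal_mult_eq_top_iff)
  qed measurable
  then have "AE x in lborel. \<forall>n::nat. indicator {x. \<bar>x \<bullet> e\<bar> \<le> real n} x * line_int e f x \<noteq> top"
    by (simp add: AE_all_countable)
  then show ?thesis
  proof eventually_elim
    case (elim x)
    obtain n :: nat where "\<bar>x \<bullet> e\<bar> \<le> real n" using real_arch_simple by blast
    then show ?case using elim[rule_format, of n] by (simp add: less_top)
  qed
qed

section \<open>The Sobolev inequality of first order\<close>

text \<open>Truncation at k is a contraction, which reduces the claim to
  \<open>powr_diff_bound\<close>. The maximum of two values of one continuous weight is the form
  that \<open>chain_inequality\<close> takes.\<close>

lemma trunc_powr_diff_bound:
  fixes a b k c :: real
  assumes "0 \<le> k" "1 < c"
  shows "\<bar>min \<bar>a\<bar> k powr c - min \<bar>b\<bar> k powr c\<bar>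
    \<le> \<bar>a - b\<bar> * max (c * min \<bar>a\<bar> k powr (c - 1)) (c * min \<bar>b\<bar> k powr (c - 1))"
proof -
  let ?A = "min \<bar>a\<bar> k" and ?B = "min \<bar>b\<bar> k"
  have 1: "c * max ?A ?B powr (c - 1) \<le> max (c * ?A powr (c - 1)) (c * ?B powr (c - 1))"
    by (auto simp: max_def)
  have 2: "\<bar>?A - ?B\<bar> \<le> \<bar>a - b\<bar>" by linarith
  have "\<bar>?A - ?B\<bar> * (c * max ?A ?B powr (c - 1)) \<le> \<bar>a - b\<bar> * max (c * ?A powr (c - 1)) (c * ?B powr (c - 1))"
    by (rule mult_mono[OF 2 1]) (use assms in simp_all)
  moreover have "\<bar>?A powr c - ?B powr c\<bar> \<le> \<bar>?A - ?B\<bar> * (c * max ?A ?B powr (c - 1))"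
    by (rule powr_diff_bound) (use assms in simp_all)
  ultimately show ?thesis by (rule order_trans[rotated])
qed

text \<open>\<open>\<bar>f\<bar> \<le> 1 + \<bar>f\<bar> powr p\<close>, and the constant 1 is
  integrable over a set of finite measure.\<close>

lemma powr_integrable_imp_set_integrable:
  fixes f :: "'a::euclidean_space \<Rightarrow> real"
  assumes [measurable]: "f \<in> borel_measurable borel" and f: "(\<integral>\<^sup>+x. ennreal (\<bar>f x\<bar> powr p) \<partial>lborel) < top"
    and p: "1 \<le> p" and K: "K \<in> sets borel" "emeasure lborel K < top"
  shows "integrable lborel (\<lambda>x. indicator K x * f x)"
proof (rule Bochner_Integration.integrable_bound)
  have "integrable lborel (\<lambda>x. \<bar>f x\<bar> powr p)" using f by (intro integrableI_nonneg) auto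
  then show "integrable lborel (\<lambda>x. indicator K x + \<bar>f x\<bar> powr p)"
    using K by (intro Bochner_Integration.integrable_add) (auto simp: integrable_indicator_iff)
  have "\<bar>f x\<bar> \<le> 1 + \<bar>f x\<bar> powr p" for x
  proof (cases "\<bar>f x\<bar> \<le> 1")
    case False
    then have "\<bar>f x\<bar> powr 1 \<le> \<bar>f x\<bar> powr p" using p by (intro powr_mono) auto
    then show ?thesis by simp
  qed (simp add: add_increasing2)
  then show "AE x in lborel. norm (indicator K x * f x) \<le> norm (indicator K x + \<bar>f x\<bar> powr p)"
    by (intro AE_I2) (auto simp: indicator_def)
qed (use K in auto)

text \<open>On almost every line v agrees almost everywhere with an absolutely continuous function
  h, and h cannot stay away from 0 on a half-line because the p-th power of v is integrable there.
  Hence the bound for a difference between x and a far point becomes a bound for the value at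
  x.\<close>

lemma line_bound:
  fixes v g :: "real^'n::finite \<Rightarrow> real"
  assumes [measurable]: "v \<in> borel_measurable borel" "g \<in> borel_measurable borel"
    and p: "1 \<le> p" and v: "(\<integral>\<^sup>+x. ennreal (\<bar>v x\<bar> powr p) \<partial>lborel) < top"
    and g: "(\<integral>\<^sup>+x. ennreal (\<bar>g x\<bar> powr p) \<partial>lborel) < top"
    and wd: "wderiv_dir i v g" and c: "1 < c" and k: "0 < k"
  shows "AE x in lborel. ennreal (min \<bar>v x\<bar> k powr c)
     \<le> line_int (axis i 1) (\<lambda>x. ennreal (c * min \<bar>v x\<bar> k powr (c - 1) * \<bar>g x\<bar>)) x"
proof -
  let ?e = "axis i 1 :: real^'n"
  \<comment> \<open>The condition on s is a conditional and not \<open>indicator {0..t} s\<close>,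
    so that joint measurability in x and t is visible; exchanging the two almost-everywhere
    quantifiers below relies on it.\<close>
  define G where "G x t = (\<integral>s. (if 0 \<le> s \<and> s \<le> t then g (x + s *\<^sub>R ?e) else 0) \<partial>lborel)" for x t
  have li: "integrable lborel (\<lambda>x. indicator K x * v x)" "integrable lborel (\<lambda>x. indicator K x * g x)" if "compact K" for K
    using that emeasure_compact_finite[OF that] powr_integrable_imp_set_integrable[OF _ v p, of K] powr_integrable_imp_set_integrable[OF _ g p, of K]
    by (auto simp: compact_imp_closed borel_closed)
  have G: "G x t = (\<integral>s. indicator {0..t} s * g (x + s *\<^sub>R ?e) \<partial>lborel)" for x t
    unfolding G_def by (intro Bochner_Integration.integral_cong) (auto simp: indicator_def)
  have "AE t in lborel. AE x in lborel. 0 \<le> t \<longrightarrow> v (x + t *\<^sub>R ?e) - v x = G x t"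
  proof (rule AE_I2)
    fix t :: real
    show "AE x in lborel. 0 \<le> t \<longrightarrow> v (x + t *\<^sub>R ?e) - v x = G x t"
      using translate_difference_AE[OF assms(1,2) li wd, of t] by (cases "0 \<le> t") (simp_all add: G)
  qed
  \<comment> \<open>Fubini for null sets: the exceptional set of x depended on t, now almost every x
    has an exceptional set of t.\<close>
  then have AE1: "AE x in lborel. AE t in lborel. 0 \<le> t \<longrightarrow> v (x + t *\<^sub>R ?e) - v x = G x t"
    by (subst lborel_pair.AE_commute) (unfold G_def, measurable)
  have AE2: "AE x in lborel. line_int ?e (\<lambda>x. ennreal (\<bar>v x\<bar> powr p)) x < top"
    by (rule line_int_finite_AE[OF _ v]) (auto simp: axis_in_Basis_iff)
  have AE3: "AE x in lborel. line_int ?e (\<lambda>x. ennreal (\<bar>g x\<bar> powr p)) x < top"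
    by (rule line_int_finite_AE[OF _ g]) (auto simp: axis_in_Basis_iff)
  show ?thesis using AE1 AE2 AE3
  proof eventually_elim
    case (elim x)
    let ?\<gamma> = "\<lambda>s. g (x + s *\<^sub>R ?e)" and ?w = "\<lambda>s. v (x + s *\<^sub>R ?e)"
    let ?\<psi> = "\<lambda>s::real. c * min \<bar>s\<bar> k powr (c - 1)" and ?\<Phi> = "\<lambda>s. min \<bar>s\<bar> k powr c"
    \<comment> \<open>The continuous representative along the line, anchored at the actual value of
      v at x, so that h 0 = v x holds exactly.\<close>
    define h where "h t = v x + G x t" for t
    have si: "set_integrable lborel {0..t} ?\<gamma>" for t
      unfolding set_integrable_def using elim(3) p
      by (simp, intro powr_integrable_imp_set_integrable[where p=p]) (auto simp: line_int_def emeasure_lborel_Icc_eq)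
    have hh: "h t = v x + integral {0..t} ?\<gamma>" for t
      using set_borel_integral_eq_integral(2)[OF si, of t] by (simp add: h_def G set_lebesgue_integral_def)
    have h0: "h 0 = v x" unfolding hh by simp
    have wh: "AE t in lborel. 0 \<le> t \<longrightarrow> ?w t = h t" using elim(1) by eventually_elim (auto simp: h_def)
    define L where "L = line_int ?e (\<lambda>x. ennreal (?\<psi> (v x) * \<bar>g x\<bar>)) x"
    have bound: "ennreal (?\<Phi> (v x) - ?\<Phi> (h T)) \<le> L" if T: "0 \<le> T" for T
    proof -
      have gT: "?\<gamma> absolutely_integrable_on {0..T}"
        using si[of T] unfolding set_integrable_def by (rule integrable_completion[THEN iffD2, rotated]) simp
      have c\<psi>: "continuous_on UNIV ?\<psi>"
        using c k by (intro continuous_intros continuous_on_powr') auto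
      have \<psi>0: "0 \<le> ?\<psi> s" for s using c by simp
      note ci = chain_inequality[OF T gT hh trunc_powr_diff_bound[OF less_imp_le[OF k] c] c\<psi> \<psi>0]
      let ?I = "integral {0..T} (\<lambda>s. ?\<psi> (h s) * \<bar>?\<gamma> s\<bar>)"
      have "ennreal (?\<Phi> (v x) - ?\<Phi> (h T)) \<le> ennreal ?I" using ci(2) h0 by (intro ennreal_leI) simp
      also have "ennreal ?I = (\<integral>\<^sup>+s. ennreal (indicator {0..T} s * (?\<psi> (h s) * \<bar>?\<gamma> s\<bar>)) \<partial>lborel)"
        using ci(1) \<psi>0 by (intro nn_integral_has_integral_lebesgue[symmetric] integrable_integral) auto
      also have "\<dots> \<le> (\<integral>\<^sup>+s. ennreal (?\<psi> (?w s) * \<bar>?\<gamma> s\<bar>) \<partial>lborel)"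
      proof (rule nn_integral_mono_AE)
        show "AE s in lborel. ennreal (indicator {0..T} s * (?\<psi> (h s) * \<bar>?\<gamma> s\<bar>)) \<le> ennreal (?\<psi> (?w s) * \<bar>?\<gamma> s\<bar>)"
          using wh by eventually_elim (auto simp: indicator_def)
      qed
      finally show ?thesis by (simp add: L_def line_int_def)
    qed
    show "ennreal (?\<Phi> (v x)) \<le> L"
    proof (rule ccontr)
      assume "\<not> ennreal (?\<Phi> (v x)) \<le> L"
      then obtain l where l: "L = ennreal l" "0 \<le> l" "l < ?\<Phi> (v x)"
        by (cases L) (auto simp: not_le ennreal_less_iff)
      \<comment> \<open>If the bound failed, the difference estimate would keep the truncated power
        of \<open>h T\<close> above \<delta> for all T \<ge> 0, and h above \<eta> on the whole
        half-line.\<close>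
      define \<delta> where "\<delta> = ?\<Phi> (v x) - l"
      have \<delta>: "\<delta> > 0" using l by (simp add: \<delta>_def)
      have h\<delta>: "\<delta> \<le> ?\<Phi> (h T)" if "0 \<le> T" for T
        using bound[OF that] l by (simp add: \<delta>_def ennreal_le_iff)
      define \<eta> where "\<eta> = \<delta> powr (1 / c)"
      have \<eta>: "\<eta> > 0" using \<delta> by (simp add: \<eta>_def)
      have h\<eta>: "\<eta> \<le> \<bar>h T\<bar>" if "0 \<le> T" for T
      proof -
        have "\<delta> \<le> \<bar>h T\<bar> powr c"
          using h\<delta>[OF that] powr_mono2[of c "min \<bar>h T\<bar> k" "\<bar>h T\<bar>"] c k by simp
        then have "\<eta> \<le> (\<bar>h T\<bar> powr c) powr (1 / c)" unfolding \<eta>_def using \<delta> c by (intro powr_mono2) auto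
        then show ?thesis using c by (simp add: powr_powr)
      qed
      have "(\<integral>\<^sup>+t. ennreal (\<eta> powr p) * indicator {0..} (t::real) \<partial>lborel) \<le> (\<integral>\<^sup>+t. ennreal (\<bar>?w t\<bar> powr p) \<partial>lborel)"
      proof (rule nn_integral_mono_AE)
        show "AE t in lborel. ennreal (\<eta> powr p) * indicator {0..} t \<le> ennreal (\<bar>?w t\<bar> powr p)"
          using wh
        proof eventually_elim
          case (elim t)
          then show ?case using h\<eta>[of t] \<eta> p by (auto simp: indicator_def intro!: ennreal_leI powr_mono2)
        qed
      qed
      moreover have "(\<integral>\<^sup>+t. ennreal (\<eta> powr p) * indicator {0..} (t::real) \<partial>lborel) = top"
      proof -
        have "emeasure lborel {0::real..} = top"
        proof (rule ccontr)
          assume "emeasure lborel {0::real..} \<noteq> top"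
          then obtain M where M: "emeasure lborel {0::real..} = ennreal M" "0 \<le> M" by (cases "emeasure lborel {0::real..}") auto
          have "emeasure lborel {0..M + 1} \<le> emeasure lborel {0::real..}" by (intro emeasure_mono) auto
          then show False using M by (simp add: ennreal_le_iff)
        qed
        then show ?thesis using \<eta> by (simp add: nn_integral_cmult_indicator ennreal_mult_top)
      qed
      ultimately show False using elim(2) by (simp add: line_int_def top_unique)
    qed
  qed
qed

lemma prod_mono_ennreal:
  fixes f g :: "'i \<Rightarrow> ennreal"
  assumes "\<And>i. i \<in> A \<Longrightarrow> f i \<le> g i"
  shows "prod f A \<le> prod g A"
  using assms by (induction A rule: infinite_finite_induct) (auto intro!: mult_mono)

lemma prod_Basis_axis: "(\<Prod>b\<in>(Basis::(real^'n::finite) set). F b) = (\<Prod>i\<in>UNIV. F (axis i 1))"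
proof -
  have B: "(Basis::(real^'n) set) = range (\<lambda>i. axis i 1)" by (auto simp: Basis_vec_def)
  show ?thesis unfolding B by (subst prod.reindex) (auto simp: inj_on_def axis_eq_axis)
qed

text \<open>Testing the grid-line inequality with the truncated power \<open>min \<bar>v\<bar> k powr c\<close> makes \<open>X\<close> finite a
priori. Splitting \<open>V powr (c - 1) * \<bar>g\<bar>\<close> between \<open>V powr r\<close>, \<open>V powr p\<close> and \<open>\<bar>g\<bar> powr p\<close> leaves a
power of \<open>X\<close> on the right that is strictly smaller than the one on the left.\<close>

lemma sobolev_step:
  fixes p c r K :: real
  assumes N: "2 \<le> CARD('n::finite)" and p: "1 < p" and c: "p \<le> c"
    and r: "r = c * CARD('n) / (CARD('n) - 1)" and rp: "r * (CARD('n) - p) \<le> p * CARD('n)" and K: "0 < K"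
  obtains C where "0 \<le> C"
    "\<And>(v :: real^'n \<Rightarrow> real) g. v \<in> borel_measurable borel \<Longrightarrow> (\<And>i. g i \<in> borel_measurable borel) \<Longrightarrow>
      (\<And>i. wderiv_dir i v (g i)) \<Longrightarrow> (\<integral>\<^sup>+x. ennreal (\<bar>v x\<bar> powr p) \<partial>lborel) \<le> ennreal K \<Longrightarrow>
      (\<And>i. (\<integral>\<^sup>+x. ennreal (\<bar>g i x\<bar> powr p) \<partial>lborel) \<le> ennreal K) \<Longrightarrow>
      (\<integral>\<^sup>+x. ennreal (\<bar>v x\<bar> powr r) \<partial>lborel) \<le> ennreal C"
proof -
  define n where "n = real CARD('n)"
  have n: "2 \<le> n" using N by (simp add: n_def)
  have rn: "(n - 1) * r = n * c" using r n by (simp add: n_def field_simps)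
  have rc: "c < r"
  proof -
    have "(n - 1) * c < (n - 1) * r" using rn n c p by (simp add: algebra_simps)
    then show ?thesis using n by simp
  qed
  \<comment> \<open>The weights \<tau>, \<sigma> and 1/p of the three Hoelder factors are determined
    by two conditions: they sum to 1, and \<open>r * \<tau> + p * \<sigma> = c - 1\<close>.\<close>
  define \<tau> where "\<tau> = (c - p) / (r - p)"
  have \<tau>0: "0 \<le> \<tau>" using c rc by (simp add: \<tau>_def)
  have rp0: "r - p > 0" using rc c by simp
  have \<tau>r: "\<tau> * (r - p) = c - p" using rp0 by (simp add: \<tau>_def)
  \<comment> \<open>The gap between the power (n-1)/n of X on the left and \<tau> on the right; the
    computation gives n (r - p) e = p.\<close>
  define e where "e = (n - 1) / n - \<tau>"
  have e: "e > 0"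
  proof -
    have "n * (r - p) * e = (n - 1) * (r - p) - n * (\<tau> * (r - p))"
      using n by (simp add: e_def field_simps)
    also have "\<dots> = p" unfolding \<tau>r using rn by (simp add: algebra_simps)
    finally have "0 < n * (r - p) * e" using p by simp
    then show ?thesis using n rp0 by (auto intro: zero_less_mult_pos[of "n * (r - p)"])
  qed
  \<comment> \<open>Nonnegativity of \<sigma> is equivalent to the bound \<open>rp\<close> on r,
    that is, to r being at most the critical exponent when p < n.\<close>
  define \<sigma> where "\<sigma> = 1 - 1 / p - \<tau>"
  have \<sigma>0: "0 \<le> \<sigma>"
  proof -
    have "n * (p * (c - p)) \<le> n * ((p - 1) * (r - p))"
    proof -
      have "n * (p * (c - p)) = p * (n * c) - n * p * p" by (simp add: algebra_simps)
      also have "\<dots> = p * ((n - 1) * r) - n * p * p" using rn by simp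
      also have "\<dots> \<le> n * ((p - 1) * (r - p))" using rp by (simp add: n_def algebra_simps)
      finally show ?thesis .
    qed
    then have "p * (c - p) \<le> (p - 1) * (r - p)" using n by simp
    then have "\<tau> \<le> (p - 1) / p" using rp0 p by (simp add: \<tau>_def field_simps)
    then show ?thesis using p by (simp add: \<sigma>_def field_simps)
  qed
  have hom: "r * \<tau> + p * \<sigma> = c - 1"
  proof -
    have "p * \<sigma> = p - 1 - p * \<tau>" using p by (simp add: \<sigma>_def field_simps)
    then show ?thesis using \<tau>r by (simp add: algebra_simps)
  qed
  \<comment> \<open>One term for each of the n directions, the factor c from differentiating the
    power, and the Hoelder weights \<sigma> + 1/p = 1 - \<tau> on K.\<close>
  define A where "A = n * c * K powr (1 - \<tau>)"
  have A: "A > 0" using n c p K by (simp add: A_def)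
  define C where "C = A powr (1 / e)"
  show thesis
  proof (rule that[of C])
    show "0 \<le> C" by (simp add: C_def)
    fix v :: "real^'n \<Rightarrow> real" and g
    assume [measurable]: "v \<in> borel_measurable borel" "\<And>i. g i \<in> borel_measurable borel"
      and wd: "\<And>i. wderiv_dir i v (g i)" and vK: "(\<integral>\<^sup>+x. ennreal (\<bar>v x\<bar> powr p) \<partial>lborel) \<le> ennreal K"
      and gK: "\<And>i. (\<integral>\<^sup>+x. ennreal (\<bar>g i x\<bar> powr p) \<partial>lborel) \<le> ennreal K"
    have v_fin: "(\<integral>\<^sup>+x. ennreal (\<bar>v x\<bar> powr p) \<partial>lborel) < top" using vK by (simp add: le_less_trans)
    have g_fin: "(\<integral>\<^sup>+x. ennreal (\<bar>g i x\<bar> powr p) \<partial>lborel) < top" for i using gK[of i] by (simp add: le_less_trans)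
    have main: "(\<integral>\<^sup>+x. ennreal (min \<bar>v x\<bar> k powr r) \<partial>lborel) \<le> ennreal C" if k: "0 < k" for k
    proof -
      define V where "V x = min \<bar>v x\<bar> k" for x
      have V[measurable]: "V \<in> borel_measurable borel" and V0: "0 \<le> V x" and Vv: "V x \<le> \<bar>v x\<bar>" for x
        using k unfolding V_def by auto
      define X where "X = (\<integral>\<^sup>+x. ennreal (V x powr r) \<partial>lborel)"
      \<comment> \<open>Finiteness of X, the reason for the truncation: the excess power r - p is
        bounded by a power of k.\<close>
      have "X \<le> (\<integral>\<^sup>+x. ennreal (k powr (r - p)) * ennreal (\<bar>v x\<bar> powr p) \<partial>lborel)"
        unfolding X_def
      proof (intro nn_integral_mono)
        fix x
        have "V x powr r = V x powr (r - p) * V x powr p" by (simp add: powr_add[symmetric])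
        also have "\<dots> \<le> k powr (r - p) * \<bar>v x\<bar> powr p"
          using V0[of x] Vv[of x] k rp0 p by (intro mult_mono powr_mono2) (auto simp: V_def)
        finally show "ennreal (V x powr r) \<le> ennreal (k powr (r - p)) * ennreal (\<bar>v x\<bar> powr p)"
          by (simp add: ennreal_mult[symmetric] ennreal_leI)
      qed
      also have "\<dots> < top" using v_fin by (simp add: nn_integral_cmult ennreal_mult_less_top)
      finally have "X < top" .
      then obtain X' where X': "X = ennreal X'" "0 \<le> X'" by (cases X) auto
      define f where "f x = (\<Sum>i\<in>UNIV. ennreal (c * V x powr (c - 1) * \<bar>g i x\<bar>))" for x
      have fm[measurable]: "f \<in> borel_measurable borel" unfolding f_def by measurable
      have "AE x in lborel. \<forall>i\<in>UNIV. ennreal (V x powr c) \<le> line_int (axis i 1) (\<lambda>x. ennreal (c * V x powr (c - 1) * \<bar>g i x\<bar>)) x"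
        unfolding V_def using c p k v_fin g_fin wd
        by (intro AE_finite_allI line_bound[where p=p]) auto
      then have "AE x in lborel. ennreal (V x powr r) \<le> (\<Prod>b\<in>Basis. epow (line_int b f x) (1 / (real DIM(real^'n) - 1)))"
      proof eventually_elim
        case (elim x)
        have "ennreal (V x powr c) \<le> line_int (axis i 1) f x" for i
        proof -
          have "ennreal (V x powr c) \<le> line_int (axis i 1) (\<lambda>x. ennreal (c * V x powr (c - 1) * \<bar>g i x\<bar>)) x"
            using elim by auto
          also have "\<dots> \<le> line_int (axis i 1) f x"
            unfolding line_int_def f_def by (intro nn_integral_mono member_le_sum) auto
          finally show ?thesis .
        qed
        then have "(\<Prod>i\<in>(UNIV::'n set). epow (ennreal (V x powr c)) (1 / (n - 1))) \<le> (\<Prod>i\<in>UNIV. epow (line_int (axis i 1) f x) (1 / (n - 1)))"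
          using n by (intro prod_mono_ennreal epow_mono) auto
        moreover have "(\<Prod>i\<in>(UNIV::'n set). epow (ennreal (V x powr c)) (1 / (n - 1))) = ennreal (V x powr r)"
        proof -
          have "(\<Prod>i\<in>(UNIV::'n set). epow (ennreal (V x powr c)) (1 / (n - 1))) = (\<Prod>i\<in>(UNIV::'n set). ennreal (V x powr (c / (n - 1))))"
            using n by (simp add: epow_ennreal powr_powr)
          also have "\<dots> = ennreal ((V x powr (c / (n - 1))) ^ CARD('n))" by (simp add: ennreal_power)
          also have "(V x powr (c / (n - 1))) ^ CARD('n) = V x powr r"
          proof (cases "V x = 0")
            case False
            then have "V x powr (c / (n - 1)) > 0" by simp
            then have "(V x powr (c / (n - 1))) ^ CARD('n) = (V x powr (c / (n - 1))) powr n"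
              by (simp add: powr_realpow n_def)
            also have "\<dots> = V x powr r" using n by (simp add: powr_powr r n_def)
            finally show ?thesis .
          qed simp
          finally show ?thesis .
        qed
        ultimately show ?case unfolding prod_Basis_axis by (simp add: n_def)
      qed
      then have "X \<le> (\<integral>\<^sup>+x. (\<Prod>b\<in>Basis. epow (line_int b f x) (1 / (real DIM(real^'n) - 1))) \<partial>lborel)"
        unfolding X_def by (rule nn_integral_mono_AE)
      also have "\<dots> \<le> epow (\<integral>\<^sup>+x. f x \<partial>lborel) (real DIM(real^'n) / (real DIM(real^'n) - 1))"
        using N by (intro Gagliardo_Nirenberg_grid fm) simp
      finally have X1: "X \<le> epow (\<integral>\<^sup>+x. f x \<partial>lborel) (n / (n - 1))" by (simp add: n_def)
      have hol: "(\<integral>\<^sup>+x. ennreal (V x powr (c - 1) * \<bar>g i x\<bar>) \<partial>lborel) \<le> ennreal (X' powr \<tau> * K powr (1 - \<tau>))" if X'0: "X' > 0" for i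
      proof -
        define F where "F j x = (if j = (0::nat) then ennreal (V x powr r) else if j = 1 then ennreal (\<bar>v x\<bar> powr p) else ennreal (\<bar>g i x\<bar> powr p))" for j x
        define a where "a j = (if j = (0::nat) then \<tau> else if j = 1 then \<sigma> else 1 / p)" for j
        have [measurable]: "F j \<in> borel_measurable lborel" for j unfolding F_def by (cases "j = 0"; cases "j = 1") auto
        have S: "{0,1,2::nat} = insert 0 (insert 1 (insert 2 {}))" by auto
        have "(\<integral>\<^sup>+x. ennreal (V x powr (c - 1) * \<bar>g i x\<bar>) \<partial>lborel) \<le> (\<integral>\<^sup>+x. (\<Prod>j\<in>{0,1,2}. epow (F j x) (a j)) \<partial>lborel)"
        proof (intro nn_integral_mono)
          fix x
          \<comment> \<open>Only an inequality: for \<tau> = 0 the left side is 1, while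
            \<open>0 powr 0 = 0\<close>. The same happens in \<open>e2\<close> for \<sigma> =
            0.\<close>
          have e1: "epow (ennreal (V x powr r)) \<tau> \<ge> ennreal (V x powr (r * \<tau>))"
            by (cases "\<tau> = 0") (auto simp: epow_ennreal powr_powr powr_zero_eq_one ennreal_leI simp flip: ennreal_1)
          have e2: "epow (ennreal (\<bar>v x\<bar> powr p)) \<sigma> \<ge> ennreal (V x powr (p * \<sigma>))"
            using V0[of x] Vv[of x] p \<sigma>0
            by (cases "\<sigma> = 0") (auto simp: epow_ennreal powr_powr intro!: ennreal_leI powr_mono2 simp flip: ennreal_1)
          have e3: "epow (ennreal (\<bar>g i x\<bar> powr p)) (1 / p) = ennreal \<bar>g i x\<bar>"
            using p by (simp add: epow_ennreal powr_powr)
          have "ennreal (V x powr (c - 1) * \<bar>g i x\<bar>) = ennreal (V x powr (r * \<tau>)) * (ennreal (V x powr (p * \<sigma>)) * ennreal \<bar>g i x\<bar>)"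
            using hom by (simp add: ennreal_mult[symmetric] mult.assoc[symmetric] powr_add[symmetric])
          also have "\<dots> \<le> epow (ennreal (V x powr r)) \<tau> * (epow (ennreal (\<bar>v x\<bar> powr p)) \<sigma> * ennreal \<bar>g i x\<bar>)"
            by (intro mult_mono e1 e2) auto
          also have "\<dots> = (\<Prod>j\<in>{0,1,2}. epow (F j x) (a j))" by (simp add: F_def a_def e3)
          finally show "ennreal (V x powr (c - 1) * \<bar>g i x\<bar>) \<le> (\<Prod>j\<in>{0,1,2}. epow (F j x) (a j))" .
        qed
        also have "\<dots> \<le> (\<Prod>j\<in>{0,1,2}. epow (\<integral>\<^sup>+x. F j x \<partial>lborel) (a j))"
          using \<tau>0 \<sigma>0 p by (intro Holder_nn_integral_prod) (auto simp: a_def \<sigma>_def)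
        also have "\<dots> = epow X \<tau> * (epow (\<integral>\<^sup>+x. ennreal (\<bar>v x\<bar> powr p) \<partial>lborel) \<sigma> * epow (\<integral>\<^sup>+x. ennreal (\<bar>g i x\<bar> powr p) \<partial>lborel) (1 / p))"
          by (simp add: F_def a_def X_def)
        also have "\<dots> \<le> epow X \<tau> * (epow (ennreal K) \<sigma> * epow (ennreal K) (1 / p))"
          using \<sigma>0 \<tau>0 p by (intro mult_mono epow_mono vK gK) auto
        also have "\<dots> = epow X \<tau> * epow (ennreal K) (1 - \<tau>)"
          using \<sigma>0 p epow_add[of \<sigma> "1 / p" "ennreal K"] by (simp add: \<sigma>_def)
        also have "\<dots> = ennreal (X' powr \<tau> * K powr (1 - \<tau>))"
        proof -
          have "epow X \<tau> = ennreal (X' powr \<tau>)" using X' X'0 by (cases "\<tau> = 0") (auto simp: epow_ennreal)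
          moreover have "epow (ennreal K) (1 - \<tau>) = ennreal (K powr (1 - \<tau>))" using K by (cases "\<tau> = 1") (auto simp: epow_ennreal)
          ultimately show ?thesis by (simp add: ennreal_mult)
        qed
        finally show ?thesis .
      qed
      show ?thesis
      proof (cases "X' = 0")
        case True
        then show ?thesis using X' by (simp add: X_def V_def)
      next
        case False
        then have X'0: "X' > 0" using X' by simp
        have "(\<integral>\<^sup>+x. f x \<partial>lborel) = (\<Sum>i\<in>UNIV. \<integral>\<^sup>+x. ennreal c * ennreal (V x powr (c - 1) * \<bar>g i x\<bar>) \<partial>lborel)"
          unfolding f_def using c p by (subst nn_integral_sum) (auto simp: ennreal_mult[symmetric] mult.assoc)
        also have "\<dots> = (\<Sum>i\<in>UNIV. ennreal c * (\<integral>\<^sup>+x. ennreal (V x powr (c - 1) * \<bar>g i x\<bar>) \<partial>lborel))"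
          by (intro sum.cong refl nn_integral_cmult) measurable
        also have "\<dots> \<le> (\<Sum>i\<in>(UNIV::'n set). ennreal c * ennreal (X' powr \<tau> * K powr (1 - \<tau>)))"
          by (intro sum_mono mult_left_mono hol X'0) auto
        also have "\<dots> = ennreal (A * X' powr \<tau>)"
          using c p by (simp add: A_def n_def ennreal_mult[symmetric] ennreal_of_nat_eq_real_of_nat mult_ac)
        finally have f_le: "(\<integral>\<^sup>+x. f x \<partial>lborel) \<le> ennreal (A * X' powr \<tau>)" .
        have "ennreal X' \<le> epow (ennreal (A * X' powr \<tau>)) (n / (n - 1))"
          using X1 epow_mono[OF _ f_le, of "n / (n - 1)"] n unfolding X'(1) by simp
        also have "\<dots> = ennreal ((A * X' powr \<tau>) powr (n / (n - 1)))"
          using n A by (simp add: epow_ennreal)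
        finally have "X' \<le> (A * X' powr \<tau>) powr (n / (n - 1))" by (simp add: ennreal_le_iff)
        then have "X' powr ((n - 1) / n) \<le> ((A * X' powr \<tau>) powr (n / (n - 1))) powr ((n - 1) / n)"
          using n X'0 by (intro powr_mono2) auto
        also have "\<dots> = A * X' powr \<tau>" using n A by (simp add: powr_powr)
        finally have "X' powr e \<le> A"
          using X'0 by (simp add: e_def powr_diff field_simps)
        then have "(X' powr e) powr (1 / e) \<le> C" unfolding C_def using e by (intro powr_mono2) auto
        then have "X' \<le> C" using e X'0 by (simp add: powr_powr)
        then show ?thesis using X' by (simp add: X_def V_def ennreal_leI)
      qed
    qed
    have "(\<integral>\<^sup>+x. ennreal (\<bar>v x\<bar> powr r) \<partial>lborel) = (\<integral>\<^sup>+x. liminf (\<lambda>k::nat. ennreal (min \<bar>v x\<bar> (real (Suc k)) powr r)) \<partial>lborel)"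
    proof (rule nn_integral_cong)
      fix x
      obtain m :: nat where m: "\<bar>v x\<bar> \<le> real m" using real_arch_simple by blast
      have "(\<lambda>k::nat. ennreal (min \<bar>v x\<bar> (real (Suc k)) powr r)) \<longlonglongrightarrow> ennreal (\<bar>v x\<bar> powr r)"
        by (rule tendsto_eventually, rule eventually_mono[OF eventually_ge_at_top[of m]]) (use m in \<open>auto simp: min_def\<close>)
      then show "ennreal (\<bar>v x\<bar> powr r) = liminf (\<lambda>k::nat. ennreal (min \<bar>v x\<bar> (real (Suc k)) powr r))"
        by (intro lim_imp_Liminf[symmetric]) auto
    qed
    \<comment> \<open>Fatou's lemma removes the truncation, as C does not depend on k.\<close>
    also have "\<dots> \<le> liminf (\<lambda>k::nat. \<integral>\<^sup>+x. ennreal (min \<bar>v x\<bar> (real (Suc k)) powr r) \<partial>lborel)"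
      by (rule nn_integral_liminf) measurable
    also have "\<dots> \<le> ennreal C"
      by (rule Liminf_le) (use main in \<open>auto intro!: always_eventually\<close>)
    finally show "(\<integral>\<^sup>+x. ennreal (\<bar>v x\<bar> powr r) \<partial>lborel) \<le> ennreal C" .
  qed
qed

section \<open>The Sobolev embedding\<close>

lemma powr_interpolate:
  fixes x :: real
  assumes "p \<le> r" "r \<le> q" shows "\<bar>x\<bar> powr r \<le> \<bar>x\<bar> powr p + \<bar>x\<bar> powr q"
proof (cases "\<bar>x\<bar> \<le> 1")
  case True
  then have "\<bar>x\<bar> powr r \<le> \<bar>x\<bar> powr p"
    using assms by (cases "x = 0") (auto intro: powr_mono')
  then show ?thesis by (simp add: add_increasing2)
next
  case False
  then have "\<bar>x\<bar> powr r \<le> \<bar>x\<bar> powr q" using assms by (intro powr_mono) auto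
  then show ?thesis by (simp add: add_increasing)
qed

text \<open>The line through a point is the whole space. Hence \<open>line_bound\<close> with c = p
  bounds the p-th power of v almost everywhere by \<open>B\<close>, and the excess power r - p is
  estimated by that bound.\<close>

lemma sobolev_step_dim1:
  fixes p r K :: real
  assumes N: "CARD('n::finite) = 1" and p: "1 < p" and r: "p \<le> r" and K: "0 < K"
  obtains C where "0 \<le> C"
    "\<And>(v :: real^'n \<Rightarrow> real) g. v \<in> borel_measurable borel \<Longrightarrow> (\<And>i. g i \<in> borel_measurable borel) \<Longrightarrow>
      (\<And>i. wderiv_dir i v (g i)) \<Longrightarrow> (\<integral>\<^sup>+x. ennreal (\<bar>v x\<bar> powr p) \<partial>lborel) \<le> ennreal K \<Longrightarrow>
      (\<And>i. (\<integral>\<^sup>+x. ennreal (\<bar>g i x\<bar> powr p) \<partial>lborel) \<le> ennreal K) \<Longrightarrow>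
      (\<integral>\<^sup>+x. ennreal (\<bar>v x\<bar> powr r) \<partial>lborel) \<le> ennreal C"
proof -
  \<comment> \<open>From \<open>p * (\<bar>v\<bar> powr (p - 1) * \<bar>g\<bar>) \<le> p *
    (\<bar>v\<bar> powr p + \<bar>g\<bar> powr p)\<close>, integrated.\<close>
  define B where "B = p * (K + K)"
  have B: "B > 0" using p K by (simp add: B_def)
  show thesis
  proof (rule that[of "B powr ((r - p) / p) * K"])
    show "0 \<le> B powr ((r - p) / p) * K" using K by simp
    fix v :: "real^'n \<Rightarrow> real" and g
    assume [measurable]: "v \<in> borel_measurable borel" "\<And>i. g i \<in> borel_measurable borel"
      and wd: "\<And>i. wderiv_dir i v (g i)" and vK: "(\<integral>\<^sup>+x. ennreal (\<bar>v x\<bar> powr p) \<partial>lborel) \<le> ennreal K"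
      and gK: "\<And>i. (\<integral>\<^sup>+x. ennreal (\<bar>g i x\<bar> powr p) \<partial>lborel) \<le> ennreal K"
    have v_fin: "(\<integral>\<^sup>+x. ennreal (\<bar>v x\<bar> powr p) \<partial>lborel) < top" using vK by (simp add: le_less_trans)
    have g_fin: "(\<integral>\<^sup>+x. ennreal (\<bar>g i x\<bar> powr p) \<partial>lborel) < top" for i using gK[of i] by (simp add: le_less_trans)
    obtain i :: 'n where i: "UNIV = {i}" using N by (metis card_1_singletonE)
    have Bs: "(Basis :: (real^'n) set) = {axis i 1}"
      using i by (auto simp: Basis_vec_def)
    have line: "line_int (axis i 1) f x = (\<integral>\<^sup>+x. f x \<partial>lborel)"
      if [measurable]: "f \<in> borel_measurable borel" for f :: "real^'n \<Rightarrow> ennreal" and x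
      using marginal_Basis[OF that, of x] marginal_insert[OF that, of "axis i 1" "{}" x]
      unfolding Bs by (simp add: marginal_empty)
    have "AE x in lborel. ennreal (min \<bar>v x\<bar> (real (Suc k)) powr p) \<le> ennreal B" for k
    proof -
      have le: "p * min \<bar>v x\<bar> (real (Suc k)) powr (p - 1) * \<bar>g i x\<bar> \<le> p * (\<bar>v x\<bar> powr p + \<bar>g i x\<bar> powr p)" for x
      proof -
        define M where "M = max \<bar>v x\<bar> \<bar>g i x\<bar>"
        have "min \<bar>v x\<bar> (real (Suc k)) powr (p - 1) * \<bar>g i x\<bar> \<le> M powr (p - 1) * M powr 1"
          using p by (intro mult_mono powr_mono2) (auto simp: M_def)
        also have "\<dots> = M powr p" unfolding powr_add[symmetric] by simp
        also have "\<dots> \<le> \<bar>v x\<bar> powr p + \<bar>g i x\<bar> powr p" by (auto simp: M_def max_def)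
        finally show ?thesis using p by (simp add: mult.assoc)
      qed
      have "line_int (axis i 1) (\<lambda>x. ennreal (p * min \<bar>v x\<bar> (real (Suc k)) powr (p - 1) * \<bar>g i x\<bar>)) x \<le> ennreal B" for x
      proof -
        have "line_int (axis i 1) (\<lambda>x. ennreal (p * min \<bar>v x\<bar> (real (Suc k)) powr (p - 1) * \<bar>g i x\<bar>)) x
          \<le> (\<integral>\<^sup>+x. ennreal p * (ennreal (\<bar>v x\<bar> powr p) + ennreal (\<bar>g i x\<bar> powr p)) \<partial>lborel)"
          using le p by (subst line) (auto intro!: nn_integral_mono ennreal_leI simp: ennreal_mult[symmetric] ennreal_plus[symmetric] simp del: ennreal_plus)
        also have "\<dots> = ennreal p * ((\<integral>\<^sup>+x. ennreal (\<bar>v x\<bar> powr p) \<partial>lborel) + (\<integral>\<^sup>+x. ennreal (\<bar>g i x\<bar> powr p) \<partial>lborel))"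
          by (simp add: nn_integral_cmult nn_integral_add)
        also have "\<dots> \<le> ennreal p * (ennreal K + ennreal K)" by (intro mult_left_mono add_mono vK gK) auto
        also have "\<dots> = ennreal B" using p K by (simp add: B_def ennreal_mult[symmetric] ennreal_plus[symmetric] del: ennreal_plus)
        finally show ?thesis .
      qed
      then show ?thesis
        using line_bound[OF _ _ less_imp_le[OF p] v_fin g_fin wd p, of i "real (Suc k)"]
        by (auto elim!: eventually_mono intro: order_trans)
    qed
    then have "AE x in lborel. \<forall>k. ennreal (min \<bar>v x\<bar> (real (Suc k)) powr p) \<le> ennreal B"
      by (subst AE_all_countable) blast
    then have vB: "AE x in lborel. ennreal (\<bar>v x\<bar> powr r) \<le> ennreal (B powr ((r - p) / p)) * ennreal (\<bar>v x\<bar> powr p)"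
    proof eventually_elim
      case (elim x)
      obtain m :: nat where m: "\<bar>v x\<bar> \<le> real m" using real_arch_simple by blast
      then have "min \<bar>v x\<bar> (real (Suc m)) = \<bar>v x\<bar>" by (simp add: min_def)
      then have vp: "\<bar>v x\<bar> powr p \<le> B" using elim[rule_format, of m] B by (simp add: ennreal_le_iff)
      have "\<bar>v x\<bar> powr r = (\<bar>v x\<bar> powr p) powr ((r - p) / p) * \<bar>v x\<bar> powr p"
        using p by (simp add: powr_powr powr_add[symmetric])
      also have "\<dots> \<le> B powr ((r - p) / p) * \<bar>v x\<bar> powr p"
        using vp p r by (intro mult_right_mono powr_mono2) auto
      finally show ?case by (simp add: ennreal_mult[symmetric] ennreal_leI)
    qed
    have "(\<integral>\<^sup>+x. ennreal (\<bar>v x\<bar> powr r) \<partial>lborel) \<le> (\<integral>\<^sup>+x. ennreal (B powr ((r - p) / p)) * ennreal (\<bar>v x\<bar> powr p) \<partial>lborel)"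
      using vB by (rule nn_integral_mono_AE)
    also have "\<dots> = ennreal (B powr ((r - p) / p)) * (\<integral>\<^sup>+x. ennreal (\<bar>v x\<bar> powr p) \<partial>lborel)"
      by (rule nn_integral_cmult) measurable
    also have "\<dots> \<le> ennreal (B powr ((r - p) / p)) * ennreal K" by (intro mult_left_mono vK) simp
    finally show "(\<integral>\<^sup>+x. ennreal (\<bar>v x\<bar> powr r) \<partial>lborel) \<le> ennreal (B powr ((r - p) / p) * K)"
      using K by (simp add: ennreal_mult)
  qed
qed

text \<open>In dimension at least 2, \<open>sobolev_step\<close> reaches the exponents r = c n/(n-1)
  with c \<ge> p. Smaller r lie between p and the exponent \<open>r1\<close> obtained for c = p, and
  follow by interpolation.\<close>

lemma sobolev_first_order_borel:
  fixes p r K :: real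
  assumes p: "1 < p" and r: "p \<le> r" "ereal r \<le> sob_exp p CARD('n::finite) 1" and K: "0 < K"
  obtains C where "0 \<le> C"
    "\<And>(v :: real^'n \<Rightarrow> real) g. v \<in> borel_measurable borel \<Longrightarrow> (\<And>i. g i \<in> borel_measurable borel) \<Longrightarrow>
      (\<And>i. wderiv_dir i v (g i)) \<Longrightarrow> (\<integral>\<^sup>+x. ennreal (\<bar>v x\<bar> powr p) \<partial>lborel) \<le> ennreal K \<Longrightarrow>
      (\<And>i. (\<integral>\<^sup>+x. ennreal (\<bar>g i x\<bar> powr p) \<partial>lborel) \<le> ennreal K) \<Longrightarrow>
      (\<integral>\<^sup>+x. ennreal (\<bar>v x\<bar> powr r) \<partial>lborel) \<le> ennreal C"
proof (cases "CARD('n) = 1")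
  case True
  show thesis using sobolev_step_dim1[OF True p r(1) K] that by blast
next
  case False
  then have N: "2 \<le> CARD('n)" using zero_less_card_finite[where 'a='n] by linarith
  define n where "n = real CARD('n)"
  have n: "2 \<le> n" using N by (simp add: n_def)
  show thesis
  proof (cases "p * n \<le> r * (n - 1)")
    case True
    define c where "c = r * (n - 1) / n"
    have c: "p \<le> c" using True n by (simp add: c_def field_simps)
    have rc: "r = c * CARD('n) / (CARD('n) - 1)" using n by (simp add: c_def n_def)
    have rp: "r * (CARD('n) - p) \<le> p * CARD('n)"
    proof (cases "n > p")
      case True
      then have "r \<le> p * n / (n - p)" using r(2) by (simp add: sob_exp_def n_def)
      then show ?thesis using True by (simp add: n_def field_simps)
    next
      case False
      have "r * (n - p) \<le> 0" using False r p by (intro mult_nonneg_nonpos) auto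
      moreover have "0 \<le> p * n" using p n by simp
      ultimately show ?thesis unfolding n_def by linarith
    qed
    show thesis using sobolev_step[OF N p c rc rp K] that by blast
  next
    case False
    define r1 where "r1 = p * n / (n - 1)"
    have r1: "r \<le> r1" using False n by (simp add: r1_def field_simps)
    have rc: "r1 = p * CARD('n) / (CARD('n) - 1)" by (simp add: r1_def n_def)
    \<comment> \<open>\<open>r1\<close> is itself at most critical because n - p \<le> n -
      1.\<close>
    have "p * n * (n - p) \<le> p * n * (n - 1)" using p n by (intro mult_left_mono) auto
    then have rp: "r1 * (CARD('n) - p) \<le> p * CARD('n)"
      using n by (simp add: r1_def n_def[symmetric] field_simps)
    obtain C where C: "0 \<le> C" "\<And>(v :: real^'n \<Rightarrow> real) g. v \<in> borel_measurable borel \<Longrightarrow> (\<And>i. g i \<in> borel_measurable borel) \<Longrightarrow>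
      (\<And>i. wderiv_dir i v (g i)) \<Longrightarrow> (\<integral>\<^sup>+x. ennreal (\<bar>v x\<bar> powr p) \<partial>lborel) \<le> ennreal K \<Longrightarrow>
      (\<And>i. (\<integral>\<^sup>+x. ennreal (\<bar>g i x\<bar> powr p) \<partial>lborel) \<le> ennreal K) \<Longrightarrow>
      (\<integral>\<^sup>+x. ennreal (\<bar>v x\<bar> powr r1) \<partial>lborel) \<le> ennreal C"
      using sobolev_step[OF N p order_refl rc rp K] by blast
    show thesis
    proof (rule that[of "K + C"])
      show "0 \<le> K + C" using C K by simp
      fix v :: "real^'n \<Rightarrow> real" and g
      assume a: "v \<in> borel_measurable borel" "\<And>i. g i \<in> borel_measurable borel"
        "\<And>i. wderiv_dir i v (g i)" "(\<integral>\<^sup>+x. ennreal (\<bar>v x\<bar> powr p) \<partial>lborel) \<le> ennreal K"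
        "\<And>i. (\<integral>\<^sup>+x. ennreal (\<bar>g i x\<bar> powr p) \<partial>lborel) \<le> ennreal K"
      note [measurable] = a(1)
      have "(\<integral>\<^sup>+x. ennreal (\<bar>v x\<bar> powr r) \<partial>lborel) \<le> (\<integral>\<^sup>+x. ennreal (\<bar>v x\<bar> powr p) + ennreal (\<bar>v x\<bar> powr r1) \<partial>lborel)"
        using powr_interpolate[OF r(1) r1] by (intro nn_integral_mono) (simp add: ennreal_leI ennreal_plus[symmetric] del: ennreal_plus)
      also have "\<dots> = (\<integral>\<^sup>+x. ennreal (\<bar>v x\<bar> powr p) \<partial>lborel) + (\<integral>\<^sup>+x. ennreal (\<bar>v x\<bar> powr r1) \<partial>lborel)"
        by (rule nn_integral_add) measurable
      also have "\<dots> \<le> ennreal K + ennreal C" by (intro add_mono a(4) C(2)[OF a])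
      finally show "(\<integral>\<^sup>+x. ennreal (\<bar>v x\<bar> powr r) \<partial>lborel) \<le> ennreal (K + C)" using C K by simp
    qed
  qed
qed

section \<open>Lebesgue representatives and induction on the order\<close>

definition unit_mi :: "'n \<Rightarrow> 'n \<Rightarrow> nat" where
  "unit_mi i = (\<lambda>j. if j = i then 1 else 0)"

lemma mi_abs_unit: "mi_abs (unit_mi i) = 1"
  and mi_abs_add: "mi_abs (\<lambda>i. \<alpha> i + \<beta> i) = mi_abs \<alpha> + mi_abs \<beta>"
  by (simp_all add: mi_abs_def unit_mi_def sum.distrib)

lemma nn_integral_lebesgue_eq_lborel: "(\<integral>\<^sup>+x. f x \<partial>lebesgue) = (\<integral>\<^sup>+x. f x \<partial>lborel)"
  by (rule nn_integral_completion)

lemma sobolev_first_order: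
  fixes p r K :: real
  assumes p: "1 < p" and r: "p \<le> r" "ereal r \<le> sob_exp p CARD('n::finite) 1" and K: "0 < K"
  obtains C where "0 \<le> C"
    "\<And>(v :: real^'n \<Rightarrow> real) g. (\<And>i. is_wderiv (unit_mi i) v (g i)) \<Longrightarrow> (\<integral>\<^sup>+x. ennreal (\<bar>v x\<bar> powr p) \<partial>lebesgue) \<le> ennreal K \<Longrightarrow>
      (\<And>i. (\<integral>\<^sup>+x. ennreal (\<bar>g i x\<bar> powr p) \<partial>lebesgue) \<le> ennreal K) \<Longrightarrow>
      (\<integral>\<^sup>+x. ennreal (\<bar>v x\<bar> powr r) \<partial>lebesgue) \<le> ennreal C"
proof -
  obtain C where C: "0 \<le> C" "\<And>(v :: real^'n \<Rightarrow> real) g. v \<in> borel_measurable borel \<Longrightarrow> (\<And>i. g i \<in> borel_measurable borel) \<Longrightarrow>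
      (\<And>i. wderiv_dir i v (g i)) \<Longrightarrow> (\<integral>\<^sup>+x. ennreal (\<bar>v x\<bar> powr p) \<partial>lborel) \<le> ennreal K \<Longrightarrow>
      (\<And>i. (\<integral>\<^sup>+x. ennreal (\<bar>g i x\<bar> powr p) \<partial>lborel) \<le> ennreal K) \<Longrightarrow>
      (\<integral>\<^sup>+x. ennreal (\<bar>v x\<bar> powr r) \<partial>lborel) \<le> ennreal C"
    using sobolev_first_order_borel[OF p r K] by blast
  show thesis
  proof (rule that[OF C(1)])
    fix v :: "real^'n \<Rightarrow> real" and g
    assume wd: "\<And>i. is_wderiv (unit_mi i) v (g i)" and vK: "(\<integral>\<^sup>+x. ennreal (\<bar>v x\<bar> powr p) \<partial>lebesgue) \<le> ennreal K"
      and gK: "\<And>i. (\<integral>\<^sup>+x. ennreal (\<bar>g i x\<bar> powr p) \<partial>lebesgue) \<le> ennreal K"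
    have vm: "v \<in> borel_measurable lebesgue" and gm: "g i \<in> borel_measurable lebesgue" for i
      using wd by (auto simp: is_wderiv_def loc_int_def)
    obtain v' where v': "v' \<in> borel_measurable lborel" "AE x in lborel. v x = v' x"
      using completion_ex_borel_measurable_real[OF vm] by blast
    have "\<exists>h. h \<in> borel_measurable lborel \<and> (AE x in lborel. g i x = h x)" for i
      using completion_ex_borel_measurable_real[OF gm[of i]] by blast
    then obtain g' where g': "\<And>i. g' i \<in> borel_measurable lborel" "\<And>i. AE x in lborel. g i x = g' i x" by metis
    have cong: "(\<integral>\<^sup>+x. ennreal (\<bar>f x\<bar> powr q) \<partial>lebesgue) = (\<integral>\<^sup>+x. ennreal (\<bar>f' x\<bar> powr q) \<partial>lborel)"
      if "AE x in lborel. f x = f' x" for f f' :: "real^'n \<Rightarrow> real" and q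
      unfolding nn_integral_lebesgue_eq_lborel by (rule nn_integral_cong_AE) (use that in auto)
    have "wderiv_dir i v' (g' i)" for i
      unfolding wderiv_dir_def
    proof (intro allI impI)
      fix \<phi> :: "real^'n \<Rightarrow> real" assume t: "test_fun \<phi>"
      have "is_wderiv (unit_mi i) v' (g' i)"
        using is_wderiv_cong_AE[OF wd[of i] AE_completion[OF v'(2)] AE_completion[OF g'(2)]] .
      moreover have "\<forall>j. count_list [i] j = unit_mi i j" by (simp add: unit_mi_def)
      ultimately have "(\<integral>x. v' x * iter_pd [i] \<phi> x \<partial>lebesgue) = (-1) ^ mi_abs (unit_mi i) * (\<integral>x. g' i x * \<phi> x \<partial>lebesgue)"
        using t unfolding is_wderiv_def by blast
      then have "(\<integral>x. v' x * pd i \<phi> x \<partial>lebesgue) = - (\<integral>x. g' i x * \<phi> x \<partial>lebesgue)" by (simp add: mi_abs_unit)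
      moreover have "(\<integral>x. v' x * pd i \<phi> x \<partial>lebesgue) = (\<integral>x. v' x * pd i \<phi> x \<partial>lborel)"
        using v'(1) test_fun_measurable[OF test_fun_pd[OF t]] by (intro integral_completion) auto
      moreover have "(\<integral>x. g' i x * \<phi> x \<partial>lebesgue) = (\<integral>x. g' i x * \<phi> x \<partial>lborel)"
        using g'(1) test_fun_measurable[OF t] by (intro integral_completion) auto
      ultimately show "(\<integral>x. v' x * pd i \<phi> x \<partial>lborel) = - (\<integral>x. g' i x * \<phi> x \<partial>lborel)" by simp
    qed
    moreover have "v' \<in> borel_measurable borel" "\<And>i. g' i \<in> borel_measurable borel" using v' g' by auto
    ultimately have "(\<integral>\<^sup>+x. ennreal (\<bar>v' x\<bar> powr r) \<partial>lborel) \<le> ennreal C"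
      using vK gK unfolding cong[OF v'(2)] cong[OF g'(2)] by (intro C(2))
    then show "(\<integral>\<^sup>+x. ennreal (\<bar>v x\<bar> powr r) \<partial>lebesgue) \<le> ennreal C" unfolding cong[OF v'(2)] .
  qed
qed

text \<open>Each derivative is bounded separately by one constant, and existentially. In this form
  the property passes to derivatives of v with the same K, and the choice made by \<open>wd\<close>
  stays out of the induction.\<close>

definition wderivs_bounded :: "nat \<Rightarrow> real \<Rightarrow> real \<Rightarrow> (real^'n::finite \<Rightarrow> real) \<Rightarrow> bool" where
  "wderivs_bounded k p K v \<longleftrightarrow> (\<forall>\<beta>. mi_abs \<beta> \<le> k \<longrightarrow>
     (\<exists>g. is_wderiv \<beta> v g \<and> (\<integral>\<^sup>+x. ennreal (\<bar>g x\<bar> powr p) \<partial>lebesgue) \<le> ennreal K))"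

lemma is_wderiv_0: "loc_int v \<Longrightarrow> is_wderiv (\<lambda>_. 0) v v"
proof -
  have "is = []" if "\<forall>i. count_list is i = 0" for "is" :: "'a list"
    using that by (metis count_list_0_iff list.set_intros(1) neq_Nil_conv)
  then show "loc_int v \<Longrightarrow> is_wderiv (\<lambda>_. 0) v v" by (fastforce simp: is_wderiv_def mi_abs_def)
qed

lemma wderivs_bounded_0:
  assumes "wderivs_bounded k p K v"
  shows "(\<integral>\<^sup>+x. ennreal (\<bar>v x\<bar> powr p) \<partial>lebesgue) \<le> ennreal K"
proof -
  obtain g where g: "is_wderiv (\<lambda>_. 0) v g" "(\<integral>\<^sup>+x. ennreal (\<bar>g x\<bar> powr p) \<partial>lebesgue) \<le> ennreal K"
    using assms unfolding wderivs_bounded_def by (metis (no_types) mi_abs_def sum.neutral_const zero_le)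
  have "AE x in lebesgue. v x = g x"
  proof (rule is_wderiv_unique[OF is_wderiv_0 g(1)])
    show "loc_int v" using g(1) by (simp add: is_wderiv_def)
  qed
  then have "(\<integral>\<^sup>+x. ennreal (\<bar>v x\<bar> powr p) \<partial>lebesgue) = (\<integral>\<^sup>+x. ennreal (\<bar>g x\<bar> powr p) \<partial>lebesgue)"
    by (intro nn_integral_cong_AE) auto
  with g(2) show ?thesis by simp
qed

lemma wderivs_bounded_deriv:
  assumes v: "wderivs_bounded (k + mi_abs \<alpha>) p K v" and g: "is_wderiv \<alpha> v g"
  shows "wderivs_bounded k p K g"
  unfolding wderivs_bounded_def
proof (intro allI impI)
  fix \<beta> :: "'a \<Rightarrow> nat" assume "mi_abs \<beta> \<le> k"
  then have "mi_abs (\<lambda>i. \<alpha> i + \<beta> i) \<le> k + mi_abs \<alpha>" by (simp add: mi_abs_add)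
  then obtain h where h: "is_wderiv (\<lambda>i. \<alpha> i + \<beta> i) v h" "(\<integral>\<^sup>+x. ennreal (\<bar>h x\<bar> powr p) \<partial>lebesgue) \<le> ennreal K"
    using v unfolding wderivs_bounded_def by blast
  then show "\<exists>h. is_wderiv \<beta> g h \<and> (\<integral>\<^sup>+x. ennreal (\<bar>h x\<bar> powr p) \<partial>lebesgue) \<le> ennreal K"
    using is_wderiv_deriv[OF g h(1)] by blast
qed

lemma wderivs_bounded_mono: "wderivs_bounded k p K v \<Longrightarrow> j \<le> k \<Longrightarrow> wderivs_bounded j p K v"
  by (auto simp: wderivs_bounded_def)

text \<open>Induction on the order. Both v and its first derivatives have k derivatives in L^p, so
  by the induction hypothesis they lie in L^P with P the exponent of order k; the first-order
  inequality at P then covers all r up to the exponent of order k + 1.\<close>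

theorem sobolev_embedding:
  fixes p r K :: real
  assumes "1 < p" "p \<le> r" "ereal r \<le> sob_exp p CARD('n::finite) k" "0 < K"
  shows "\<exists>C\<ge>0. \<forall>v :: real^'n \<Rightarrow> real. wderivs_bounded k p K v \<longrightarrow> (\<integral>\<^sup>+x. ennreal (\<bar>v x\<bar> powr r) \<partial>lebesgue) \<le> ennreal C"
  using assms
proof (induction k arbitrary: r)
  case 0
  then have "r = p" by (simp add: sob_exp_def)
  then show ?case using wderivs_bounded_0 0 by (intro exI[of _ K]) auto
next
  case (Suc k)
  let ?n = "real CARD('n)"
  show ?case
  proof (cases "ereal r \<le> sob_exp p CARD('n) k")
    case True
    then obtain C where "C \<ge> 0" "\<forall>v :: real^'n \<Rightarrow> real. wderivs_bounded k p K v \<longrightarrow> (\<integral>\<^sup>+x. ennreal (\<bar>v x\<bar> powr r) \<partial>lebesgue) \<le> ennreal C"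
      using Suc by blast
    then show ?thesis using wderivs_bounded_mono[of "Suc k" p K _ k] by (intro exI[of _ C]) auto
  next
    case False
    then have kn: "?n > real k * p" and r: "r > p * ?n / (?n - real k * p)"
      by (auto simp: sob_exp_def split: if_splits)
    define P where "P = p * ?n / (?n - real k * p)"
    have n: "?n > 0" by simp
    have pP: "p \<le> P"
    proof -
      have "p * (?n - real k * p) \<le> p * ?n" using Suc.prems by (intro mult_left_mono) auto
      then show ?thesis using kn by (simp add: P_def field_simps)
    qed
    have se: "sob_exp p CARD('n) k = ereal P" using kn by (simp add: sob_exp_def P_def)
    obtain C where C: "C \<ge> 0" "\<And>v :: real^'n \<Rightarrow> real. wderivs_bounded k p K v \<Longrightarrow> (\<integral>\<^sup>+x. ennreal (\<bar>v x\<bar> powr P) \<partial>lebesgue) \<le> ennreal C"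
      using Suc.IH[of P] Suc.prems pP se by auto
    have r': "ereal r \<le> sob_exp P CARD('n) 1"
    proof (cases "?n > P")
      case True
      have "p * ?n < ?n * (?n - real k * p)" using True kn by (simp add: P_def field_simps)
      then have "p < ?n - real k * p" by simp
      then have k1: "?n > real (Suc k) * p" by (simp add: algebra_simps)
      \<comment> \<open>Orders add up under iterated conjugation: 1/P = 1/p - k/n, and one further
        step subtracts 1/n.\<close>
      have "P * ?n / (?n - P) = p * ?n / (?n - real (Suc k) * p)"
      proof -
        define d where "d = ?n - real k * p"
        have d: "0 < d" "0 < d - p" using kn k1 by (simp_all add: d_def algebra_simps)
        have Pd: "P = p * ?n / d" by (simp add: P_def d_def)
        have "?n - P = ?n * (d - p) / d" using d by (simp add: Pd field_simps)
        then have "P * ?n / (?n - P) = p * ?n / (d - p)" using d n by (simp add: Pd)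
        then show ?thesis by (simp add: d_def algebra_simps)
      qed
      then show ?thesis using Suc.prems True k1 by (simp add: sob_exp_def)
    qed (simp add: sob_exp_def)
    have P1: "1 < P" "P \<le> r" using pP Suc.prems r by (auto simp: P_def)
    \<comment> \<open>\<open>sobolev_first_order\<close> takes a positive bound, whereas C may be
      0.\<close>
    have C1: "0 < C + 1" using C by simp
    obtain D where D: "0 \<le> D"
    "\<And>(v :: real^'n \<Rightarrow> real) g. (\<And>i. is_wderiv (unit_mi i) v (g i)) \<Longrightarrow> (\<integral>\<^sup>+x. ennreal (\<bar>v x\<bar> powr P) \<partial>lebesgue) \<le> ennreal (C + 1) \<Longrightarrow>
      (\<And>i. (\<integral>\<^sup>+x. ennreal (\<bar>g i x\<bar> powr P) \<partial>lebesgue) \<le> ennreal (C + 1)) \<Longrightarrow>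
      (\<integral>\<^sup>+x. ennreal (\<bar>v x\<bar> powr r) \<partial>lebesgue) \<le> ennreal D"
      using sobolev_first_order[OF P1 r' C1] by blast
    have C': "(\<integral>\<^sup>+x. ennreal (\<bar>v x\<bar> powr P) \<partial>lebesgue) \<le> ennreal (C + 1)" if "wderivs_bounded k p K v" for v :: "real^'n \<Rightarrow> real"
      using C(2)[OF that] by (rule order_trans) (simp add: ennreal_leI)
    have "(\<integral>\<^sup>+x. ennreal (\<bar>v x\<bar> powr r) \<partial>lebesgue) \<le> ennreal D" if v: "wderivs_bounded (Suc k) p K v" for v :: "real^'n \<Rightarrow> real"
    proof -
      have "\<exists>g. is_wderiv (unit_mi i) v g" for i
        using v mi_abs_unit[of i] unfolding wderivs_bounded_def by (auto dest!: spec[of _ "unit_mi i"])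
      then obtain g where g: "\<And>i. is_wderiv (unit_mi i) v (g i)" by metis
      show ?thesis
      proof (rule D(2)[OF g])
        show "(\<integral>\<^sup>+x. ennreal (\<bar>v x\<bar> powr P) \<partial>lebesgue) \<le> ennreal (C + 1)"
          by (intro C' wderivs_bounded_mono[OF v]) simp
        show "(\<integral>\<^sup>+x. ennreal (\<bar>g i x\<bar> powr P) \<partial>lebesgue) \<le> ennreal (C + 1)" for i
          by (intro C' wderivs_bounded_deriv[OF _ g]) (use v mi_abs_unit[of i] in auto)
      qed
    qed
    then show ?thesis using D(1) by blast
  qed
qed

section \<open>Splitting of integrals along diverging translates\<close>

text \<open>Either d \<le> \<delta> T, and the first term on the right suffices, or T < d/\<delta>,
  and the second does. All small-coefficient estimates for differences of powers come from
  here.\<close>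

lemma young_powr:
  fixes d T \<delta> r :: real
  assumes "0 \<le> d" "d \<le> T" "0 < \<delta>" "1 \<le> r"
  shows "d * T powr (r - 1) \<le> \<delta> * T powr r + \<delta> powr (1 - r) * d powr r"
proof (cases "d = 0")
  case False
  then have T: "T > 0" "d > 0" using assms by auto
  show ?thesis
  proof (cases "d \<le> \<delta> * T")
    case True
    have "d * T powr (r - 1) \<le> \<delta> * T * T powr (r - 1)" by (intro mult_right_mono True) auto
    also have "\<dots> = \<delta> * T powr r" using T by (simp add: powr_diff)
    finally show ?thesis using T by (simp add: add_increasing2)
  next
    case False
    then have "T powr (r - 1) \<le> (d / \<delta>) powr (r - 1)"
      using assms T by (intro powr_mono2) (auto simp: field_simps)
    then have "d * T powr (r - 1) \<le> d * (d / \<delta>) powr (r - 1)" using T by (intro mult_left_mono) auto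
    also have "\<dots> = \<delta> powr (1 - r) * d powr r"
      using T assms by (simp add: powr_divide powr_diff field_simps)
    finally show ?thesis using assms by (simp add: add_increasing)
  qed
qed (use assms in auto)

text \<open>Every term is at most the largest one. The constant grows with the number of terms, so
  this serves for a fixed set of profiles; bounds uniform in that number come from
  \<open>profile_energy_bound\<close>.\<close>

lemma powr_sum_le:
  fixes a :: "'i \<Rightarrow> real"
  assumes I: "finite I" and r: "0 \<le> r"
  shows "\<bar>\<Sum>i\<in>I. a i\<bar> powr r \<le> real (card I) powr r * (\<Sum>i\<in>I. \<bar>a i\<bar> powr r)"
proof (cases "I = {}")
  case False
  define m where "m = Max ((\<lambda>i. \<bar>a i\<bar>) ` I)"
  have m: "\<bar>a i\<bar> \<le> m" if "i \<in> I" for i using I that by (simp add: m_def)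
  have "m \<in> (\<lambda>i. \<bar>a i\<bar>) ` I" unfolding m_def using I False by (intro Max_in) auto
  then obtain j where j: "j \<in> I" "m = \<bar>a j\<bar>" by auto
  have "\<bar>\<Sum>i\<in>I. a i\<bar> \<le> (\<Sum>i\<in>I. \<bar>a i\<bar>)" by (rule sum_abs)
  also have "\<dots> \<le> (\<Sum>i\<in>I. m)" by (rule sum_mono[OF m])
  finally have "\<bar>\<Sum>i\<in>I. a i\<bar> powr r \<le> (real (card I) * m) powr r" using r by (intro powr_mono2) auto
  also have "\<dots> = real (card I) powr r * m powr r" using j by (simp add: powr_mult)
  also have "m powr r \<le> (\<Sum>i\<in>I. \<bar>a i\<bar> powr r)"
    unfolding j(2) using I j(1) by (intro member_le_sum[of j I "\<lambda>i. \<bar>a i\<bar> powr r"]) auto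
  finally show ?thesis by (simp add: mult_left_mono)
qed simp

lemma powr_add_le:
  fixes a b :: real
  assumes "0 \<le> r"
  shows "(\<bar>a\<bar> + \<bar>b\<bar>) powr r \<le> 2 powr r * (\<bar>a\<bar> powr r + \<bar>b\<bar> powr r)"
  using powr_sum_le[of "UNIV :: bool set" r "\<lambda>i. if i then \<bar>a\<bar> else \<bar>b\<bar>"] assms
  by (simp add: UNIV_bool add.commute)

section \<open>Borel functions with integrable powers\<close>

definition Lpb :: "real \<Rightarrow> ('a::euclidean_space \<Rightarrow> real) \<Rightarrow> bool" where
  "Lpb r f \<longleftrightarrow> f \<in> borel_measurable borel \<and> integrable lborel (\<lambda>x. \<bar>f x\<bar> powr r)"

lemma Lpb_measurable: "Lpb r f \<Longrightarrow> f \<in> borel_measurable borel"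
  and Lpb_integrable: "Lpb r f \<Longrightarrow> integrable lborel (\<lambda>x. \<bar>f x\<bar> powr r)"
  by (auto simp: Lpb_def)

lemma Lpb_bound:
  assumes "Lpb r g" "f \<in> borel_measurable borel" "\<And>x. \<bar>f x\<bar> \<le> \<bar>g x\<bar>" "0 \<le> r"
  shows "Lpb r f" "(\<integral>x. \<bar>f x\<bar> powr r \<partial>lborel) \<le> (\<integral>x. \<bar>g x\<bar> powr r \<partial>lborel)"
proof -
  have le: "\<bar>f x\<bar> powr r \<le> \<bar>g x\<bar> powr r" for x using assms by (intro powr_mono2) auto
  have "integrable lborel (\<lambda>x. \<bar>f x\<bar> powr r)"
    using Lpb_integrable[OF assms(1)] by (rule Bochner_Integration.integrable_bound) (use assms(2) le in auto)
  then show "Lpb r f" using assms by (simp add: Lpb_def)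
  then show "(\<integral>x. \<bar>f x\<bar> powr r \<partial>lborel) \<le> (\<integral>x. \<bar>g x\<bar> powr r \<partial>lborel)"
    using assms le by (intro integral_mono) (auto dest: Lpb_integrable)
qed

lemma borel_measurable_shift:
  fixes f :: "'a::euclidean_space \<Rightarrow> real"
  assumes [measurable]: "f \<in> borel_measurable borel"
  shows "(\<lambda>x. f (x - c)) \<in> borel_measurable borel"
  by measurable

lemma Lpb_shift: "Lpb r f \<Longrightarrow> Lpb r (\<lambda>x. f (x - c))"
  and integral_shift: "f \<in> borel_measurable borel \<Longrightarrow> (\<integral>x. \<bar>f (x - c)\<bar> powr r \<partial>lborel) = (\<integral>x. \<bar>f x\<bar> powr r \<partial>lborel)"
proof -
  show "Lpb r f \<Longrightarrow> Lpb r (\<lambda>x. f (x - c))"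
  proof -
    assume f: "Lpb r f"
    note [measurable] = Lpb_measurable[OF f]
    show "Lpb r (\<lambda>x. f (x - c))"
      using lborel_shift(2)[of "\<lambda>x. \<bar>f x\<bar> powr r" "- c"] f unfolding Lpb_def by simp
  qed
  show "f \<in> borel_measurable borel \<Longrightarrow> (\<integral>x. \<bar>f (x - c)\<bar> powr r \<partial>lborel) = (\<integral>x. \<bar>f x\<bar> powr r \<partial>lborel)"
    using lborel_shift(1)[of "\<lambda>x. \<bar>f x\<bar> powr r" "- c"] by simp
qed

lemma Lpb_sum:
  assumes I: "finite I" and f: "\<And>i. i \<in> I \<Longrightarrow> Lpb r (f i)" and r: "0 \<le> r"
  shows "Lpb r (\<lambda>x. \<Sum>i\<in>I. f i x)"
    and "(\<integral>x. \<bar>\<Sum>i\<in>I. f i x\<bar> powr r \<partial>lborel) \<le> real (card I) powr r * (\<Sum>i\<in>I. \<integral>x. \<bar>f i x\<bar> powr r \<partial>lborel)"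
proof -
  have m: "(\<lambda>x. \<Sum>i\<in>I. f i x) \<in> borel_measurable borel"
    using f by (intro borel_measurable_sum) (auto dest: Lpb_measurable)
  have i: "integrable lborel (\<lambda>x. real (card I) powr r * (\<Sum>i\<in>I. \<bar>f i x\<bar> powr r))"
    using f by (intro integrable_mult_right Bochner_Integration.integrable_sum Lpb_integrable)
  have "integrable lborel (\<lambda>x. \<bar>\<Sum>i\<in>I. f i x\<bar> powr r)"
    using i by (rule Bochner_Integration.integrable_bound)
      (use m powr_sum_le[OF I r] in \<open>auto simp: sum_nonneg abs_mult intro!: AE_I2\<close>)
  then show L: "Lpb r (\<lambda>x. \<Sum>i\<in>I. f i x)" using m by (simp add: Lpb_def)
  have "(\<integral>x. \<bar>\<Sum>i\<in>I. f i x\<bar> powr r \<partial>lborel) \<le> (\<integral>x. real (card I) powr r * (\<Sum>i\<in>I. \<bar>f i x\<bar> powr r) \<partial>lborel)"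
    using i Lpb_integrable[OF L] powr_sum_le[OF I r] by (intro integral_mono) auto
  also have "\<dots> = real (card I) powr r * (\<Sum>i\<in>I. \<integral>x. \<bar>f i x\<bar> powr r \<partial>lborel)"
    using f by (simp add: Lpb_integrable)
  finally show "(\<integral>x. \<bar>\<Sum>i\<in>I. f i x\<bar> powr r \<partial>lborel) \<le> real (card I) powr r * (\<Sum>i\<in>I. \<integral>x. \<bar>f i x\<bar> powr r \<partial>lborel)" .
qed

lemma Lpb_add_abs:
  assumes a: "Lpb r a" and b: "Lpb r b" and r: "0 \<le> r"
  shows "integrable lborel (\<lambda>x. (\<bar>a x\<bar> + \<bar>b x\<bar>) powr r)"
    and "(\<integral>x. (\<bar>a x\<bar> + \<bar>b x\<bar>) powr r \<partial>lborel) \<le> 2 powr r * ((\<integral>x. \<bar>a x\<bar> powr r \<partial>lborel) + (\<integral>x. \<bar>b x\<bar> powr r \<partial>lborel))"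
    and "Lpb r (\<lambda>x. a x - b x)"
proof -
  note [measurable] = Lpb_measurable[OF a] Lpb_measurable[OF b]
  have i: "integrable lborel (\<lambda>x. 2 powr r * (\<bar>a x\<bar> powr r + \<bar>b x\<bar> powr r))"
    using a b by (auto dest: Lpb_integrable)
  show ii: "integrable lborel (\<lambda>x. (\<bar>a x\<bar> + \<bar>b x\<bar>) powr r)"
    using i by (rule Bochner_Integration.integrable_bound) (use powr_add_le[OF r] in \<open>auto simp: abs_mult intro!: AE_I2\<close>)
  have "(\<integral>x. (\<bar>a x\<bar> + \<bar>b x\<bar>) powr r \<partial>lborel) \<le> (\<integral>x. 2 powr r * (\<bar>a x\<bar> powr r + \<bar>b x\<bar> powr r) \<partial>lborel)"
    using i ii powr_add_le[OF r] by (intro integral_mono) auto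
  then show "(\<integral>x. (\<bar>a x\<bar> + \<bar>b x\<bar>) powr r \<partial>lborel) \<le> 2 powr r * ((\<integral>x. \<bar>a x\<bar> powr r \<partial>lborel) + (\<integral>x. \<bar>b x\<bar> powr r \<partial>lborel))"
    using a b by (simp add: Lpb_integrable)
  have "Lpb r (\<lambda>x. \<bar>a x\<bar> + \<bar>b x\<bar>)" using ii by (simp add: Lpb_def)
  then show "Lpb r (\<lambda>x. a x - b x)" by (rule Lpb_bound(1)) (use r in auto)
qed

text \<open>Quantitative uniform continuity, uniform in x: the coefficient of the sizes is as small
  as desired, at the price of a large coefficient of the difference. Integrals of
  \<open>F x (a x)\<close> are then uniformly continuous in a on sets bounded in L^r for all r in
  \<open>E\<close>.\<close>

definition growth_mod :: "real set \<Rightarrow> ('a \<Rightarrow> real \<Rightarrow> real) \<Rightarrow> bool" where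
  "growth_mod E F \<longleftrightarrow> (\<forall>\<delta>>0. \<exists>C\<ge>0. \<forall>x a b.
     \<bar>F x a - F x b\<bar> \<le> (\<Sum>r\<in>E. \<delta> * (\<bar>a\<bar> + \<bar>b\<bar>) powr r + C * \<bar>a - b\<bar> powr r))"

lemma Nemytskii_integrable:
  fixes F :: "'a::euclidean_space \<Rightarrow> real \<Rightarrow> real"
  assumes E: "finite E" and Em: "(\<lambda>(x, s). F x s) \<in> borel_measurable (borel \<Otimes>\<^sub>M borel)"
    and F0: "\<And>x. F x 0 = 0" and G: "growth_mod E F"
    and a: "\<And>r. r \<in> E \<Longrightarrow> Lpb r a" and am: "a \<in> borel_measurable borel"
  shows "integrable lborel (\<lambda>x. F x (a x))"
proof -
  obtain C where C: "C \<ge> 0" "\<And>x a b. \<bar>F x a - F x b\<bar> \<le> (\<Sum>r\<in>E. 1 * (\<bar>a\<bar> + \<bar>b\<bar>) powr r + C * \<bar>a - b\<bar> powr r)"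
    using G unfolding growth_mod_def by (metis zero_less_one)
  have "integrable lborel (\<lambda>x. \<Sum>r\<in>E. 1 * \<bar>a x\<bar> powr r + C * \<bar>a x\<bar> powr r)"
    using a by (intro integrable_mult_right Bochner_Integration.integrable_sum Bochner_Integration.integrable_add Lpb_integrable)
  then show ?thesis
  proof (rule Bochner_Integration.integrable_bound)
    show "(\<lambda>x. F x (a x)) \<in> borel_measurable lborel"
      using measurable_compose[OF measurable_Pair[OF measurable_ident_sets[OF refl] am] Em] by simp
    have "\<bar>F x (a x)\<bar> \<le> \<bar>\<Sum>r\<in>E. 1 * \<bar>a x\<bar> powr r + C * \<bar>a x\<bar> powr r\<bar>" for x
      using C(2)[of x "a x" 0] F0 by simp
    then show "AE x in lborel. norm (F x (a x)) \<le> norm (\<Sum>r\<in>E. 1 * \<bar>a x\<bar> powr r + C * \<bar>a x\<bar> powr r)" by simp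
  qed
qed

lemma integral_diff_bound:
  fixes F :: "'a::euclidean_space \<Rightarrow> real \<Rightarrow> real"
  assumes E: "finite E" and i: "integrable lborel (\<lambda>x. F x (a x))" "integrable lborel (\<lambda>x. F x (b x))"
    and C: "\<And>x. \<bar>F x (a x) - F x (b x)\<bar> \<le> (\<Sum>r\<in>E. \<delta> r * (\<bar>a x\<bar> + \<bar>b x\<bar>) powr r + C r * \<bar>a x - b x\<bar> powr r)"
    and ab: "\<And>r. r \<in> E \<Longrightarrow> Lpb r a" "\<And>r. r \<in> E \<Longrightarrow> Lpb r b" and E0: "\<And>r. r \<in> E \<Longrightarrow> 0 \<le> r"
  shows "\<bar>(\<integral>x. F x (a x) \<partial>lborel) - (\<integral>x. F x (b x) \<partial>lborel)\<bar>
    \<le> (\<Sum>r\<in>E. \<delta> r * (\<integral>x. (\<bar>a x\<bar> + \<bar>b x\<bar>) powr r \<partial>lborel) + C r * (\<integral>x. \<bar>a x - b x\<bar> powr r \<partial>lborel))"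
proof -
  have i1: "integrable lborel (\<lambda>x. (\<bar>a x\<bar> + \<bar>b x\<bar>) powr r)" "integrable lborel (\<lambda>x. \<bar>a x - b x\<bar> powr r)" if "r \<in> E" for r
    using Lpb_add_abs[OF ab(1)[OF that] ab(2)[OF that] E0[OF that]] by (auto dest: Lpb_integrable)
  have "\<bar>(\<integral>x. F x (a x) \<partial>lborel) - (\<integral>x. F x (b x) \<partial>lborel)\<bar> = \<bar>\<integral>x. F x (a x) - F x (b x) \<partial>lborel\<bar>" using i by simp
  also have "\<dots> \<le> (\<integral>x. (\<Sum>r\<in>E. \<delta> r * (\<bar>a x\<bar> + \<bar>b x\<bar>) powr r + C r * \<bar>a x - b x\<bar> powr r) \<partial>lborel)"
    using i i1 C by (intro integral_abs_bound_integral) auto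
  also have "\<dots> = (\<Sum>r\<in>E. \<delta> r * (\<integral>x. (\<bar>a x\<bar> + \<bar>b x\<bar>) powr r \<partial>lborel) + C r * (\<integral>x. \<bar>a x - b x\<bar> powr r \<partial>lborel))"
    using i1 by simp
  finally show ?thesis .
qed

lemma tail_tendsto_0:
  assumes w: "Lpb r w" and r: "0 < r"
  shows "(\<lambda>k. \<integral>x. \<bar>w x - indicator (ball 0 (real k)) x * w x\<bar> powr r \<partial>lborel) \<longlonglongrightarrow> 0"
proof -
  note [measurable] = Lpb_measurable[OF w]
  have [measurable]: "ball 0 s \<in> sets (borel :: 'a measure)" for s by simp
  have "(\<lambda>k. \<integral>x. \<bar>w x - indicator (ball 0 (real k)) x * w x\<bar> powr r \<partial>lborel) \<longlonglongrightarrow> (\<integral>x. 0 \<partial>(lborel :: 'a measure))"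
  proof (rule integral_dominated_convergence[where w="\<lambda>x. \<bar>w x\<bar> powr r"])
    show "integrable lborel (\<lambda>x. \<bar>w x\<bar> powr r)" using w by (rule Lpb_integrable)
    show "AE x in lborel. (\<lambda>k. \<bar>w x - indicator (ball 0 (real k)) x * w x\<bar> powr r) \<longlonglongrightarrow> 0"
    proof (rule AE_I2)
      fix x :: 'a
      obtain m :: nat where m: "norm x < real m" using reals_Archimedean2 by blast
      show "(\<lambda>k. \<bar>w x - indicator (ball 0 (real k)) x * w x\<bar> powr r) \<longlonglongrightarrow> 0"
        by (rule tendsto_eventually, rule eventually_mono[OF eventually_ge_at_top[of m]]) (use m in \<open>auto simp: indicator_def\<close>)
    qed
    show "AE x in lborel. norm (\<bar>w x - indicator (ball 0 (real k)) x * w x\<bar> powr r) \<le> \<bar>w x\<bar> powr r" for k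
      by (intro AE_I2) (auto simp: indicator_def)
  qed auto
  then show ?thesis by simp
qed

lemma eventually_separated:
  fixes y :: "'i \<Rightarrow> nat \<Rightarrow> 'a::real_normed_vector"
  assumes I: "finite I" and sep: "\<And>l k. l \<in> I \<Longrightarrow> k \<in> I \<Longrightarrow> l \<noteq> k \<Longrightarrow> filterlim (\<lambda>n. norm (y l n - y k n)) at_top sequentially"
  shows "\<forall>\<^sub>F n in sequentially. \<forall>l\<in>I. \<forall>k\<in>I. l \<noteq> k \<longrightarrow> B \<le> norm (y l n - y k n)"
proof -
  have "\<forall>\<^sub>F n in sequentially. \<forall>k\<in>I. l \<noteq> k \<longrightarrow> B \<le> norm (y l n - y k n)" if "l \<in> I" for l
  proof (rule eventually_ball_finite[OF I], rule ballI)
    fix k assume k: "k \<in> I"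
    show "\<forall>\<^sub>F n in sequentially. l \<noteq> k \<longrightarrow> B \<le> norm (y l n - y k n)"
      using sep[OF that k] by (cases "l = k") (auto simp: filterlim_at_top)
  qed
  then show ?thesis by (intro eventually_ball_finite[OF I]) auto
qed

lemma separated_unique:
  fixes y :: "'i \<Rightarrow> 'a::real_normed_vector"
  assumes "\<And>l k. l \<in> I \<Longrightarrow> k \<in> I \<Longrightarrow> l \<noteq> k \<Longrightarrow> 2 * B \<le> norm (y l - y k)"
    and "l \<in> I" "k \<in> I" "x - y l \<in> ball 0 B" "x - y k \<in> ball 0 B"
  shows "l = k"
proof (rule ccontr)
  assume "l \<noteq> k"
  then have "2 * B \<le> norm (y l - y k)" using assms by blast
  also have "\<dots> \<le> norm (x - y l) + norm (x - y k)"
    using norm_triangle_ineq4[of "x - y k" "x - y l"] by (simp add: add.commute)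
  also have "\<dots> < 2 * B" using assms(4,5) by simp
  finally show False by simp
qed

text \<open>Cutting the profiles off outside large balls makes their translates disjoint for large \<open>n\<close>,
where the integral splits exactly; \<open>growth_mod\<close> controls the error uniformly in \<open>n\<close>.\<close>

lemma Nemytskii_splitting:
  fixes F :: "'a::euclidean_space \<Rightarrow> real \<Rightarrow> real" and \<omega> :: "'i \<Rightarrow> 'a \<Rightarrow> real"
  assumes E: "finite E" "\<And>r. r \<in> E \<Longrightarrow> 0 < r"
    and Fm: "(\<lambda>(x, s). F x s) \<in> borel_measurable (borel \<Otimes>\<^sub>M borel)"
    and F0: "\<And>x. F x 0 = 0" and G: "growth_mod E F" and I: "finite I"
    and \<omega>: "\<And>l r. l \<in> I \<Longrightarrow> r \<in> E \<Longrightarrow> Lpb r (\<omega> l)" and \<omega>m: "\<And>l. l \<in> I \<Longrightarrow> \<omega> l \<in> borel_measurable borel"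
    and sep: "\<And>l k. l \<in> I \<Longrightarrow> k \<in> I \<Longrightarrow> l \<noteq> k \<Longrightarrow> filterlim (\<lambda>n. norm (y l n - y k n)) at_top sequentially"
  shows "(\<lambda>n. (\<integral>x. F x (\<Sum>l\<in>I. \<omega> l (x - y l n)) \<partial>lborel) - (\<Sum>l\<in>I. \<integral>x. F x (\<omega> l (x - y l n)) \<partial>lborel)) \<longlonglongrightarrow> 0"
proof -
  define m where "m = real (card I)"
  define P where "P r f = (\<integral>x. \<bar>f x\<bar> powr r \<partial>lborel)" for r and f :: "'a \<Rightarrow> real"
  have P0: "0 \<le> P r f" for r f by (simp add: P_def)
  define cut where "cut k l x = indicator (ball 0 (real k)) x * \<omega> l x" for k l x
  define tail where "tail k r l = P r (\<lambda>x. \<omega> l x - cut k l x)" for k r l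
  have cut_m: "cut k l \<in> borel_measurable borel" if "l \<in> I" for k l
    unfolding cut_def using \<omega>m[OF that] by (intro borel_measurable_times borel_measurable_indicator) auto
  have cut_L: "Lpb r (cut k l)" and cut_P: "P r (cut k l) \<le> P r (\<omega> l)" if "l \<in> I" "r \<in> E" for k l r
  proof -
    have "\<bar>cut k l x\<bar> \<le> \<bar>\<omega> l x\<bar>" for x by (auto simp: cut_def indicator_def)
    from Lpb_bound[OF \<omega>[OF that] cut_m[OF that(1)] this less_imp_le[OF E(2)[OF that(2)]]]
    show "Lpb r (cut k l)" "P r (cut k l) \<le> P r (\<omega> l)" unfolding P_def .
  qed
  define s where "s n x = (\<Sum>l\<in>I. \<omega> l (x - y l n))" for n x
  define sk where "sk k n x = (\<Sum>l\<in>I. cut k l (x - y l n))" for k n x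
  have sm: "s n \<in> borel_measurable borel" "sk k n \<in> borel_measurable borel" for n k
    unfolding s_def sk_def by (intro borel_measurable_sum borel_measurable_shift \<omega>m cut_m; simp)+
  have sL: "Lpb r (s n)" "Lpb r (sk k n)" if "r \<in> E" for r n k
    unfolding s_def sk_def using \<omega> cut_L that E(2)[OF that] by (auto intro!: Lpb_sum I Lpb_shift)
  have sP: "P r (s n) \<le> m powr r * (\<Sum>l\<in>I. P r (\<omega> l))" "P r (sk k n) \<le> m powr r * (\<Sum>l\<in>I. P r (\<omega> l))"
    "P r (\<lambda>x. s n x - sk k n x) \<le> m powr r * (\<Sum>l\<in>I. tail k r l)" if r: "r \<in> E" for r n k
  proof -
    have r0: "0 \<le> r" using E(2)[OF r] by simp
    have "P r (s n) \<le> m powr r * (\<Sum>l\<in>I. P r (\<lambda>x. \<omega> l (x - y l n)))"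
      unfolding s_def[abs_def] m_def P_def by (rule Lpb_sum(2)[OF I Lpb_shift[OF \<omega>[OF _ r]] r0])
    then show "P r (s n) \<le> m powr r * (\<Sum>l\<in>I. P r (\<omega> l))"
      by (simp add: P_def integral_shift \<omega>m cong: sum.cong)
    have "P r (sk k n) \<le> m powr r * (\<Sum>l\<in>I. P r (\<lambda>x. cut k l (x - y l n)))"
      unfolding sk_def[abs_def] m_def P_def by (rule Lpb_sum(2)[OF I Lpb_shift[OF cut_L[OF _ r]] r0])
    also have "\<dots> = m powr r * (\<Sum>l\<in>I. P r (cut k l))"
      by (simp add: P_def integral_shift cut_m cong: sum.cong)
    also have "\<dots> \<le> m powr r * (\<Sum>l\<in>I. P r (\<omega> l))"
      using cut_P[OF _ r] by (intro mult_left_mono sum_mono) auto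
    finally show "P r (sk k n) \<le> m powr r * (\<Sum>l\<in>I. P r (\<omega> l))" .
    have L: "Lpb r (\<lambda>x. \<omega> l x - cut k l x)" if "l \<in> I" for l
      by (rule Lpb_add_abs(3)[OF \<omega>[OF that r] cut_L[OF that r] r0])
    have "P r (\<lambda>x. s n x - sk k n x) = P r (\<lambda>x. \<Sum>l\<in>I. \<omega> l (x - y l n) - cut k l (x - y l n))"
      by (simp add: s_def sk_def sum_subtractf)
    also have "\<dots> \<le> m powr r * (\<Sum>l\<in>I. P r (\<lambda>x. \<omega> l (x - y l n) - cut k l (x - y l n)))"
      unfolding m_def P_def by (rule Lpb_sum(2)[OF I Lpb_shift[OF L] r0])
    also have "(\<Sum>l\<in>I. P r (\<lambda>x. \<omega> l (x - y l n) - cut k l (x - y l n))) = (\<Sum>l\<in>I. tail k r l)"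
      unfolding tail_def P_def
      by (intro sum.cong refl integral_shift[of "\<lambda>x. \<omega> _ x - cut k _ x"] borel_measurable_diff \<omega>m cut_m)
    finally show "P r (\<lambda>x. s n x - sk k n x) \<le> m powr r * (\<Sum>l\<in>I. tail k r l)" .
  qed
  have tail0: "(\<lambda>k. tail k r l) \<longlonglongrightarrow> 0" if "r \<in> E" "l \<in> I" for r l
    unfolding tail_def P_def cut_def by (rule tail_tendsto_0[OF \<omega>[OF that(2,1)] E(2)[OF that(1)]])
  \<comment> \<open>The total coefficient of \<delta>: the factor 2^r splits the power of
    \<open>\<bar>a\<bar> + \<bar>b\<bar>\<close>, the part 2 m^r comes from the two sums of profiles
    in \<open>d1\<close>, the part 2 from the single profiles in \<open>d2\<close>.\<close>
  define A where "A = (\<Sum>r\<in>E. 2 powr r * (2 * m powr r + 2) * (\<Sum>l\<in>I. P r (\<omega> l)))"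
  have A0: "0 \<le> A" unfolding A_def by (intro sum_nonneg mult_nonneg_nonneg P0) auto
  show ?thesis
  proof (rule LIMSEQ_I)
    fix \<eta> :: real assume \<eta>: "0 < \<eta>"
    \<comment> \<open>The order of choices is \<delta> from A, C from \<delta>, the cut-off radius k
      from C, and the threshold for n from k; A involves full profiles only, so it does not depend
      on k.\<close>
    define \<delta> where "\<delta> = \<eta> / (4 * (A + 1))"
    have \<delta>: "\<delta> > 0" "\<delta> * A \<le> \<eta> / 4" using \<eta> A0 by (auto simp: \<delta>_def field_simps)
    obtain C where C: "C \<ge> 0" "\<And>x a b. \<bar>F x a - F x b\<bar> \<le> (\<Sum>r\<in>E. \<delta> * (\<bar>a\<bar> + \<bar>b\<bar>) powr r + C * \<bar>a - b\<bar> powr r)"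
      using G \<delta>(1) unfolding growth_mod_def by metis
    have "(\<lambda>k. \<Sum>r\<in>E. C * (m powr r + 1) * (\<Sum>l\<in>I. tail k r l)) \<longlonglongrightarrow> (\<Sum>r\<in>E. C * (m powr r + 1) * (\<Sum>l\<in>I. 0))"
      by (intro tendsto_intros tail0)
    then have "\<forall>\<^sub>F k in sequentially. (\<Sum>r\<in>E. C * (m powr r + 1) * (\<Sum>l\<in>I. tail k r l)) < \<eta> / 4"
      using \<eta> by (intro order_tendstoD(2)) auto
    then obtain k where k: "(\<Sum>r\<in>E. C * (m powr r + 1) * (\<Sum>l\<in>I. tail k r l)) < \<eta> / 4"
      by (auto simp: eventually_sequentially)
    have intF: "integrable lborel (\<lambda>x. F x (a x))" if "\<And>r. r \<in> E \<Longrightarrow> Lpb r a" "a \<in> borel_measurable borel" for a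
      by (rule Nemytskii_integrable[OF E(1) Fm F0 G that])
    have d: "\<bar>(\<integral>x. F x (a x) \<partial>lborel) - (\<integral>x. F x (b x) \<partial>lborel)\<bar>
       \<le> (\<Sum>r\<in>E. \<delta> * (2 powr r * (P r a + P r b)) + C * P r (\<lambda>x. a x - b x))"
      if ab: "\<And>r. r \<in> E \<Longrightarrow> Lpb r a" "\<And>r. r \<in> E \<Longrightarrow> Lpb r b" "a \<in> borel_measurable borel" "b \<in> borel_measurable borel" for a b
    proof -
      have "\<bar>(\<integral>x. F x (a x) \<partial>lborel) - (\<integral>x. F x (b x) \<partial>lborel)\<bar>
         \<le> (\<Sum>r\<in>E. \<delta> * (\<integral>x. (\<bar>a x\<bar> + \<bar>b x\<bar>) powr r \<partial>lborel) + C * (\<integral>x. \<bar>a x - b x\<bar> powr r \<partial>lborel))"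
        using ab C(2) less_imp_le[OF E(2)] by (intro integral_diff_bound E(1) intF) auto
      also have "\<dots> \<le> (\<Sum>r\<in>E. \<delta> * (2 powr r * (P r a + P r b)) + C * P r (\<lambda>x. a x - b x))"
        unfolding P_def using \<delta>(1) C(1) Lpb_add_abs(2)[OF ab(1,2)] less_imp_le[OF E(2)]
        by (intro sum_mono add_mono mult_left_mono) auto
      finally show ?thesis .
    qed
    have d1: "\<bar>(\<integral>x. F x (s n x) \<partial>lborel) - (\<integral>x. F x (sk k n x) \<partial>lborel)\<bar>
      \<le> (\<Sum>r\<in>E. \<delta> * (2 powr r * (2 * m powr r * (\<Sum>l\<in>I. P r (\<omega> l)))) + C * (m powr r * (\<Sum>l\<in>I. tail k r l)))" for n
    proof (rule order_trans[OF d[OF sL(1) sL(2) sm]])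
      show "(\<Sum>r\<in>E. \<delta> * (2 powr r * (P r (s n) + P r (sk k n))) + C * P r (\<lambda>x. s n x - sk k n x))
        \<le> (\<Sum>r\<in>E. \<delta> * (2 powr r * (2 * m powr r * (\<Sum>l\<in>I. P r (\<omega> l)))) + C * (m powr r * (\<Sum>l\<in>I. tail k r l)))"
      proof (intro sum_mono add_mono mult_left_mono)
        fix r assume r: "r \<in> E"
        show "P r (s n) + P r (sk k n) \<le> 2 * m powr r * (\<Sum>l\<in>I. P r (\<omega> l))"
          using sP(1)[OF r, of n] sP(2)[OF r, of k n] by simp
        show "P r (\<lambda>x. s n x - sk k n x) \<le> m powr r * (\<Sum>l\<in>I. tail k r l)" by (rule sP(3)[OF r])
      qed (use \<delta> C in auto)
    qed
    have d2: "\<bar>(\<integral>x. F x (\<omega> l (x - y l n)) \<partial>lborel) - (\<integral>x. F x (cut k l (x - y l n)) \<partial>lborel)\<bar>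
      \<le> (\<Sum>r\<in>E. \<delta> * (2 powr r * (2 * P r (\<omega> l))) + C * tail k r l)" if l: "l \<in> I" for l n
    proof -
      have "\<bar>(\<integral>x. F x (\<omega> l (x - y l n)) \<partial>lborel) - (\<integral>x. F x (cut k l (x - y l n)) \<partial>lborel)\<bar>
        \<le> (\<Sum>r\<in>E. \<delta> * (2 powr r * (P r (\<lambda>x. \<omega> l (x - y l n)) + P r (\<lambda>x. cut k l (x - y l n))))
             + C * P r (\<lambda>x. \<omega> l (x - y l n) - cut k l (x - y l n)))"
        by (rule d) (use \<omega> cut_L l \<omega>m[OF l] cut_m[OF l] in \<open>auto intro: Lpb_shift borel_measurable_shift\<close>)
      also have "\<dots> = (\<Sum>r\<in>E. \<delta> * (2 powr r * (P r (\<omega> l) + P r (cut k l))) + C * tail k r l)"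
        unfolding tail_def P_def using integral_shift[of "\<lambda>x. \<omega> l x - cut k l x" "y l n"] \<omega>m[OF l] cut_m[OF l]
        by (simp add: integral_shift)
      also have "\<dots> \<le> (\<Sum>r\<in>E. \<delta> * (2 powr r * (2 * P r (\<omega> l))) + C * tail k r l)"
        using cut_P[OF l] \<delta> C(1) by (intro sum_mono add_mono mult_left_mono) auto
      finally show ?thesis .
    qed
    obtain n0 where n0: "\<And>n. n \<ge> n0 \<Longrightarrow> \<forall>l\<in>I. \<forall>j\<in>I. l \<noteq> j \<longrightarrow> 2 * real k \<le> norm (y l n - y j n)"
      using eventually_separated[where y=y, OF I sep, where B="2 * real k"] by (auto simp: eventually_sequentially)
    show "\<exists>n0. \<forall>n\<ge>n0. norm ((\<integral>x. F x (\<Sum>l\<in>I. \<omega> l (x - y l n)) \<partial>lborel) - (\<Sum>l\<in>I. \<integral>x. F x (\<omega> l (x - y l n)) \<partial>lborel) - 0) < \<eta>"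
    proof (intro exI[of _ n0] allI impI)
      fix n assume n: "n \<ge> n0"
      \<comment> \<open>At most one cut-off translate is nonzero at x, and F vanishes at 0, so F of
        the sum is the sum of the values.\<close>
      have pt: "F x (sk k n x) = (\<Sum>l\<in>I. F x (cut k l (x - y l n)))" for x
      proof (cases "\<exists>l\<in>I. x - y l n \<in> ball 0 (real k)")
        case True
        then obtain l where l: "l \<in> I" "x - y l n \<in> ball 0 (real k)" by blast
        have z: "cut k j (x - y j n) = 0" if "j \<in> I - {l}" for j
        proof -
          have "x - y j n \<notin> ball 0 (real k)"
            using separated_unique[of I "real k" "\<lambda>l. y l n" l j x] n0[OF n] l that by auto
          then show ?thesis by (simp add: cut_def)
        qed
        show ?thesis using z F0 unfolding sk_def by (simp add: sum.remove[OF I l(1)])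
      next
        case False
        then have "cut k l (x - y l n) = 0" if "l \<in> I" for l using that by (simp add: cut_def)
        then show ?thesis using F0 by (simp add: sk_def)
      qed
      have skF: "(\<integral>x. F x (sk k n x) \<partial>lborel) = (\<Sum>l\<in>I. \<integral>x. F x (cut k l (x - y l n)) \<partial>lborel)"
        unfolding pt using cut_L cut_m
        by (intro Bochner_Integration.integral_sum intF) (auto intro: Lpb_shift borel_measurable_shift)
      have "\<bar>(\<integral>x. F x (s n x) \<partial>lborel) - (\<Sum>l\<in>I. \<integral>x. F x (\<omega> l (x - y l n)) \<partial>lborel)\<bar>
        \<le> \<bar>(\<integral>x. F x (s n x) \<partial>lborel) - (\<integral>x. F x (sk k n x) \<partial>lborel)\<bar>
          + \<bar>\<Sum>l\<in>I. (\<integral>x. F x (cut k l (x - y l n)) \<partial>lborel) - (\<integral>x. F x (\<omega> l (x - y l n)) \<partial>lborel)\<bar>"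
        unfolding skF sum_subtractf by linarith
      also have "\<dots> \<le> \<bar>(\<integral>x. F x (s n x) \<partial>lborel) - (\<integral>x. F x (sk k n x) \<partial>lborel)\<bar>
          + (\<Sum>l\<in>I. \<bar>(\<integral>x. F x (\<omega> l (x - y l n)) \<partial>lborel) - (\<integral>x. F x (cut k l (x - y l n)) \<partial>lborel)\<bar>)"
        using sum_abs[of "\<lambda>l. (\<integral>x. F x (cut k l (x - y l n)) \<partial>lborel) - (\<integral>x. F x (\<omega> l (x - y l n)) \<partial>lborel)" I]
        by (simp add: abs_minus_commute)
      also have "\<dots> \<le> (\<Sum>r\<in>E. \<delta> * (2 powr r * (2 * m powr r * (\<Sum>l\<in>I. P r (\<omega> l)))) + C * (m powr r * (\<Sum>l\<in>I. tail k r l)))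
          + (\<Sum>l\<in>I. \<Sum>r\<in>E. \<delta> * (2 powr r * (2 * P r (\<omega> l))) + C * tail k r l)"
        by (intro add_mono d1 sum_mono d2)
      also have "\<dots> = \<delta> * A + (\<Sum>r\<in>E. C * (m powr r + 1) * (\<Sum>l\<in>I. tail k r l))"
        unfolding A_def by (subst sum.swap[of _ E I]) (simp add: sum.distrib sum_distrib_left algebra_simps)
      also have "\<dots> < \<eta>" using \<delta>(2) k \<eta> by linarith
      finally show "norm ((\<integral>x. F x (\<Sum>l\<in>I. \<omega> l (x - y l n)) \<partial>lborel) - (\<Sum>l\<in>I. \<integral>x. F x (\<omega> l (x - y l n)) \<partial>lborel) - 0) < \<eta>"
        by (simp add: s_def)
    qed
  qed
qed

section \<open>The limit along a profile decomposition\<close>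

text \<open>Makes \<open>Nemytskii_splitting\<close> applicable to the r-th power itself: the r-th
  power integral of a sum of translates is asymptotically the sum of the integrals, with constant 1
  and for any number of profiles.\<close>

lemma growth_mod_powr:
  assumes r: "1 < r"
  shows "growth_mod {r} (\<lambda>x s. \<bar>s\<bar> powr r)"
  unfolding growth_mod_def
proof (intro allI impI)
  fix \<delta> :: real assume \<delta>: "0 < \<delta>"
  define d where "d = \<delta> / r"
  have d: "0 < d" using \<delta> r by (simp add: d_def)
  have "\<bar>\<bar>a\<bar> powr r - \<bar>b\<bar> powr r\<bar> \<le> \<delta> * (\<bar>a\<bar> + \<bar>b\<bar>) powr r + r * d powr (1 - r) * \<bar>a - b\<bar> powr r" for a b :: real
  proof -
    have "\<bar>\<bar>a\<bar> powr r - \<bar>b\<bar> powr r\<bar> \<le> \<bar>\<bar>a\<bar> - \<bar>b\<bar>\<bar> * (r * max \<bar>a\<bar> \<bar>b\<bar> powr (r - 1))"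
      by (rule powr_diff_bound) (use r in auto)
    also have "\<dots> \<le> \<bar>a - b\<bar> * (r * (\<bar>a\<bar> + \<bar>b\<bar>) powr (r - 1))"
      using r by (intro mult_mono mult_left_mono powr_mono2) auto
    also have "\<dots> = r * (\<bar>a - b\<bar> * (\<bar>a\<bar> + \<bar>b\<bar>) powr (r - 1))" by simp
    also have "\<dots> \<le> r * (d * (\<bar>a\<bar> + \<bar>b\<bar>) powr r + d powr (1 - r) * \<bar>a - b\<bar> powr r)"
      using r d by (intro mult_left_mono young_powr) auto
    finally show ?thesis using r by (simp add: d_def algebra_simps)
  qed
  then show "\<exists>C\<ge>0. \<forall>x a b. \<bar>\<bar>a\<bar> powr r - \<bar>b\<bar> powr r\<bar> \<le> (\<Sum>r\<in>{r}. \<delta> * (\<bar>a\<bar> + \<bar>b\<bar>) powr r + C * \<bar>a - b\<bar> powr r)"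
    using r by (intro exI[of _ "r * d powr (1 - r)"]) auto
qed

text \<open>Duality: testing the weak convergence with truncations of \<open>\<bar>\<omega> l\<bar> powr (r - 1)\<close> on balls whose
translates are eventually disjoint, and Young's inequality.\<close>

lemma profile_energy_bound:
  fixes \<omega> :: "'i \<Rightarrow> 'a::euclidean_space \<Rightarrow> real" and v :: "nat \<Rightarrow> 'a \<Rightarrow> real"
  assumes r: "1 < r" and I: "finite I"
    and v: "\<And>n. Lpb r (v n)" and M: "\<And>n. (\<integral>x. \<bar>v n x\<bar> powr r \<partial>lborel) \<le> M"
    and \<omega>: "\<And>l. l \<in> I \<Longrightarrow> \<omega> l \<in> borel_measurable borel"
    and \<omega>i: "\<And>l k. l \<in> I \<Longrightarrow> integrable lborel (\<lambda>x. indicator (ball 0 (real k)) x * \<omega> l x)"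
    and sep: "\<And>l k. l \<in> I \<Longrightarrow> k \<in> I \<Longrightarrow> l \<noteq> k \<Longrightarrow> filterlim (\<lambda>n. norm (y l n - y k n)) at_top sequentially"
    and weak: "\<And>l g B k. l \<in> I \<Longrightarrow> g \<in> borel_measurable borel \<Longrightarrow> (\<And>x. \<bar>g x\<bar> \<le> B) \<Longrightarrow> (\<And>x. x \<notin> ball 0 (real k) \<Longrightarrow> g x = 0) \<Longrightarrow>
       (\<lambda>n. \<integral>x. v n (x + y l n) * g x \<partial>lborel) \<longlonglongrightarrow> (\<integral>x. \<omega> l x * g x \<partial>lborel)"
  shows "\<And>l. l \<in> I \<Longrightarrow> Lpb r (\<omega> l)" and "(\<Sum>l\<in>I. \<integral>x. \<bar>\<omega> l x\<bar> powr r \<partial>lborel) \<le> M"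
proof -
  \<comment> \<open>Cut off in space and in height, so that its integral is finite before anything
    is known about the r-th power of the profile; the absorption at the end relies on that.\<close>
  define b where "b k l x = indicator (ball 0 (real k)) x * min \<bar>\<omega> l x\<bar> (real k) powr r" for k l x
  have [measurable]: "ball 0 s \<in> sets (borel :: 'a measure)" for s by simp
  have bm[measurable]: "b k l \<in> borel_measurable borel" if "l \<in> I" for k l
    unfolding b_def using \<omega>[OF that] by measurable
  have b_int: "integrable lborel (b k l)" if "l \<in> I" for k l
  proof (rule Bochner_Integration.integrable_bound)
    show "integrable lborel (\<lambda>x::'a. real k powr r * indicator (ball 0 (real k)) x)"
      by (intro integrable_mult_right) (use emeasure_bounded_finite[OF bounded_ball[of "0::'a" "real k"]] in \<open>simp add: integrable_indicator_iff\<close>)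
    show "AE x in lborel. norm (b k l x) \<le> norm (real k powr r * indicator (ball 0 (real k)) x)"
      using r by (intro AE_I2) (auto simp: b_def indicator_def intro!: powr_mono2)
  qed (use bm[OF that] in auto)
  have b_sum: "(\<Sum>l\<in>I. \<integral>x. b k l x \<partial>lborel) \<le> M" for k
  proof -
    \<comment> \<open>The dual function of the truncated profile: it has the sign of the profile,
      and its power with the conjugate exponent r/(r-1) is \<open>b\<close>.\<close>
    define g where "g l x = indicator (ball 0 (real k)) x * (sgn (\<omega> l x) * min \<bar>\<omega> l x\<bar> (real k) powr (r - 1))" for l x
    have gm: "g l \<in> borel_measurable borel" if "l \<in> I" for l
      unfolding g_def using \<omega>[OF that] by measurable
    have gB: "\<bar>g l x\<bar> \<le> real k powr (r - 1)" for l x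
      using r by (auto simp: g_def indicator_def abs_mult sgn_if intro!: powr_mono2)
    have g0: "g l x = 0" if "x \<notin> ball 0 (real k)" for l x using that by (simp add: g_def)
    have gmin: "min \<bar>\<omega> l x\<bar> (real k) * \<bar>g l x\<bar> = b k l x" for l x
    proof (cases "\<omega> l x = 0 \<or> k = 0")
      case False
      then have "min \<bar>\<omega> l x\<bar> (real k) > 0" by simp
      then have "min \<bar>\<omega> l x\<bar> (real k) * min \<bar>\<omega> l x\<bar> (real k) powr (r - 1) = min \<bar>\<omega> l x\<bar> (real k) powr r"
        by (simp add: powr_diff)
      then show ?thesis using False by (auto simp: g_def b_def indicator_def abs_mult abs_sgn_eq)
    qed (auto simp: g_def b_def indicator_def)
    have \<omega>g: "\<omega> l x * g l x = \<bar>\<omega> l x\<bar> * \<bar>g l x\<bar>" for l x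
      by (auto simp: g_def indicator_def abs_mult abs_sgn_eq sgn_if)
    have \<omega>g_int: "integrable lborel (\<lambda>x. \<omega> l x * g l x)" if l: "l \<in> I" for l
    proof (rule Bochner_Integration.integrable_bound)
      show "integrable lborel (\<lambda>x. real k powr (r - 1) * (indicator (ball 0 (real k)) x * \<omega> l x))"
        by (intro integrable_mult_right \<omega>i l)
      show "AE x in lborel. norm (\<omega> l x * g l x) \<le> norm (real k powr (r - 1) * (indicator (ball 0 (real k)) x * \<omega> l x))"
      proof (rule AE_I2)
        fix x :: 'a
        show "norm (\<omega> l x * g l x) \<le> norm (real k powr (r - 1) * (indicator (ball 0 (real k)) x * \<omega> l x))"
          using gB[of l x] g0[of x l] by (cases "x \<in> ball 0 (real k)") (auto simp: abs_mult mult.commute[of "\<bar>\<omega> l x\<bar>"] mult_right_mono)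
      qed
    qed (use gm[OF l] \<omega>[OF l] in simp)
    have b_le: "(\<Sum>l\<in>I. \<integral>x. b k l x \<partial>lborel) \<le> (\<Sum>l\<in>I. \<integral>x. \<omega> l x * g l x \<partial>lborel)"
    proof (intro sum_mono integral_mono b_int \<omega>g_int)
      fix l x
      show "b k l x \<le> \<omega> l x * g l x" unfolding gmin[symmetric] \<omega>g by (intro mult_right_mono) auto
    qed
    have lim: "(\<lambda>n. \<Sum>l\<in>I. \<integral>x. v n (x + y l n) * g l x \<partial>lborel) \<longlonglongrightarrow> (\<Sum>l\<in>I. \<integral>x. \<omega> l x * g l x \<partial>lborel)"
      by (rule tendsto_sum) (rule weak[OF _ gm gB g0])
    have "\<forall>\<^sub>F n in sequentially. (\<Sum>l\<in>I. \<integral>x. v n (x + y l n) * g l x \<partial>lborel) \<le> M / r + (1 - 1 / r) * (\<Sum>l\<in>I. \<integral>x. b k l x \<partial>lborel)"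
    proof -
      have "\<forall>\<^sub>F n in sequentially. \<forall>l\<in>I. \<forall>j\<in>I. l \<noteq> j \<longrightarrow> 2 * real k \<le> norm (y l n - y j n)"
        by (rule eventually_separated[OF I sep])
      then show ?thesis
    proof eventually_elim
      case (elim n)
      let ?i = "\<lambda>x. indicator (ball 0 (real k)) x :: real"
      define V where "V l x = ?i x * \<bar>v n (x + y l n)\<bar> powr r" for l x
      have vm[measurable]: "v n \<in> borel_measurable borel" using v by (rule Lpb_measurable)
      have vi: "integrable lborel (\<lambda>x. \<bar>v n x\<bar> powr r)" using v by (rule Lpb_integrable)
      have si: "integrable lborel (\<lambda>x. ?i (x - y l n) * \<bar>v n x\<bar> powr r)" for l
        using vi by (rule Bochner_Integration.integrable_bound) (auto simp: indicator_def)
      have Vi: "integrable lborel (V l)" for l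
        using lborel_shift(2)[of "\<lambda>x. ?i (x - y l n) * \<bar>v n x\<bar> powr r" "y l n"] si by (simp add: V_def[abs_def])
      have Vs: "(\<integral>x. V l x \<partial>lborel) = (\<integral>x. ?i (x - y l n) * \<bar>v n x\<bar> powr r \<partial>lborel)" for l
        using lborel_shift(1)[of "\<lambda>x. ?i (x - y l n) * \<bar>v n x\<bar> powr r" "y l n"] by (simp add: V_def)
      have young: "t * u powr (r - 1) \<le> t powr r / r + (1 - 1 / r) * u powr r" if "0 \<le> t" for t u :: real
      proof -
        have c: "(r - 1) * (r / (r - 1)) = r" using r by simp
        have "t * u powr (r - 1) \<le> t powr r / r + (u powr (r - 1)) powr (r / (r - 1)) / (r / (r - 1))"
          using r that by (intro Youngs_inequality) (auto simp: field_simps)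
        also have "(u powr (r - 1)) powr (r / (r - 1)) = u powr r" unfolding powr_powr c ..
        also have "u powr r / (r / (r - 1)) = (1 - 1 / r) * u powr r" using r by (simp add: field_simps)
        finally show ?thesis .
      qed
      have pt: "\<bar>v n (x + y l n) * g l x\<bar> \<le> V l x / r + (1 - 1 / r) * b k l x" for l x
      proof (cases "x \<in> ball 0 (real k)")
        case True
        have "\<bar>v n (x + y l n) * g l x\<bar> \<le> \<bar>v n (x + y l n)\<bar> * min \<bar>\<omega> l x\<bar> (real k) powr (r - 1)"
          using True by (auto simp: g_def abs_mult abs_sgn_eq sgn_if)
        also have "\<dots> \<le> \<bar>v n (x + y l n)\<bar> powr r / r + (1 - 1 / r) * min \<bar>\<omega> l x\<bar> (real k) powr r"
          by (rule young) simp
        finally show ?thesis using True by (simp add: V_def b_def)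
      qed (simp add: g_def V_def b_def)
      have vg: "integrable lborel (\<lambda>x. v n (x + y l n) * g l x)" if l: "l \<in> I" for l
      proof (rule Bochner_Integration.integrable_bound)
        show "integrable lborel (\<lambda>x. V l x / r + (1 - 1 / r) * b k l x)" using Vi b_int[OF l] by auto
        show "(\<lambda>x. v n (x + y l n) * g l x) \<in> borel_measurable lborel" using gm[OF l] by simp
        show "AE x in lborel. norm (v n (x + y l n) * g l x) \<le> norm (V l x / r + (1 - 1 / r) * b k l x)"
          using pt by (intro AE_I2) (simp add: order_trans[OF _ abs_ge_self])
      qed
      have "(\<Sum>l\<in>I. \<integral>x. v n (x + y l n) * g l x \<partial>lborel) \<le> (\<Sum>l\<in>I. \<integral>x. V l x / r + (1 - 1 / r) * b k l x \<partial>lborel)"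
        using order_trans[OF abs_ge_self pt] vg Vi b_int by (intro sum_mono integral_mono) auto
      also have "\<dots> = (\<Sum>l\<in>I. (\<integral>x. V l x \<partial>lborel) / r + (1 - 1 / r) * (\<integral>x. b k l x \<partial>lborel))"
        using Vi b_int by (intro sum.cong refl) simp
      also have "\<dots> = (\<Sum>l\<in>I. \<integral>x. V l x \<partial>lborel) / r + (1 - 1 / r) * (\<Sum>l\<in>I. \<integral>x. b k l x \<partial>lborel)"
        by (simp add: sum.distrib sum_distrib_left sum_divide_distrib)
      also have "(\<Sum>l\<in>I. \<integral>x. V l x \<partial>lborel) = (\<integral>x. (\<Sum>l\<in>I. ?i (x - y l n) * \<bar>v n x\<bar> powr r) \<partial>lborel)"
        unfolding Vs using si by simp
      also have "\<dots> \<le> (\<integral>x. \<bar>v n x\<bar> powr r \<partial>lborel)"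
      proof (intro integral_mono)
        fix x
        \<comment> \<open>The balls of radius k around the \<open>y l n\<close> are disjoint by now,
          so the pieces of the integral of v add up to at most the whole.\<close>
        have "(\<Sum>l\<in>I. ?i (x - y l n)) \<le> 1"
        proof (cases "\<exists>l\<in>I. x - y l n \<in> ball 0 (real k)")
          case True
          then obtain l where l: "l \<in> I" "x - y l n \<in> ball 0 (real k)" by blast
          have "?i (x - y j n) = 0" if "j \<in> I - {l}" for j
            using separated_unique[of I "real k" "\<lambda>l. y l n" l j x] elim l that by (auto simp: indicator_def)
          then show ?thesis by (simp add: sum.remove[OF I l(1)] indicator_def)
        next
          case False
          then show ?thesis by (simp add: indicator_def)
        qed
        then show "(\<Sum>l\<in>I. ?i (x - y l n) * \<bar>v n x\<bar> powr r) \<le> \<bar>v n x\<bar> powr r"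
          unfolding sum_distrib_right[symmetric] by (intro mult_left_le_one_le) (auto intro!: sum_nonneg)
      qed (use si vi in auto)
      also have "\<dots> \<le> M" by (rule M)
      finally show ?case using r by (simp add: divide_right_mono)
    qed
    qed
    from tendsto_upperbound[OF lim this]
    have "(\<Sum>l\<in>I. \<integral>x. \<omega> l x * g l x \<partial>lborel) \<le> M / r + (1 - 1 / r) * (\<Sum>l\<in>I. \<integral>x. b k l x \<partial>lborel)" by simp
    \<comment> \<open>The part 1 - 1/r of the finite sum is absorbed on the left, which leaves
      exactly the constant M.\<close>
    with b_le have "(\<Sum>l\<in>I. \<integral>x. b k l x \<partial>lborel) / r \<le> M / r" by (simp add: left_diff_distrib)
    then show ?thesis using r by (simp add: divide_le_cancel)
  qed
  have b_nn: "(\<integral>\<^sup>+x. (\<Sum>l\<in>I. ennreal (b k l x)) \<partial>lborel) \<le> ennreal M" for k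
  proof -
    have b0: "0 \<le> b k l x" for l x by (simp add: b_def)
    have "(\<integral>\<^sup>+x. (\<Sum>l\<in>I. ennreal (b k l x)) \<partial>lborel) = (\<Sum>l\<in>I. \<integral>\<^sup>+x. ennreal (b k l x) \<partial>lborel)"
      using bm by (intro nn_integral_sum) auto
    also have "\<dots> = (\<Sum>l\<in>I. ennreal (\<integral>x. b k l x \<partial>lborel))"
      using b_int b0 by (intro sum.cong refl nn_integral_eq_integral) auto
    also have "\<dots> = ennreal (\<Sum>l\<in>I. \<integral>x. b k l x \<partial>lborel)"
      using b0 by (intro sum_ennreal Bochner_Integration.integral_nonneg) auto
    also have "\<dots> \<le> ennreal M" using b_sum by (rule ennreal_leI)
    finally show ?thesis .
  qed
  have lim: "(\<lambda>k. \<Sum>l\<in>I. ennreal (b k l x)) \<longlonglongrightarrow> (\<Sum>l\<in>I. ennreal (\<bar>\<omega> l x\<bar> powr r))" for x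
  proof (intro tendsto_sum)
    fix l
    obtain m1 m2 :: nat where m: "norm x < real m1" "\<bar>\<omega> l x\<bar> < real m2" using reals_Archimedean2 by meson
    show "(\<lambda>k. ennreal (b k l x)) \<longlonglongrightarrow> ennreal (\<bar>\<omega> l x\<bar> powr r)"
      by (rule tendsto_eventually, rule eventually_mono[OF eventually_ge_at_top[of "max m1 m2"]])
        (use m in \<open>auto simp: b_def indicator_def min_def\<close>)
  qed
  have "(\<integral>\<^sup>+x. (\<Sum>l\<in>I. ennreal (\<bar>\<omega> l x\<bar> powr r)) \<partial>lborel) = (\<integral>\<^sup>+x. liminf (\<lambda>k. \<Sum>l\<in>I. ennreal (b k l x)) \<partial>lborel)"
    by (intro nn_integral_cong lim_imp_Liminf[symmetric] lim) simp
  \<comment> \<open>Fatou's lemma in k; the bound M is independent of the truncation.\<close>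
  also have "\<dots> \<le> liminf (\<lambda>k. \<integral>\<^sup>+x. (\<Sum>l\<in>I. ennreal (b k l x)) \<partial>lborel)"
    using bm by (intro nn_integral_liminf) auto
  also have "\<dots> \<le> ennreal M" by (rule Liminf_le) (use b_nn in \<open>auto intro!: always_eventually\<close>)
  finally have nn: "(\<Sum>l\<in>I. \<integral>\<^sup>+x. ennreal (\<bar>\<omega> l x\<bar> powr r) \<partial>lborel) \<le> ennreal M"
    using \<omega> by (subst (asm) nn_integral_sum) auto
  show L: "Lpb r (\<omega> l)" if l: "l \<in> I" for l
  proof -
    have "(\<integral>\<^sup>+x. ennreal (\<bar>\<omega> l x\<bar> powr r) \<partial>lborel) \<le> (\<Sum>l\<in>I. \<integral>\<^sup>+x. ennreal (\<bar>\<omega> l x\<bar> powr r) \<partial>lborel)"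
      using l I by (intro member_le_sum) auto
    also have "\<dots> < top" using nn by (simp add: le_less_trans)
    finally have "integrable lborel (\<lambda>x. \<bar>\<omega> l x\<bar> powr r)" using \<omega>[OF l] by (intro integrableI_nonneg) auto
    then show ?thesis using \<omega>[OF l] by (simp add: Lpb_def)
  qed
  have M0: "0 \<le> M" using order_trans[OF _ M[of 0]] by simp
  have "ennreal (\<Sum>l\<in>I. \<integral>x. \<bar>\<omega> l x\<bar> powr r \<partial>lborel) = (\<Sum>l\<in>I. ennreal (\<integral>x. \<bar>\<omega> l x\<bar> powr r \<partial>lborel))"
    by (intro sum_ennreal[symmetric]) simp
  also have "\<dots> = (\<Sum>l\<in>I. \<integral>\<^sup>+x. ennreal (\<bar>\<omega> l x\<bar> powr r) \<partial>lborel)"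
    using L by (intro sum.cong refl nn_integral_eq_integral[symmetric]) (auto dest: Lpb_integrable)
  also have "\<dots> \<le> ennreal M" by (rule nn)
  finally show "(\<Sum>l\<in>I. \<integral>x. \<bar>\<omega> l x\<bar> powr r \<partial>lborel) \<le> M" using M0 by (simp add: ennreal_le_iff)
qed

text \<open>Two late partial sums are both close to a common \<open>A j\<close>, so they are close
  to each other. The series therefore converges, and A has the same limit. For a finite \<Lambda>
  the estimate is read at its last index only.\<close>

lemma sum_upto_of_cauchy:
  assumes est: "\<And>\<eta>. 0 < \<eta> \<Longrightarrow> \<exists>L0. enat L0 \<le> \<Lambda> \<and> (\<forall>L\<ge>L0. enat L \<le> \<Lambda> \<longrightarrow> (\<forall>\<^sub>F n in sequentially. \<bar>A n - (\<Sum>l\<le>L. a l)\<bar> < \<eta>))"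
  shows "\<exists>S. (A \<longlonglongrightarrow> S) \<and> sum_upto \<Lambda> a S"
proof (cases \<Lambda>)
  case (enat K)
  have "A \<longlonglongrightarrow> (\<Sum>l\<le>K. a l)"
    unfolding tendsto_iff
  proof (intro allI impI)
    fix \<eta> :: real assume "0 < \<eta>"
    then obtain L0 where "enat L0 \<le> \<Lambda>" "\<forall>L\<ge>L0. enat L \<le> \<Lambda> \<longrightarrow> (\<forall>\<^sub>F n in sequentially. \<bar>A n - (\<Sum>l\<le>L. a l)\<bar> < \<eta>)" using est by blast
    then show "\<forall>\<^sub>F n in sequentially. dist (A n) (\<Sum>l\<le>K. a l) < \<eta>" using enat by (auto simp: dist_real_def)
  qed
  then show ?thesis using enat by (auto simp: sum_upto_def)
next
  case infinity
  have est': "\<exists>L0. \<forall>L\<ge>L0. \<forall>\<^sub>F n in sequentially. \<bar>A n - (\<Sum>l\<le>L. a l)\<bar> < \<eta>" if "0 < \<eta>" for \<eta>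
    using est[OF that] infinity by auto
  have "Cauchy (\<lambda>L. \<Sum>l\<le>L. a l)"
    unfolding Cauchy_def
  proof (intro allI impI)
    fix e :: real assume "0 < e"
    then obtain L0 where L0: "\<And>L. L \<ge> L0 \<Longrightarrow> \<forall>\<^sub>F n in sequentially. \<bar>A n - (\<Sum>l\<le>L. a l)\<bar> < e / 2"
      using est'[of "e / 2"] by auto
    show "\<exists>M. \<forall>m\<ge>M. \<forall>n\<ge>M. dist (\<Sum>l\<le>m. a l) (\<Sum>l\<le>n. a l) < e"
    proof (intro exI[of _ L0] allI impI)
      fix m n assume "L0 \<le> m" "L0 \<le> n"
      then have "\<forall>\<^sub>F j in sequentially. \<bar>A j - (\<Sum>l\<le>m. a l)\<bar> < e / 2 \<and> \<bar>A j - (\<Sum>l\<le>n. a l)\<bar> < e / 2"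
        using L0 by (intro eventually_conj) auto
      then obtain j where j: "\<bar>A j - (\<Sum>l\<le>m. a l)\<bar> < e / 2" "\<bar>A j - (\<Sum>l\<le>n. a l)\<bar> < e / 2"
        by (auto simp: eventually_sequentially)
      then show "dist (\<Sum>l\<le>m. a l) (\<Sum>l\<le>n. a l) < e" unfolding dist_real_def by linarith
    qed
  qed
  then obtain S where S: "(\<lambda>L. \<Sum>l\<le>L. a l) \<longlonglongrightarrow> S" using Cauchy_convergent convergent_def by blast
  have "A \<longlonglongrightarrow> S"
    unfolding tendsto_iff
  proof (intro allI impI)
    fix e :: real assume e: "0 < e"
    then obtain L0 where L0: "\<And>L. L \<ge> L0 \<Longrightarrow> \<forall>\<^sub>F n in sequentially. \<bar>A n - (\<Sum>l\<le>L. a l)\<bar> < e / 2"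
      using est'[of "e / 2"] by auto
    have "\<forall>\<^sub>F L in sequentially. dist (\<Sum>l\<le>L. a l) S < e / 2" using S e unfolding tendsto_iff by (auto dest!: spec[of _ "e / 2"])
    then obtain L1 where L1: "\<And>L. L \<ge> L1 \<Longrightarrow> dist (\<Sum>l\<le>L. a l) S < e / 2" by (auto simp: eventually_sequentially)
    show "\<forall>\<^sub>F n in sequentially. dist (A n) S < e"
    proof -
      have "\<forall>\<^sub>F n in sequentially. \<bar>A n - (\<Sum>l\<le>max L0 L1. a l)\<bar> < e / 2" by (rule L0) simp
      then show ?thesis
      proof eventually_elim
        case (elim n)
        have "dist (\<Sum>l\<le>max L0 L1. a l) S < e / 2" by (rule L1) simp
        with elim show ?case unfolding dist_real_def by linarith
      qed
    qed
  qed
  moreover have "a sums S" using S by (simp add: sums_def_le)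
  ultimately show ?thesis using infinity by (auto simp: sum_upto_def)
qed

text \<open>The order of choices is forced by the hypotheses: \<epsilon> against the bounds in L^p
  and L^R, which determines q; \<delta> against the bound in L^q, which determines C; and last L, so
  that the remainder in L^q is small compared with 1/C. This is consistent because the bounds
  \<open>M r\<close> do not depend on L.\<close>

theorem profile_integral_limit:
  fixes \<omega> :: "nat \<Rightarrow> 'a::euclidean_space \<Rightarrow> real" and v :: "nat \<Rightarrow> 'a \<Rightarrow> real" and F :: "'a \<Rightarrow> real \<Rightarrow> real"
  assumes p: "1 < p" and R: "1 < R" and Q: "\<And>q. q \<in> Q \<Longrightarrow> 1 < q"
    and bd: "\<And>r. r \<in> {p, R} \<union> Q \<Longrightarrow> \<exists>M. \<forall>n. Lpb r (v n) \<and> (\<integral>x. \<bar>v n x\<bar> powr r \<partial>lborel) \<le> M"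
    and \<omega>: "\<And>l. enat l \<le> \<Lambda> \<Longrightarrow> \<omega> l \<in> borel_measurable borel"
    and \<omega>i: "\<And>l k. enat l \<le> \<Lambda> \<Longrightarrow> integrable lborel (\<lambda>x. indicator (ball 0 (real k)) x * \<omega> l x)"
    and sep: "\<And>l k. enat l \<le> \<Lambda> \<Longrightarrow> enat k \<le> \<Lambda> \<Longrightarrow> l \<noteq> k \<Longrightarrow> filterlim (\<lambda>n. norm (y l n - y k n)) at_top sequentially"
    and weak: "\<And>l g B k. enat l \<le> \<Lambda> \<Longrightarrow> g \<in> borel_measurable borel \<Longrightarrow> (\<And>x. \<bar>g x\<bar> \<le> B) \<Longrightarrow> (\<And>x. x \<notin> ball 0 (real k) \<Longrightarrow> g x = 0) \<Longrightarrow>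
       (\<lambda>n. \<integral>x. v n (x + y l n) * g x \<partial>lborel) \<longlonglongrightarrow> (\<integral>x. \<omega> l x * g x \<partial>lborel)"
    and rem: "\<And>q e. q \<in> Q \<Longrightarrow> 0 < e \<Longrightarrow> \<exists>L0. enat L0 \<le> \<Lambda> \<and> (\<forall>L\<ge>L0. enat L \<le> \<Lambda> \<longrightarrow>
        (\<forall>\<^sub>F n in sequentially. (\<integral>x. \<bar>v n x - (\<Sum>l\<le>L. \<omega> l (x - y l n))\<bar> powr q \<partial>lborel) < e))"
    and Fm: "(\<lambda>(x, s). F x s) \<in> borel_measurable (borel \<Otimes>\<^sub>M borel)" and F0: "\<And>x. F x 0 = 0"
    and G: "\<And>\<epsilon>. 0 < \<epsilon> \<Longrightarrow> \<exists>q\<in>Q. \<forall>\<delta>>0. \<exists>C\<ge>0. \<forall>x a b. \<bar>F x a - F x b\<bar> \<le>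
        \<epsilon> * ((\<bar>a\<bar> + \<bar>b\<bar>) powr p + (\<bar>a\<bar> + \<bar>b\<bar>) powr R) + \<delta> * (\<bar>a\<bar> + \<bar>b\<bar>) powr q + C * \<bar>a - b\<bar> powr q"
    and G1: "q1 \<in> Q" "growth_mod {p, R, q1} F"
    and lim: "\<And>l. enat l \<le> \<Lambda> \<Longrightarrow> (\<lambda>n. \<integral>x. F x (\<omega> l (x - y l n)) \<partial>lborel) \<longlonglongrightarrow> a l"
  shows "\<exists>S. (\<lambda>n. \<integral>x. F x (v n x) \<partial>lborel) \<longlonglongrightarrow> S \<and> sum_upto \<Lambda> a S"
proof (rule sum_upto_of_cauchy)
  define P where "P r f = (\<integral>x. \<bar>f x\<bar> powr r \<partial>lborel)" for r and f :: "'a \<Rightarrow> real"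
  have P0: "0 \<le> P r f" for r f by (simp add: P_def)
  have r1: "1 < r" if "r \<in> {p, R} \<union> Q" for r using that p R Q by auto
  obtain M where M: "\<And>r n. r \<in> {p, R} \<union> Q \<Longrightarrow> Lpb r (v n)" "\<And>r n. r \<in> {p, R} \<union> Q \<Longrightarrow> P r (v n) \<le> M r"
    using bd unfolding P_def by metis
  have M0: "0 \<le> M r" if "r \<in> {p, R} \<union> Q" for r using order_trans[OF P0 M(2)[OF that, of 0]] .
  have down: "enat l \<le> \<Lambda>" if "enat L \<le> \<Lambda>" "l \<le> L" for l L using that by (meson enat_ord_simps(1) order_trans)
  have energy: "Lpb r (\<omega> l)" "(\<Sum>l\<le>L. P r (\<omega> l)) \<le> M r" if r: "r \<in> {p, R} \<union> Q" and L: "enat L \<le> \<Lambda>" and l: "l \<le> L" for r L l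
  proof -
    note e = profile_energy_bound[of r "{..L}" v "M r" \<omega> y, OF r1[OF r] finite_atMost M(1)[OF r] M(2)[OF r, unfolded P_def]]
    have w: "(\<lambda>n. \<integral>x. v n (x + y l n) * g x \<partial>lborel) \<longlonglongrightarrow> (\<integral>x. \<omega> l x * g x \<partial>lborel)"
      if "l \<in> {..L}" "g \<in> borel_measurable borel" "\<And>x. \<bar>g x\<bar> \<le> B" "\<And>x. x \<notin> ball 0 (real k) \<Longrightarrow> g x = 0" for l g B k
      by (rule weak[OF down[OF L] that(2-4)]) (use that(1) in simp_all)
    show "Lpb r (\<omega> l)"
      by (rule e(1)[OF _ _ _ w]) (use down[OF L] \<omega> \<omega>i sep l in auto)
    show "(\<Sum>l\<le>L. P r (\<omega> l)) \<le> M r"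
      unfolding P_def by (rule e(2)[OF _ _ _ w]) (use down[OF L] \<omega> \<omega>i sep in auto)
  qed
  define s where "s L n x = (\<Sum>l\<le>L. \<omega> l (x - y l n))" for L n x
  have sL: "Lpb r (s L n)" if r: "r \<in> {p, R} \<union> Q" and L: "enat L \<le> \<Lambda>" for r L n
    unfolding s_def using energy(1)[OF r L] r1[OF r] by (intro Lpb_sum Lpb_shift) auto
  \<comment> \<open>The bound is the same for all L; only the threshold for n depends on L.\<close>
  have s_bd: "\<forall>\<^sub>F n in sequentially. P r (s L n) < M r + 1" if r: "r \<in> {p, R} \<union> Q" and L: "enat L \<le> \<Lambda>" for r L
  proof -
    have "(\<lambda>n. (\<integral>x. \<bar>\<Sum>l\<in>{..L}. \<omega> l (x - y l n)\<bar> powr r \<partial>lborel) - (\<Sum>l\<in>{..L}. \<integral>x. \<bar>\<omega> l (x - y l n)\<bar> powr r \<partial>lborel)) \<longlonglongrightarrow> 0"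
    proof (rule Nemytskii_splitting[where F="\<lambda>x s. \<bar>s\<bar> powr r" and E="{r}"])
      show "growth_mod {r} (\<lambda>x s. \<bar>s\<bar> powr r)" by (rule growth_mod_powr[OF r1[OF r]])
      show "(\<lambda>(x::'a, s). \<bar>s\<bar> powr r) \<in> borel_measurable (borel \<Otimes>\<^sub>M borel)" by measurable
    qed (use r1[OF r] energy(1)[OF r L] \<omega> down[OF L] sep in auto)
    moreover have "(\<Sum>l\<in>{..L}. \<integral>x. \<bar>\<omega> l (x - y l n)\<bar> powr r \<partial>lborel) = (\<Sum>l\<le>L. P r (\<omega> l))" for n
      unfolding P_def using \<omega> down[OF L] by (intro sum.cong refl integral_shift) auto
    ultimately have "(\<lambda>n. P r (s L n) - (\<Sum>l\<le>L. P r (\<omega> l))) \<longlonglongrightarrow> 0" by (simp add: P_def s_def)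
    then have "\<forall>\<^sub>F n in sequentially. P r (s L n) - (\<Sum>l\<le>L. P r (\<omega> l)) < 1" by (rule order_tendstoD(2)) simp
    then show ?thesis by eventually_elim (use energy(2)[OF r L, of L] in simp)
  qed
  have intF: "integrable lborel (\<lambda>x. F x (b x))" if "\<And>r. r \<in> {p, R} \<union> Q \<Longrightarrow> Lpb r b" for b
    by (rule Nemytskii_integrable[OF _ Fm F0 G1(2)]) (use that G1(1) in \<open>auto dest: Lpb_measurable\<close>)
  fix \<eta> :: real assume \<eta>: "0 < \<eta>"
  \<comment> \<open>Bounds the r-th power integral of
    \<open>\<bar>v n\<bar> + \<bar>s L n\<bar>\<close>: \<open>M r\<close> for v,
    \<open>M r + 1\<close> for the sum of profiles, and 2^r for the power of a sum.\<close>
  define K where "K r = 2 powr r * (2 * M r + 1)" for r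
  have K0: "0 \<le> K r" if "r \<in> {p, R} \<union> Q" for r using M0[OF that] by (simp add: K_def)
  have Kp: "0 \<le> K p" "0 \<le> K R" using K0 by auto
  \<comment> \<open>Five errors of at most \<eta>/6 are going to be added: three from the growth
    bound, one from the splitting and one from the limits of the single profile integrals.\<close>
  define \<epsilon> where "\<epsilon> = \<eta> / (6 * (K p + K R + 1))"
  have \<epsilon>: "0 < \<epsilon>" "\<epsilon> * (K p + K R) \<le> \<eta> / 6" using \<eta> Kp by (auto simp: \<epsilon>_def field_simps)
  obtain q where q: "q \<in> Q" and Gq: "\<And>\<delta>. 0 < \<delta> \<Longrightarrow> \<exists>C\<ge>0. \<forall>x a b. \<bar>F x a - F x b\<bar> \<le>
        \<epsilon> * ((\<bar>a\<bar> + \<bar>b\<bar>) powr p + (\<bar>a\<bar> + \<bar>b\<bar>) powr R) + \<delta> * (\<bar>a\<bar> + \<bar>b\<bar>) powr q + C * \<bar>a - b\<bar> powr q"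
    using G[OF \<epsilon>(1)] by blast
  have Kq: "0 \<le> K q" using K0 q by auto
  define \<delta> where "\<delta> = \<eta> / (6 * (K q + 1))"
  have \<delta>: "0 < \<delta>" "\<delta> * K q \<le> \<eta> / 6" using \<eta> Kq by (auto simp: \<delta>_def field_simps)
  obtain C where C: "0 \<le> C" "\<And>x a b. \<bar>F x a - F x b\<bar> \<le>
        \<epsilon> * ((\<bar>a\<bar> + \<bar>b\<bar>) powr p + (\<bar>a\<bar> + \<bar>b\<bar>) powr R) + \<delta> * (\<bar>a\<bar> + \<bar>b\<bar>) powr q + C * \<bar>a - b\<bar> powr q"
    using Gq[OF \<delta>(1)] by blast
  define e where "e = \<eta> / (6 * (C + 1))"
  have e: "0 < e" "C * e \<le> \<eta> / 6" using \<eta> C(1) by (auto simp: e_def field_simps)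
  obtain L0 where L0: "enat L0 \<le> \<Lambda>" "\<And>L. L \<ge> L0 \<Longrightarrow> enat L \<le> \<Lambda> \<Longrightarrow> \<forall>\<^sub>F n in sequentially. P q (\<lambda>x. v n x - s L n x) < e"
    using rem[OF q e(1)] unfolding P_def s_def by blast
  show "\<exists>L0. enat L0 \<le> \<Lambda> \<and> (\<forall>L\<ge>L0. enat L \<le> \<Lambda> \<longrightarrow> (\<forall>\<^sub>F n in sequentially. \<bar>(\<integral>x. F x (v n x) \<partial>lborel) - (\<Sum>l\<le>L. a l)\<bar> < \<eta>))"
  proof (intro exI[of _ L0] conjI allI impI L0(1))
    fix L assume L: "L0 \<le> L" "enat L \<le> \<Lambda>"
    have "(\<lambda>n. (\<integral>x. F x (\<Sum>l\<in>{..L}. \<omega> l (x - y l n)) \<partial>lborel) - (\<Sum>l\<in>{..L}. \<integral>x. F x (\<omega> l (x - y l n)) \<partial>lborel)) \<longlonglongrightarrow> 0"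
      by (rule Nemytskii_splitting[OF _ _ Fm F0 G1(2)])
        (use energy(1)[OF _ L(2)] G1(1) p R Q \<omega> down[OF L(2)] sep in \<open>auto intro: less_trans[OF zero_less_one]\<close>)
    then have split: "\<forall>\<^sub>F n in sequentially. \<bar>(\<integral>x. F x (s L n x) \<partial>lborel) - (\<Sum>l\<le>L. \<integral>x. F x (\<omega> l (x - y l n)) \<partial>lborel)\<bar> < \<eta> / 6"
      using \<eta> unfolding tendsto_iff s_def by (auto dest!: spec[of _ "\<eta> / 6"])
    have "(\<lambda>n. \<Sum>l\<le>L. \<integral>x. F x (\<omega> l (x - y l n)) \<partial>lborel) \<longlonglongrightarrow> (\<Sum>l\<le>L. a l)"
      by (intro tendsto_sum lim) (use down[OF L(2)] in auto)
    then have lims: "\<forall>\<^sub>F n in sequentially. \<bar>(\<Sum>l\<le>L. \<integral>x. F x (\<omega> l (x - y l n)) \<partial>lborel) - (\<Sum>l\<le>L. a l)\<bar> < \<eta> / 6"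
      using \<eta> unfolding tendsto_iff by (auto dest!: spec[of _ "\<eta> / 6"] simp: dist_real_def)
    have sb3: "\<forall>\<^sub>F n in sequentially. P p (s L n) < M p + 1" "\<forall>\<^sub>F n in sequentially. P R (s L n) < M R + 1"
      "\<forall>\<^sub>F n in sequentially. P q (s L n) < M q + 1" using s_bd L q by auto
    show "\<forall>\<^sub>F n in sequentially. \<bar>(\<integral>x. F x (v n x) \<partial>lborel) - (\<Sum>l\<le>L. a l)\<bar> < \<eta>"
      using split lims L0(2)[OF L] sb3
    proof eventually_elim
      case (elim n)
      note sb = elim(4,5,6)
      have T: "integrable lborel (\<lambda>x. (\<bar>v n x\<bar> + \<bar>s L n x\<bar>) powr r)" "(\<integral>x. (\<bar>v n x\<bar> + \<bar>s L n x\<bar>) powr r \<partial>lborel) \<le> K r"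
        if r: "r \<in> {p, R} \<union> Q" "P r (s L n) < M r + 1" for r
      proof -
        note A = Lpb_add_abs[OF M(1)[OF r(1), of n] sL[OF r(1) L(2), of n]]
        have r0: "0 \<le> r" using r1[OF r(1)] by simp
        show "integrable lborel (\<lambda>x. (\<bar>v n x\<bar> + \<bar>s L n x\<bar>) powr r)" by (rule A(1)[OF r0])
        have "(\<integral>x. (\<bar>v n x\<bar> + \<bar>s L n x\<bar>) powr r \<partial>lborel) \<le> 2 powr r * (P r (v n) + P r (s L n))"
          unfolding P_def by (rule A(2)[OF r0])
        also have "\<dots> \<le> K r" unfolding K_def using M(2)[OF r(1), of n] r(2) by (intro mult_left_mono) auto
        finally show "(\<integral>x. (\<bar>v n x\<bar> + \<bar>s L n x\<bar>) powr r \<partial>lborel) \<le> K r" .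
      qed
      have qi: "integrable lborel (\<lambda>x. \<bar>v n x - s L n x\<bar> powr q)"
        using Lpb_add_abs(3)[OF M(1)[of q n] sL[of q L n]] L(2) q Q[OF q] by (auto dest: Lpb_integrable)
      have Fi: "integrable lborel (\<lambda>x. F x (v n x))" "integrable lborel (\<lambda>x. F x (s L n x))"
        using intF M(1) sL L(2) by blast+
      let ?T = "\<lambda>x. \<bar>v n x\<bar> + \<bar>s L n x\<bar>"
      have "\<bar>(\<integral>x. F x (v n x) \<partial>lborel) - (\<integral>x. F x (s L n x) \<partial>lborel)\<bar> = \<bar>\<integral>x. F x (v n x) - F x (s L n x) \<partial>lborel\<bar>"
        using Fi by simp
      also have "\<dots> \<le> (\<integral>x. \<epsilon> * (?T x powr p + ?T x powr R) + \<delta> * ?T x powr q + C * \<bar>v n x - s L n x\<bar> powr q \<partial>lborel)"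
        using Fi T(1) sb q qi C(2) by (intro integral_abs_bound_integral) auto
      also have "\<dots> = \<epsilon> * ((\<integral>x. ?T x powr p \<partial>lborel) + (\<integral>x. ?T x powr R \<partial>lborel)) + \<delta> * (\<integral>x. ?T x powr q \<partial>lborel) + C * P q (\<lambda>x. v n x - s L n x)"
        using T(1)[of p] T(1)[of R] T(1)[of q] sb q qi by (simp add: P_def)
      also have "\<dots> \<le> \<epsilon> * (K p + K R) + \<delta> * K q + C * e"
        using T(2)[of p] T(2)[of R] T(2)[of q] sb q elim(3) \<epsilon>(1) \<delta>(1) C(1) by (intro add_mono mult_left_mono) auto
      also have "\<dots> \<le> \<eta> / 2" using \<epsilon>(2) \<delta>(2) e(2) by linarith
      finally show ?case using elim(1,2) \<eta> by linarith
    qed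
  qed
qed

section \<open>Primitives and Sobolev functions\<close>

abbreviation (input) prim :: "(real \<Rightarrow> real) \<Rightarrow> real \<Rightarrow> real" where
  "prim h s \<equiv> (LBINT t=0..ereal s. h t)"

text \<open>The signed indicator of the open interval between 0 and s. It turns the interval
  integral, which is defined by cases on the sign of s, into one integral over the line with a
  jointly measurable kernel, open to Fubini and dominated convergence.\<close>

definition primitive_ker :: "real \<Rightarrow> real \<Rightarrow> real" where
  "primitive_ker s t = indicator {0<..<s} t - indicator {s<..<0} t"

lemma interval_integral_eq_ker:
  fixes h :: "real \<Rightarrow> real"
  shows "prim h s = (\<integral>t. primitive_ker s t * h t \<partial>lborel)"
proof -
  have e: "einterval 0 (ereal s) = {0<..<s}" "einterval (ereal s) 0 = {s<..<0}"
    by (auto simp: einterval_def)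
  show ?thesis
  proof (cases "0 \<le> s")
    case True
    then have "primitive_ker s t = indicator {0<..<s} t" for t by (auto simp: primitive_ker_def indicator_def)
    then show ?thesis using True by (simp add: interval_lebesgue_integral_def set_lebesgue_integral_def e)
  next
    case False
    then have "primitive_ker s t = - indicator {s<..<0} t" for t by (auto simp: primitive_ker_def indicator_def)
    then show ?thesis using False by (simp add: interval_lebesgue_integral_def set_lebesgue_integral_def e)
  qed
qed

lemma measurable_primitive_ker [measurable]:
  "(\<lambda>x. primitive_ker (f x) (g x)) \<in> borel_measurable M"
  if [measurable]: "f \<in> borel_measurable M" "g \<in> borel_measurable M"
proof -
  have "(\<lambda>x. primitive_ker (f x) (g x)) = (\<lambda>x. (if 0 < g x \<and> g x < f x then 1 else 0) - (if f x < g x \<and> g x < 0 then 1 else 0))"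
    by (auto simp: primitive_ker_def indicator_def)
  also have "\<dots> \<in> borel_measurable M" by measurable
  finally show ?thesis .
qed

lemma primitive_ker_integrable:
  fixes h :: "real \<Rightarrow> real"
  assumes [measurable]: "h \<in> borel_measurable borel" and B: "\<And>t. \<bar>t\<bar> \<le> \<bar>s\<bar> \<Longrightarrow> \<bar>h t\<bar> \<le> B"
  shows "integrable lborel (\<lambda>t. primitive_ker s t * h t)"
proof (rule Bochner_Integration.integrable_bound)
  show "integrable lborel (\<lambda>t. B * indicator {-\<bar>s\<bar>..\<bar>s\<bar>} t)"
    by (intro integrable_mult_right) (simp add: integrable_indicator_iff)
  show "AE t in lborel. norm (primitive_ker s t * h t) \<le> norm (B * indicator {-\<bar>s\<bar>..\<bar>s\<bar>} t)"
  proof (rule AE_I2)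
    fix t
    have "0 \<le> B" using B[of 0] by simp
    show "norm (primitive_ker s t * h t) \<le> norm (B * indicator {-\<bar>s\<bar>..\<bar>s\<bar>} t)"
    proof (cases "\<bar>t\<bar> \<le> \<bar>s\<bar>")
      case True
      then have "\<bar>h t\<bar> \<le> B" by (rule B)
      moreover have "\<bar>primitive_ker s t\<bar> \<le> 1" by (auto simp: primitive_ker_def indicator_def)
      ultimately have "\<bar>primitive_ker s t\<bar> * \<bar>h t\<bar> \<le> 1 * B" by (intro mult_mono) auto
      then show ?thesis using True \<open>0 \<le> B\<close> by (auto simp: abs_mult indicator_def abs_le_iff)
    next
      case False
      then have "primitive_ker s t = 0" by (auto simp: primitive_ker_def indicator_def)
      then show ?thesis by simp
    qed
  qed
qed measurable

text \<open>The kernels of a and b agree outside the interval between a and b and differ by at most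
  1 inside, where \<phi> is at most its value at
  \<open>\<bar>a\<bar> + \<bar>b\<bar>\<close>.\<close>

lemma primitive_difference_bound:
  fixes h \<phi> :: "real \<Rightarrow> real"
  assumes m: "h \<in> borel_measurable borel" and h: "\<And>t. \<bar>h t\<bar> \<le> \<phi> \<bar>t\<bar>" and \<phi>: "\<And>s t. 0 \<le> s \<Longrightarrow> s \<le> t \<Longrightarrow> \<phi> s \<le> \<phi> t"
  shows "\<bar>prim h a - prim h b\<bar> \<le> \<bar>a - b\<bar> * \<phi> (\<bar>a\<bar> + \<bar>b\<bar>)"
proof -
  let ?T = "\<bar>a\<bar> + \<bar>b\<bar>"
  have B: "\<bar>h t\<bar> \<le> \<phi> ?T" if "\<bar>t\<bar> \<le> ?T" for t
    using h[of t] \<phi>[of "\<bar>t\<bar>" ?T] that by simp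
  have ia: "integrable lborel (\<lambda>t. primitive_ker a t * h t)" and ib: "integrable lborel (\<lambda>t. primitive_ker b t * h t)"
    by (rule primitive_ker_integrable[OF m, of _ "\<phi> ?T"]; rule B; simp)+
  have "\<bar>prim h a - prim h b\<bar> = \<bar>\<integral>t. primitive_ker a t * h t - primitive_ker b t * h t \<partial>lborel\<bar>"
    unfolding interval_integral_eq_ker using ia ib by simp
  also have "\<dots> \<le> (\<integral>t. \<phi> ?T * indicator {min a b..max a b} t \<partial>lborel)"
  proof (rule integral_abs_bound_integral)
    show "integrable lborel (\<lambda>t. \<phi> ?T * indicator {min a b..max a b} t)"
      by (intro integrable_mult_right) (simp add: integrable_indicator_iff)
    show "integrable lborel (\<lambda>t. primitive_ker a t * h t - primitive_ker b t * h t)" using ia ib by simp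
    fix t
    have \<phi>0: "0 \<le> \<phi> ?T" using B[of 0] by simp
    show "\<bar>primitive_ker a t * h t - primitive_ker b t * h t\<bar> \<le> \<phi> ?T * indicator {min a b..max a b} t"
    proof (cases "t \<in> {min a b..max a b}")
      case True
      then have "\<bar>t\<bar> \<le> ?T" by auto
      then have "\<bar>h t\<bar> \<le> \<phi> ?T" by (rule B)
      moreover have "\<bar>primitive_ker a t - primitive_ker b t\<bar> \<le> 1"
        by (auto simp: primitive_ker_def indicator_def)
      ultimately have "\<bar>primitive_ker a t - primitive_ker b t\<bar> * \<bar>h t\<bar> \<le> 1 * \<phi> ?T" by (intro mult_mono) auto
      then show ?thesis using True by (simp add: abs_mult[symmetric] left_diff_distrib)
    next
      case False
      then have "primitive_ker a t = primitive_ker b t" by (auto simp: primitive_ker_def indicator_def)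
      then show ?thesis using \<phi>0 by simp
    qed
  qed
  also have "\<dots> = \<bar>a - b\<bar> * \<phi> ?T" by (cases "a \<le> b") simp_all
  finally show ?thesis .
qed

lemma measurable_primitive:
  fixes f :: "'a::euclidean_space \<Rightarrow> real \<Rightarrow> real"
  assumes f: "(\<lambda>(x, s). f x s) \<in> borel_measurable (borel \<Otimes>\<^sub>M borel)"
  shows "(\<lambda>(x, s). prim (f x) s) \<in> borel_measurable (borel \<Otimes>\<^sub>M borel)"
proof -
  have [measurable]: "(\<lambda>z. f (fst (fst z)) (snd z)) \<in> borel_measurable ((borel \<Otimes>\<^sub>M borel) \<Otimes>\<^sub>M lborel)"
    using measurable_compose[OF _ f, of "\<lambda>z. (fst (fst z), snd z)" "(borel \<Otimes>\<^sub>M borel) \<Otimes>\<^sub>M lborel"] by simp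
  have "(\<lambda>z. \<integral>t. primitive_ker (snd z) t * f (fst z) t \<partial>lborel) \<in> borel_measurable (borel \<Otimes>\<^sub>M borel)"
    by (rule lborel.borel_measurable_lebesgue_integral) (simp add: case_prod_beta)
  then show ?thesis unfolding interval_integral_eq_ker by (simp add: case_prod_beta)
qed

text \<open>One shape for both cases of the growth hypothesis: for an infinite critical exponent R
  is taken to be p, which only weakens the bound.\<close>

definition power_growth :: "real \<Rightarrow> real \<Rightarrow> real set \<Rightarrow> ('a \<Rightarrow> real \<Rightarrow> real) \<Rightarrow> bool" where
  "power_growth p R Q f \<longleftrightarrow> (\<forall>\<epsilon>>0. \<exists>q\<in>Q. \<exists>C>0. \<forall>x s.
     \<bar>f x s\<bar> \<le> \<epsilon> * (\<bar>s\<bar> powr (p - 1) + \<bar>s\<bar> powr (R - 1)) + C * \<bar>s\<bar> powr (q - 1))"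

lemma primitive_growth:
  fixes f :: "'a \<Rightarrow> real \<Rightarrow> real"
  assumes p: "1 < p" and R: "1 < R" and q: "1 < q"
    and m: "\<And>x. f x \<in> borel_measurable borel" and e: "0 \<le> \<epsilon>" and C: "0 \<le> C"
    and f: "\<And>x s. \<bar>f x s\<bar> \<le> \<epsilon> * (\<bar>s\<bar> powr (p - 1) + \<bar>s\<bar> powr (R - 1)) + C * \<bar>s\<bar> powr (q - 1)"
  shows "\<bar>prim (f x) a - prim (f x) b\<bar> \<le> \<bar>a - b\<bar> *
    (\<epsilon> * ((\<bar>a\<bar> + \<bar>b\<bar>) powr (p - 1) + (\<bar>a\<bar> + \<bar>b\<bar>) powr (R - 1)) + C * (\<bar>a\<bar> + \<bar>b\<bar>) powr (q - 1))"
  using assms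
  by (intro primitive_difference_bound[where \<phi>="\<lambda>s. \<epsilon> * (s powr (p - 1) + s powr (R - 1)) + C * s powr (q - 1)"]
     add_mono mult_left_mono powr_mono2) auto

text \<open>In the two \<epsilon>-terms the difference is estimated by
  \<open>\<bar>a\<bar> + \<bar>b\<bar>\<close>; only the q-term is divided by
  \<open>young_powr\<close>, with parameter \<delta>/C so that the factor C cancels. Thus the
  difference occurs in the power q alone, the one in which remainders are small.\<close>

lemma primitive_growth_fine:
  fixes f :: "'a \<Rightarrow> real \<Rightarrow> real"
  assumes p: "1 < p" and R: "1 < R" and Q: "\<And>q. q \<in> Q \<Longrightarrow> 1 < q"
    and m: "\<And>x. f x \<in> borel_measurable borel" and G: "power_growth p R Q f" and e: "0 < \<epsilon>"
  shows "\<exists>q\<in>Q. \<forall>\<delta>>0. \<exists>C\<ge>0. \<forall>x a b. \<bar>prim (f x) a - prim (f x) b\<bar> \<le>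
        \<epsilon> * ((\<bar>a\<bar> + \<bar>b\<bar>) powr p + (\<bar>a\<bar> + \<bar>b\<bar>) powr R) + \<delta> * (\<bar>a\<bar> + \<bar>b\<bar>) powr q + C * \<bar>a - b\<bar> powr q"
proof -
  obtain q C where q: "q \<in> Q" and C: "0 < C"
    and f: "\<And>x s. \<bar>f x s\<bar> \<le> \<epsilon> * (\<bar>s\<bar> powr (p - 1) + \<bar>s\<bar> powr (R - 1)) + C * \<bar>s\<bar> powr (q - 1)"
    using G e unfolding power_growth_def by blast
  show ?thesis
  proof (intro bexI[OF _ q] allI impI)
    fix \<delta> :: real assume \<delta>: "0 < \<delta>"
    show "\<exists>C\<ge>0. \<forall>x a b. \<bar>prim (f x) a - prim (f x) b\<bar> \<le>
        \<epsilon> * ((\<bar>a\<bar> + \<bar>b\<bar>) powr p + (\<bar>a\<bar> + \<bar>b\<bar>) powr R) + \<delta> * (\<bar>a\<bar> + \<bar>b\<bar>) powr q + C * \<bar>a - b\<bar> powr q"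
    proof (intro exI[of _ "C * (\<delta> / C) powr (1 - q)"] conjI allI)
      show "0 \<le> C * (\<delta> / C) powr (1 - q)" using C by simp
      fix x :: 'a and a b :: real
      let ?T = "\<bar>a\<bar> + \<bar>b\<bar>"
      have dT: "\<bar>a - b\<bar> \<le> ?T" by linarith
      have 1: "\<bar>a - b\<bar> * ?T powr (r - 1) \<le> ?T powr r" if "1 < r" for r
      proof -
        have "\<bar>a - b\<bar> * ?T powr (r - 1) \<le> ?T powr 1 * ?T powr (r - 1)" using dT by (intro mult_right_mono) auto
        then show ?thesis unfolding powr_add[symmetric] by simp
      qed
      have 2: "\<bar>a - b\<bar> * ?T powr (q - 1) \<le> \<delta> / C * ?T powr q + (\<delta> / C) powr (1 - q) * \<bar>a - b\<bar> powr q"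
        using dT \<delta> C Q[OF q] by (intro young_powr) auto
      have "\<bar>prim (f x) a - prim (f x) b\<bar> \<le> \<bar>a - b\<bar> * (\<epsilon> * (?T powr (p - 1) + ?T powr (R - 1)) + C * ?T powr (q - 1))"
        by (rule primitive_growth[OF p R Q[OF q] m _ _ f]) (use e C in auto)
      also have "\<dots> = \<epsilon> * (\<bar>a - b\<bar> * ?T powr (p - 1) + \<bar>a - b\<bar> * ?T powr (R - 1)) + C * (\<bar>a - b\<bar> * ?T powr (q - 1))"
        by (simp add: algebra_simps)
      also have "\<dots> \<le> \<epsilon> * (?T powr p + ?T powr R) + C * (\<delta> / C * ?T powr q + (\<delta> / C) powr (1 - q) * \<bar>a - b\<bar> powr q)"
        using e C by (intro add_mono mult_left_mono 1 2 p R) auto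
      also have "\<dots> = \<epsilon> * (?T powr p + ?T powr R) + \<delta> * ?T powr q + C * (\<delta> / C) powr (1 - q) * \<bar>a - b\<bar> powr q"
        using C by (simp add: algebra_simps)
      finally show "\<bar>prim (f x) a - prim (f x) b\<bar> \<le>
        \<epsilon> * (?T powr p + ?T powr R) + \<delta> * ?T powr q + C * (\<delta> / C) powr (1 - q) * \<bar>a - b\<bar> powr q" .
    qed
  qed
qed

text \<open>Here every term is divided by \<open>young_powr\<close>, so differences occur in all
  three powers. That suits the splitting, where tails of profiles are small in each of these spaces,
  but not the remainder, for which \<open>primitive_growth_fine\<close> is made.\<close>

lemma primitive_growth_mod:
  fixes f :: "'a \<Rightarrow> real \<Rightarrow> real"
  assumes p: "1 < p" and R: "1 < R" and q: "1 < q"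
    and m: "\<And>x. f x \<in> borel_measurable borel" and C: "0 \<le> C"
    and f: "\<And>x s. \<bar>f x s\<bar> \<le> 1 * (\<bar>s\<bar> powr (p - 1) + \<bar>s\<bar> powr (R - 1)) + C * \<bar>s\<bar> powr (q - 1)"
  shows "growth_mod {p, R, q} (\<lambda>x s. prim (f x) s)"
  unfolding growth_mod_def
proof (intro allI impI)
  fix \<delta> :: real assume \<delta>: "0 < \<delta>"
  let ?E = "{p, R, q}"
  \<comment> \<open>The exponents may coincide, and then the sum over the set {p, R, q} has fewer
    terms. Replacing each power by the total \<open>?S\<close> avoids a case distinction; D = 1 + 1
    + C is the resulting coefficient.\<close>
  define D where "D = 2 + C"
  define C' where "C' = (\<Sum>r\<in>?E. D * (\<delta> / D) powr (1 - r))"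
  have D: "0 < D" using C by (simp add: D_def)
  show "\<exists>C\<ge>0. \<forall>x a b. \<bar>prim (f x) a - prim (f x) b\<bar> \<le> (\<Sum>r\<in>?E. \<delta> * (\<bar>a\<bar> + \<bar>b\<bar>) powr r + C * \<bar>a - b\<bar> powr r)"
  proof (intro exI[of _ C'] conjI allI)
    show "0 \<le> C'" unfolding C'_def using D by (intro sum_nonneg) auto
    fix x :: 'a and a b :: real
    let ?T = "\<bar>a\<bar> + \<bar>b\<bar>" and ?S = "\<Sum>r\<in>?E. (\<bar>a\<bar> + \<bar>b\<bar>) powr (r - 1)"
    have S: "?T powr (r - 1) \<le> ?S" if "r \<in> ?E" for r using that by (intro member_le_sum) auto
    have "\<bar>prim (f x) a - prim (f x) b\<bar> \<le> \<bar>a - b\<bar> * (1 * (?T powr (p - 1) + ?T powr (R - 1)) + C * ?T powr (q - 1))"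
      by (rule primitive_growth[OF p R q m _ C f]) simp
    also have "\<dots> \<le> \<bar>a - b\<bar> * (1 * (?S + ?S) + C * ?S)"
      using C by (intro mult_left_mono add_mono S) auto
    also have "\<dots> = (\<Sum>r\<in>?E. D * (\<bar>a - b\<bar> * ?T powr (r - 1)))"
      by (simp only: sum_distrib_left[symmetric]) (simp add: D_def algebra_simps)
    also have "\<dots> \<le> (\<Sum>r\<in>?E. \<delta> * ?T powr r + C' * \<bar>a - b\<bar> powr r)"
    proof (rule sum_mono)
      fix r assume r: "r \<in> ?E"
      have r1: "1 \<le> r" using r p R q by auto
      have "D * (\<bar>a - b\<bar> * ?T powr (r - 1)) \<le> D * (\<delta> / D * ?T powr r + (\<delta> / D) powr (1 - r) * \<bar>a - b\<bar> powr r)"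
        using D \<delta> r1 by (intro mult_left_mono young_powr) auto
      also have "\<dots> = \<delta> * ?T powr r + D * (\<delta> / D) powr (1 - r) * \<bar>a - b\<bar> powr r" using D by (simp add: algebra_simps)
      also have "\<dots> \<le> \<delta> * ?T powr r + C' * \<bar>a - b\<bar> powr r"
      proof (intro add_left_mono mult_right_mono)
        show "D * (\<delta> / D) powr (1 - r) \<le> C'"
          unfolding C'_def using r D by (intro member_le_sum[of r ?E "\<lambda>r. D * (\<delta> / D) powr (1 - r)"]) auto
      qed simp
      finally show "D * (\<bar>a - b\<bar> * ?T powr (r - 1)) \<le> \<delta> * ?T powr r + C' * \<bar>a - b\<bar> powr r" .
    qed
    finally show "\<bar>prim (f x) a - prim (f x) b\<bar> \<le> (\<Sum>r\<in>?E. \<delta> * ?T powr r + C' * \<bar>a - b\<bar> powr r)" .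
  qed
qed

text \<open>Two-factor case of Hoelder's inequality, with the indicator of a bounded set as second factor.\<close>

lemma integral_bounded_support_le:
  fixes f g :: "'a::euclidean_space \<Rightarrow> real"
  assumes p: "1 < p" and f: "Lpb p f" and g[measurable]: "g \<in> borel_measurable borel"
    and B: "\<And>x. \<bar>g x\<bar> \<le> B" and k: "\<And>x. x \<notin> ball 0 k \<Longrightarrow> g x = 0"
  shows "integrable lborel (\<lambda>x. f x * g x)"
    and "\<bar>\<integral>x. f x * g x \<partial>lborel\<bar> \<le> B * measure lborel (ball (0::'a) k) powr (1 - 1 / p) * (\<integral>x. \<bar>f x\<bar> powr p \<partial>lborel) powr (1 / p)"
proof -
  let ?b = "ball (0::'a) k"
  note [measurable] = Lpb_measurable[OF f]
  have [measurable]: "?b \<in> sets borel" by simp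
  have B0: "0 \<le> B" using B[of 0] by linarith
  have fin: "emeasure lborel ?b \<noteq> top" using emeasure_bounded_finite[OF bounded_ball[of "0::'a" k]] by simp
  have fp: "(\<integral>\<^sup>+x. ennreal (\<bar>f x\<bar> powr p) \<partial>lborel) = ennreal (\<integral>x. \<bar>f x\<bar> powr p \<partial>lborel)"
    using Lpb_integrable[OF f] by (intro nn_integral_eq_integral) auto
  define F where "F (j::bool) x = (if j then ennreal (\<bar>f x\<bar> powr p) else indicator ?b x)" for j x
  define a where "a (j::bool) = (if j then 1 / p else 1 - 1 / p)" for j
  have pt: "ennreal \<bar>f x * g x\<bar> \<le> ennreal B * (\<Prod>j\<in>UNIV. epow (F j x) (a j))" for x
  proof (cases "x \<in> ?b")
    case True
    have "epow (ennreal (\<bar>f x\<bar> powr p)) (1 / p) = ennreal \<bar>f x\<bar>" using p by (simp add: epow_ennreal powr_powr)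
    moreover have "epow 1 (1 - 1 / p) = 1" using epow_ennreal[of 1 "1 - 1 / p"] by (cases "1 - 1 / p = 0") auto
    moreover have "\<bar>f x * g x\<bar> \<le> B * \<bar>f x\<bar>" using mult_left_mono[OF B[of x], of "\<bar>f x\<bar>"] by (simp add: abs_mult mult.commute)
    ultimately show ?thesis using True B0
      by (simp add: UNIV_bool F_def a_def ennreal_mult[symmetric] ennreal_leI)
  qed (simp add: k)
  have "(\<integral>\<^sup>+x. ennreal \<bar>f x * g x\<bar> \<partial>lborel) \<le> (\<integral>\<^sup>+x. ennreal B * (\<Prod>j\<in>UNIV. epow (F j x) (a j)) \<partial>lborel)"
    by (intro nn_integral_mono pt)
  also have Fm: "F j \<in> borel_measurable lborel" for j unfolding F_def by (cases j) auto
  then have "(\<integral>\<^sup>+x. ennreal B * (\<Prod>j\<in>UNIV. epow (F j x) (a j)) \<partial>lborel) = ennreal B * (\<integral>\<^sup>+x. (\<Prod>j\<in>UNIV. epow (F j x) (a j)) \<partial>lborel)"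
    by (intro nn_integral_cmult borel_measurable_prod_ennreal measurable_epow)
  also have "\<dots> \<le> ennreal B * (\<Prod>j\<in>UNIV. epow (\<integral>\<^sup>+x. F j x \<partial>lborel) (a j))"
    using p Fm by (intro mult_left_mono Holder_nn_integral_prod) (auto simp: a_def UNIV_bool)
  also have "\<dots> = ennreal (B * measure lborel ?b powr (1 - 1 / p) * (\<integral>x. \<bar>f x\<bar> powr p \<partial>lborel) powr (1 / p))"
  proof -
    have "epow (\<integral>\<^sup>+x. F True x \<partial>lborel) (a True) = ennreal ((\<integral>x. \<bar>f x\<bar> powr p \<partial>lborel) powr (1 / p))"
      using p by (simp add: F_def a_def fp epow_ennreal)
    moreover have "epow (\<integral>\<^sup>+x. F False x \<partial>lborel) (a False) = ennreal (measure lborel ?b powr (1 - 1 / p))"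
      using p fin by (simp add: F_def a_def emeasure_eq_ennreal_measure epow_ennreal)
    ultimately show ?thesis using B0 by (simp add: UNIV_bool ennreal_mult mult_ac)
  qed
  finally have le: "(\<integral>\<^sup>+x. ennreal \<bar>f x * g x\<bar> \<partial>lborel) \<le> ennreal (B * measure lborel ?b powr (1 - 1 / p) * (\<integral>x. \<bar>f x\<bar> powr p \<partial>lborel) powr (1 / p))" .
  then show i: "integrable lborel (\<lambda>x. f x * g x)" by (intro integrableI_bounded) (auto simp: le_less_trans)
  have "ennreal \<bar>\<integral>x. f x * g x \<partial>lborel\<bar> \<le> (\<integral>\<^sup>+x. ennreal \<bar>f x * g x\<bar> \<partial>lborel)"
    using integral_norm_bound_ennreal[OF i] by simp
  with le have "ennreal \<bar>\<integral>x. f x * g x \<partial>lborel\<bar> \<le> ennreal (B * measure lborel ?b powr (1 - 1 / p) * (\<integral>x. \<bar>f x\<bar> powr p \<partial>lborel) powr (1 / p))"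
    by (rule order_trans[rotated])
  then show "\<bar>\<integral>x. f x * g x \<partial>lborel\<bar> \<le> B * measure lborel ?b powr (1 - 1 / p) * (\<integral>x. \<bar>f x\<bar> powr p \<partial>lborel) powr (1 / p)"
    using B0 by (simp add: ennreal_le_iff)
qed

section \<open>Sobolev functions and their Borel representatives\<close>

lemma finite_mi: "finite {\<beta> :: 'n::finite \<Rightarrow> nat. mi_abs \<beta> \<le> m}"
proof (rule finite_subset)
  have "\<beta> i \<le> mi_abs \<beta>" for \<beta> :: "'n \<Rightarrow> nat" and i
    unfolding mi_abs_def by (rule member_le_sum) auto
  then show "{\<beta> :: 'n \<Rightarrow> nat. mi_abs \<beta> \<le> m} \<subseteq> PiE UNIV (\<lambda>_. {..m})"
    by (auto simp: PiE_UNIV_domain intro: order_trans)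
  show "finite (PiE (UNIV :: 'n set) (\<lambda>_. {..m}))" by (intro finite_PiE) auto
qed

lemma W_wd:
  assumes "u \<in> W m p" "mi_abs \<beta> \<le> m"
  shows "is_wderiv \<beta> u (wd \<beta> u)" "in_Lp p (wd \<beta> u)"
proof -
  obtain v where v: "is_wderiv \<beta> u v" "in_Lp p v" using assms by (auto simp: W_def)
  show "is_wderiv \<beta> u (wd \<beta> u)" by (rule wd_is_wderiv[OF v(1)])
  have "AE x in lebesgue. v x = wd \<beta> u x" using wd_AE_eq[OF v(1)] by (auto simp: eq_commute)
  then show "in_Lp p (wd \<beta> u)" by (rule in_Lp_cong_AE[OF v(2)])
qed

lemma Lp_norm_le_W_norm:
  assumes p: "1 < p" and b: "mi_abs \<beta> \<le> m"
  shows "Lp_norm p (wd \<beta> u) \<le> W_norm m p u"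
proof -
  \<comment> \<open>By convention a sum over an infinite set is 0; \<open>finite_mi\<close> is what
    lets \<open>W_norm\<close> control each single derivative.\<close>
  have "Lp_norm p (wd \<beta> u) powr p \<le> (\<Sum>\<beta>\<in>{\<beta>. mi_abs \<beta> \<le> m}. Lp_norm p (wd \<beta> u) powr p)"
    using b by (intro member_le_sum[of \<beta> _ "\<lambda>\<beta>. Lp_norm p (wd \<beta> u) powr p"] finite_mi) auto
  then have "(Lp_norm p (wd \<beta> u) powr p) powr (1 / p) \<le> W_norm m p u"
    unfolding W_norm_def using p by (intro powr_mono2) auto
  then show ?thesis using p by (simp add: powr_powr Lp_norm_def)
qed

lemma wderivs_bounded_W:
  assumes p: "1 < p" and u: "u \<in> W m p" and C: "W_norm m p u \<le> C" and K: "C powr p \<le> K"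
  shows "wderivs_bounded m p K u"
  unfolding wderivs_bounded_def
proof (intro allI impI exI conjI)
  fix \<beta> :: "'a \<Rightarrow> nat" assume b: "mi_abs \<beta> \<le> m"
  show "is_wderiv \<beta> u (wd \<beta> u)" by (rule W_wd(1)[OF u b])
  have i: "integrable lebesgue (\<lambda>x. \<bar>wd \<beta> u x\<bar> powr p)" using W_wd(2)[OF u b] by (simp add: in_Lp_def)
  have "Lp_norm p (wd \<beta> u) \<le> C" using Lp_norm_le_W_norm[OF p b] C by (rule order_trans)
  then have "Lp_norm p (wd \<beta> u) powr p \<le> K"
    using powr_mono2[of p "Lp_norm p (wd \<beta> u)" C] K p by (simp add: Lp_norm_def)
  then have "(\<integral>x. \<bar>wd \<beta> u x\<bar> powr p \<partial>lebesgue) \<le> K" using p by (simp add: Lp_norm_def powr_powr)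
  then show "(\<integral>\<^sup>+x. ennreal (\<bar>wd \<beta> u x\<bar> powr p) \<partial>lebesgue) \<le> ennreal K"
    using i by (subst nn_integral_eq_integral) (auto intro: ennreal_leI)
qed

lemma wd_lin:
  assumes "is_wderiv \<alpha> u u'" "is_wderiv \<alpha> v v'"
  shows "AE x in lebesgue. wd \<alpha> (\<lambda>x. a * u x + b * v x) x = a * wd \<alpha> u x + b * wd \<alpha> v x"
  by (rule wd_AE_eq[OF is_wderiv_lin[OF wd_is_wderiv[OF assms(1)] wd_is_wderiv[OF assms(2)]]])

lemma is_wderiv_remainder:
  assumes u: "is_wderiv \<alpha> (u (N n)) u'" and w: "\<And>l. l \<le> L \<Longrightarrow> is_wderiv \<alpha> (w l) (w' l)"
  shows "is_wderiv \<alpha> (remainder u N w y L n) (\<lambda>x. u' x - (\<Sum>l\<le>L. w' l (x - y l n)))"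
  using w
proof (induction L)
  case 0
  from is_wderiv_lin[OF u is_wderiv_shift[OF 0(1)[OF order_refl], of "- y 0 n"], of 1 "-1"]
  show ?case by (simp add: remainder_def)
next
  case (Suc L)
  have "is_wderiv \<alpha> (\<lambda>x. 1 * remainder u N w y L n x + (-1) * w (Suc L) (x + - y (Suc L) n))
     (\<lambda>x. 1 * (u' x - (\<Sum>l\<le>L. w' l (x - y l n))) + (-1) * w' (Suc L) (x + - y (Suc L) n))"
    by (intro is_wderiv_lin is_wderiv_shift Suc) auto
  then show ?case by (simp add: remainder_def algebra_simps)
qed

text \<open>Exchanges representative and measure at once. Completeness of \<open>lebesgue\<close>
  makes the integrand with \<open>V\<close> measurable, since it agrees almost everywhere with a
  Borel one.\<close>

lemma lebesgue_eq_lborel_cong: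
  fixes F :: "real^'n::finite \<Rightarrow> real \<Rightarrow> real"
  assumes F: "(\<lambda>(x, s). F x s) \<in> borel_measurable (borel \<Otimes>\<^sub>M borel)"
    and v: "v \<in> borel_measurable borel" and V: "AE x in lborel. V x = v x"
  shows "(\<integral>x. F x (V x) \<partial>lebesgue) = (\<integral>x. F x (v x) \<partial>lborel)"
proof -
  have m: "(\<lambda>x. F x (v x)) \<in> borel_measurable lborel"
    using measurable_compose[OF measurable_Pair[OF measurable_ident_sets[OF refl] v] F] by simp
  have ml: "(\<lambda>x. F x (v x)) \<in> borel_measurable lebesgue" using measurable_completion[OF m] .
  have ae: "AE x in lebesgue. F x (v x) = F x (V x)" using AE_completion[OF V] by eventually_elim simp
  have "(\<integral>x. F x (V x) \<partial>lebesgue) = (\<integral>x. F x (v x) \<partial>lebesgue)"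
    by (rule integral_cong_AE[OF borel_measurable_AE[OF ml ae] ml]) (use ae in \<open>auto simp: eq_commute\<close>)
  also have "\<dots> = (\<integral>x. F x (v x) \<partial>lborel)" by (rule integral_completion[OF m])
  finally show ?thesis .
qed

lemma Lpb_of_nn_integral:
  assumes [measurable]: "f \<in> borel_measurable borel" and M: "0 \<le> M" "(\<integral>\<^sup>+x. ennreal (\<bar>f x\<bar> powr r) \<partial>lborel) \<le> ennreal M"
  shows "Lpb r f" "(\<integral>x. \<bar>f x\<bar> powr r \<partial>lborel) \<le> M"
proof -
  have i: "integrable lborel (\<lambda>x. \<bar>f x\<bar> powr r)" using M by (intro integrableI_nonneg) (auto simp: le_less_trans)
  then show "Lpb r f" by (simp add: Lpb_def)
  have "ennreal (\<integral>x. \<bar>f x\<bar> powr r \<partial>lborel) \<le> ennreal M"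
    using M(2) i by (subst (asm) nn_integral_eq_integral) auto
  then show "(\<integral>x. \<bar>f x\<bar> powr r \<partial>lborel) \<le> M" using M(1) by (simp add: ennreal_le_iff)
qed

lemma borel_version:
  assumes "f \<in> borel_measurable lebesgue"
  obtains g :: "'a::euclidean_space \<Rightarrow> real" where "g \<in> borel_measurable borel" "AE x in lborel. f x = g x"
  using completion_ex_borel_measurable_real[OF assms] by auto

text \<open>Weak convergence in W thereby yields convergence of derivatives against bounded Borel
  functions of bounded support. \<open>wd\<close> is linear only up to null sets, which the integral
  does not see; the bound is Hoelder's inequality on the ball.\<close>

lemma W_functional_pairing:
  fixes g :: "real^'n::finite \<Rightarrow> real"
  assumes p: "1 < p" and a: "mi_abs \<alpha> \<le> m" and g[measurable]: "g \<in> borel_measurable borel"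
    and B: "\<And>x. \<bar>g x\<bar> \<le> B" and k: "\<And>x. x \<notin> ball 0 k \<Longrightarrow> g x = 0"
  shows "W_functional m p (\<lambda>z. \<integral>x. wd \<alpha> z x * g x \<partial>lebesgue)"
proof -
  let ?b = "ball (0::real^'n) k"
  have Fm: "(\<lambda>(x, s). s * g x) \<in> borel_measurable (borel \<Otimes>\<^sub>M borel)" by measurable
  have ver: "\<exists>z'. Lpb p z' \<and> (AE x in lborel. wd \<alpha> z x = z' x)" if z: "z \<in> W m p" for z
  proof -
    have L: "in_Lp p (wd \<alpha> z)" by (rule W_wd(2)[OF z a])
    then obtain z' where z': "z' \<in> borel_measurable borel" "AE x in lborel. wd \<alpha> z x = z' x"
      using borel_version unfolding in_Lp_def by blast
    have "in_Lp p z'" by (rule in_Lp_cong_AE[OF L AE_completion[OF z'(2)]])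
    then have "integrable lborel (\<lambda>x. \<bar>z' x\<bar> powr p)"
      using z'(1) by (simp add: in_Lp_def integrable_completion)
    then show ?thesis using z' by (auto simp: Lpb_def)
  qed
  show ?thesis unfolding W_functional_def
  proof (intro conjI allI impI)
    fix z1 z2 :: "real^'n \<Rightarrow> real" and c d assume z: "z1 \<in> W m p" "z2 \<in> W m p"
    obtain z1' where z1: "Lpb p z1'" "AE x in lborel. wd \<alpha> z1 x = z1' x" using ver[OF z(1)] by blast
    obtain z2' where z2: "Lpb p z2'" "AE x in lborel. wd \<alpha> z2 x = z2' x" using ver[OF z(2)] by blast
    have "AE x in lborel. wd \<alpha> (\<lambda>x. c * z1 x + d * z2 x) x = c * wd \<alpha> z1 x + d * wd \<alpha> z2 x"
      using wd_lin[OF W_wd(1)[OF z(1) a] W_wd(1)[OF z(2) a], of c d] by (simp add: AE_completion_iff)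
    then have ae: "AE x in lborel. wd \<alpha> (\<lambda>x. c * z1 x + d * z2 x) x = c * z1' x + d * z2' x"
      using z1(2) z2(2) by eventually_elim simp
    have m': "(\<lambda>x. c * z1' x + d * z2' x) \<in> borel_measurable borel"
      using Lpb_measurable[OF z1(1)] Lpb_measurable[OF z2(1)] by measurable
    have "(\<integral>x. (c * z1' x + d * z2' x) * g x \<partial>lborel) = (\<integral>x. c * (z1' x * g x) + d * (z2' x * g x) \<partial>lborel)"
      by (simp add: algebra_simps)
    also have "\<dots> = c * (\<integral>x. z1' x * g x \<partial>lborel) + d * (\<integral>x. z2' x * g x \<partial>lborel)"
      using integral_bounded_support_le(1)[OF p z1(1) g B k] integral_bounded_support_le(1)[OF p z2(1) g B k] by simp
    finally show "(\<integral>x. wd \<alpha> (\<lambda>x. c * z1 x + d * z2 x) x * g x \<partial>lebesgue)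
        = c * (\<integral>x. wd \<alpha> z1 x * g x \<partial>lebesgue) + d * (\<integral>x. wd \<alpha> z2 x * g x \<partial>lebesgue)"
      unfolding lebesgue_eq_lborel_cong[OF Fm m' ae] lebesgue_eq_lborel_cong[OF Fm Lpb_measurable[OF z1(1)] z1(2)]
        lebesgue_eq_lborel_cong[OF Fm Lpb_measurable[OF z2(1)] z2(2)] .
  next
    show "\<exists>C. \<forall>z\<in>W m p. \<bar>\<integral>x. wd \<alpha> z x * g x \<partial>lebesgue\<bar> \<le> C * W_norm m p z"
    proof (intro exI[of _ "B * measure lborel ?b powr (1 - 1 / p)"] ballI)
      fix z :: "real^'n \<Rightarrow> real" assume z: "z \<in> W m p"
      obtain z' where z': "Lpb p z'" "AE x in lborel. wd \<alpha> z x = z' x" using ver[OF z] by blast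
      have B0: "0 \<le> B" using B[of 0] by linarith
      have "(\<lambda>(x::real^'n, s). \<bar>s\<bar> powr p) \<in> borel_measurable (borel \<Otimes>\<^sub>M borel)" by measurable
      from lebesgue_eq_lborel_cong[OF this Lpb_measurable[OF z'(1)] z'(2)]
      have n: "Lp_norm p (wd \<alpha> z) = (\<integral>x. \<bar>z' x\<bar> powr p \<partial>lborel) powr (1 / p)" by (simp add: Lp_norm_def)
      have "\<bar>\<integral>x. wd \<alpha> z x * g x \<partial>lebesgue\<bar> \<le> B * measure lborel ?b powr (1 - 1 / p) * Lp_norm p (wd \<alpha> z)"
        unfolding lebesgue_eq_lborel_cong[OF Fm Lpb_measurable[OF z'(1)] z'(2)] n
        by (rule integral_bounded_support_le(2)[OF p z'(1) g B k])
      also have "\<dots> \<le> B * measure lborel ?b powr (1 - 1 / p) * W_norm m p z"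
        using B0 by (intro mult_left_mono Lp_norm_le_W_norm[OF p a]) auto
      finally show "\<bar>\<integral>x. wd \<alpha> z x * g x \<partial>lebesgue\<bar> \<le> B * measure lborel ?b powr (1 - 1 / p) * W_norm m p z" .
    qed
  qed
qed

text \<open>M is chosen before z, so one constant serves for a whole ball of W; this is used for the
  bounded sequence and also for each single profile.\<close>

lemma W_embedding_bounded:
  fixes \<alpha> :: "'n::finite \<Rightarrow> nat"
  assumes p: "1 < p" and a: "mi_abs \<alpha> \<le> m" and r: "p \<le> r" "ereal r \<le> sob_exp p CARD('n) (m - mi_abs \<alpha>)"
  shows "\<exists>M. \<forall>z v. z \<in> W m p \<longrightarrow> W_norm m p z \<le> C \<longrightarrow> v \<in> borel_measurable borel \<longrightarrow> (AE x in lborel. wd \<alpha> z x = v x) \<longrightarrow>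
     Lpb r v \<and> (\<integral>x. \<bar>v x\<bar> powr r \<partial>lborel) \<le> M"
proof -
  \<comment> \<open>The summand 1 keeps K positive when C is 0.\<close>
  define K where "K = C powr p + 1"
  have K: "0 < K" by (simp add: K_def add_nonneg_pos)
  obtain M where M: "0 \<le> M" "\<And>v :: real^'n \<Rightarrow> real. wderivs_bounded (m - mi_abs \<alpha>) p K v \<Longrightarrow> (\<integral>\<^sup>+x. ennreal (\<bar>v x\<bar> powr r) \<partial>lebesgue) \<le> ennreal M"
    using sobolev_embedding[OF p r K] by blast
  show ?thesis
  proof (intro exI[of _ M] allI impI)
    fix z v :: "real^'n \<Rightarrow> real"
    assume z: "z \<in> W m p" "W_norm m p z \<le> C" and v: "v \<in> borel_measurable borel" "AE x in lborel. wd \<alpha> z x = v x"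
    have "wderivs_bounded (m - mi_abs \<alpha> + mi_abs \<alpha>) p K z"
      using wderivs_bounded_W[OF p z] a by (simp add: K_def)
    then have "(\<integral>\<^sup>+x. ennreal (\<bar>wd \<alpha> z x\<bar> powr r) \<partial>lebesgue) \<le> ennreal M"
      by (intro M(2) wderivs_bounded_deriv[OF _ W_wd(1)[OF z(1) a]])
    moreover have "(\<integral>\<^sup>+x. ennreal (\<bar>wd \<alpha> z x\<bar> powr r) \<partial>lebesgue) = (\<integral>\<^sup>+x. ennreal (\<bar>v x\<bar> powr r) \<partial>lborel)"
      unfolding nn_integral_lebesgue_eq_lborel by (rule nn_integral_cong_AE) (use v(2) in auto)
    ultimately show "Lpb r v \<and> (\<integral>x. \<bar>v x\<bar> powr r \<partial>lborel) \<le> M"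
      using Lpb_of_nn_integral[OF v(1) M(1)] by simp
  qed
qed

text \<open>Turns the two forms of the vanishing condition into one: a finite \<Lambda> allows only
  L = \<Lambda>, so it is its own threshold, and for infinite \<Lambda> the threshold comes from the
  limit of the upper limits.\<close>

lemma remainder_eventually_small:
  assumes q: "0 < q" and e: "0 < e"
    and small: "case \<Lambda> of enat K \<Rightarrow> limsup (\<lambda>n. ereal (I K n powr (1 / q))) = 0
         | \<infinity> \<Rightarrow> (\<lambda>L. limsup (\<lambda>n. ereal (I L n powr (1 / q)))) \<longlonglongrightarrow> 0"
    and I: "\<And>L n. 0 \<le> (I L n :: real)"
  shows "\<exists>L0. enat L0 \<le> \<Lambda> \<and> (\<forall>L\<ge>L0. enat L \<le> \<Lambda> \<longrightarrow> (\<forall>\<^sub>F n in sequentially. I L n < e))"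
proof -
  define e' where "e' = e powr (1 / q)"
  have e': "0 < e'" using e by (simp add: e'_def)
  have *: "\<forall>\<^sub>F n in sequentially. I L n < e" if "limsup (\<lambda>n. ereal (I L n powr (1 / q))) < ereal e'" for L
    using Limsup_lessD[OF that]
  proof eventually_elim
    case (elim n)
    then have "I L n powr (1 / q) < e powr (1 / q)" by (simp add: e'_def)
    then show ?case using powr_mono2[of "1 / q" e "I L n"] e q by (force simp: not_le[symmetric])
  qed
  show ?thesis
  proof (cases \<Lambda>)
    case (enat K)
    then have "limsup (\<lambda>n. ereal (I K n powr (1 / q))) < ereal e'" using small e' by simp
    then show ?thesis using * enat by (intro exI[of _ K]) (auto simp: order_antisym_conv)
  next
    case infinity
    then have "(\<lambda>L. limsup (\<lambda>n. ereal (I L n powr (1 / q)))) \<longlonglongrightarrow> 0" using small by simp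
    then have "\<forall>\<^sub>F L in sequentially. limsup (\<lambda>n. ereal (I L n powr (1 / q))) < ereal e'"
      using e' by (intro order_tendstoD(2)) (auto simp: zero_ereal_def)
    then obtain L0 where "\<And>L. L \<ge> L0 \<Longrightarrow> limsup (\<lambda>n. ereal (I L n powr (1 / q))) < ereal e'"
      by (auto simp: eventually_sequentially)
    then show ?thesis using * infinity by (intro exI[of _ L0]) auto
  qed
qed

text \<open>Representatives are fixed once for all members of the sequence and all profiles, and
  boundedness, weak convergence and smallness of the remainder are restated for them. Statements on
  profiles are limited to indices up to \<Lambda>, beyond which \<open>w l\<close> is
  arbitrary.\<close>

lemma profile_borel_versions:
  fixes u :: "nat \<Rightarrow> real^'n::finite \<Rightarrow> real" and \<alpha> :: "'n \<Rightarrow> nat"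
  assumes p: "1 < p" and bdd: "W_bounded_seq m p u" and pd: "profile_decomp m p u \<Lambda> N w y"
    and alpha: "mi_abs \<alpha> < m"
  obtains v \<omega> where
    "\<And>n. v n \<in> borel_measurable borel" "\<And>n. AE x in lborel. wd \<alpha> (u (N n)) x = v n x"
    "\<And>l. enat l \<le> \<Lambda> \<Longrightarrow> \<omega> l \<in> borel_measurable borel"
    "\<And>l. enat l \<le> \<Lambda> \<Longrightarrow> AE x in lborel. wd \<alpha> (w l) x = \<omega> l x"
    "\<And>r. p \<le> r \<Longrightarrow> ereal r \<le> sob_exp p CARD('n) (m - mi_abs \<alpha>) \<Longrightarrow> \<exists>M. \<forall>n. Lpb r (v n) \<and> (\<integral>x. \<bar>v n x\<bar> powr r \<partial>lborel) \<le> M"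
    "\<And>l r. enat l \<le> \<Lambda> \<Longrightarrow> p \<le> r \<Longrightarrow> ereal r \<le> sob_exp p CARD('n) (m - mi_abs \<alpha>) \<Longrightarrow> Lpb r (\<omega> l)"
    "\<And>l g B k. enat l \<le> \<Lambda> \<Longrightarrow> g \<in> borel_measurable borel \<Longrightarrow> (\<And>x. \<bar>g x\<bar> \<le> B) \<Longrightarrow> (\<And>x. x \<notin> ball 0 (real k) \<Longrightarrow> g x = 0) \<Longrightarrow>
       (\<lambda>n. \<integral>x. v n (x + y l n) * g x \<partial>lborel) \<longlonglongrightarrow> (\<integral>x. \<omega> l x * g x \<partial>lborel)"
    "\<And>q e. p < q \<Longrightarrow> ereal q < sob_exp p CARD('n) (m - mi_abs \<alpha>) \<Longrightarrow> 0 < e \<Longrightarrow> \<exists>L0. enat L0 \<le> \<Lambda> \<and> (\<forall>L\<ge>L0. enat L \<le> \<Lambda> \<longrightarrow>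
        (\<forall>\<^sub>F n in sequentially. (\<integral>x. \<bar>v n x - (\<Sum>l\<le>L. \<omega> l (x - y l n))\<bar> powr q \<partial>lborel) < e))"
proof -
  have a: "mi_abs \<alpha> \<le> m" using alpha by simp
  obtain C where uW: "\<And>n. u n \<in> W m p" and uC: "\<And>n. W_norm m p (u n) \<le> C"
    using bdd by (auto simp: W_bounded_seq_def)
  have wW: "w l \<in> W m p" if "enat l \<le> \<Lambda>" for l using pd that by (simp add: profile_decomp_def)
  have ver: "\<exists>v. v \<in> borel_measurable borel \<and> (AE x in lborel. wd \<alpha> z x = v x)" if "z \<in> W m p" for z :: "real^'n \<Rightarrow> real"
    using borel_version[of "wd \<alpha> z"] W_wd(2)[OF that a] unfolding in_Lp_def by blast
  have "\<forall>n. \<exists>v. v \<in> borel_measurable borel \<and> (AE x in lborel. wd \<alpha> (u (N n)) x = v x)"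
    using ver[OF uW] by blast
  then obtain v where v: "\<And>n. v n \<in> borel_measurable borel" "\<And>n. AE x in lborel. wd \<alpha> (u (N n)) x = v n x" by metis
  have "\<forall>l. \<exists>f. enat l \<le> \<Lambda> \<longrightarrow> f \<in> borel_measurable borel \<and> (AE x in lborel. wd \<alpha> (w l) x = f x)"
    using ver[OF wW] by blast
  then obtain \<omega> where \<omega>: "\<And>l. enat l \<le> \<Lambda> \<Longrightarrow> \<omega> l \<in> borel_measurable borel"
    "\<And>l. enat l \<le> \<Lambda> \<Longrightarrow> AE x in lborel. wd \<alpha> (w l) x = \<omega> l x" by metis
  note wd_u = W_wd(1)[OF uW a] and wd_w = W_wd(1)[OF wW a]
  have down: "enat l \<le> \<Lambda>" if "enat L \<le> \<Lambda>" "l \<le> L" for l L using that by (meson enat_ord_simps(1) order_trans)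
  show thesis
  proof (rule that[OF v \<omega>])
    show "\<exists>M. \<forall>n. Lpb r (v n) \<and> (\<integral>x. \<bar>v n x\<bar> powr r \<partial>lborel) \<le> M"
      if r: "p \<le> r" "ereal r \<le> sob_exp p CARD('n) (m - mi_abs \<alpha>)" for r
      using W_embedding_bounded[OF p a r, of C] uW uC v by meson
    show "Lpb r (\<omega> l)" if l: "enat l \<le> \<Lambda>" and r: "p \<le> r" "ereal r \<le> sob_exp p CARD('n) (m - mi_abs \<alpha>)" for l r
      using W_embedding_bounded[OF p a r, of "W_norm m p (w l)"] wW[OF l] \<omega>[OF l] by blast
  next
    fix l B k and g :: "real^'n \<Rightarrow> real"
    assume l: "enat l \<le> \<Lambda>" and g[measurable]: "g \<in> borel_measurable borel" and B: "\<And>x. \<bar>g x\<bar> \<le> B" and k: "\<And>x. x \<notin> ball 0 (real k) \<Longrightarrow> g x = 0"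
    let ?lf = "\<lambda>z. \<integral>x. wd \<alpha> z x * g x \<partial>lebesgue"
    have Fm: "(\<lambda>(x, s). s * g x) \<in> borel_measurable (borel \<Otimes>\<^sub>M borel)" by measurable
    have "W_weak_conv m p (\<lambda>n. \<lambda>x. u (N n) (x + y l n)) (w l)" using pd l by (simp add: profile_decomp_def)
    then have "(\<lambda>n. ?lf (\<lambda>x. u (N n) (x + y l n))) \<longlonglongrightarrow> ?lf (w l)"
      using W_functional_pairing[OF p a g B k] unfolding W_weak_conv_def by blast
    moreover have "?lf (w l) = (\<integral>x. \<omega> l x * g x \<partial>lborel)"
      by (rule lebesgue_eq_lborel_cong[OF Fm \<omega>[OF l]])
    moreover have "?lf (\<lambda>x. u (N n) (x + y l n)) = (\<integral>x. v n (x + y l n) * g x \<partial>lborel)" for n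
    proof (rule lebesgue_eq_lborel_cong[OF Fm])
      note [measurable] = v(1)[of n]
      show "(\<lambda>x. v n (x + y l n)) \<in> borel_measurable borel" by measurable
      have "AE x in lebesgue. wd \<alpha> (\<lambda>x. u (N n) (x + y l n)) x = wd \<alpha> (u (N n)) (x + y l n)"
        by (rule wd_AE_eq[OF is_wderiv_shift[OF wd_u]])
      moreover have "AE x in lebesgue. wd \<alpha> (u (N n)) (x + y l n) = v n (x + y l n)"
        by (rule AE_lebesgue_shift[OF AE_completion[OF v(2)]])
      ultimately have "AE x in lebesgue. wd \<alpha> (\<lambda>x. u (N n) (x + y l n)) x = v n (x + y l n)"
        by eventually_elim simp
      then show "AE x in lborel. wd \<alpha> (\<lambda>x. u (N n) (x + y l n)) x = v n (x + y l n)" by (simp add: AE_completion_iff)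
    qed
    ultimately show "(\<lambda>n. \<integral>x. v n (x + y l n) * g x \<partial>lborel) \<longlonglongrightarrow> (\<integral>x. \<omega> l x * g x \<partial>lborel)" by simp
  next
    fix q e :: real assume q: "p < q" "ereal q < sob_exp p CARD('n) (m - mi_abs \<alpha>)" and e: "0 < e"
    define I where "I L n = (if enat L \<le> \<Lambda> then \<integral>x. \<bar>v n x - (\<Sum>l\<le>L. \<omega> l (x - y l n))\<bar> powr q \<partial>lborel else 0)" for L n
    have eq: "Lp_norm q (wd \<alpha> (remainder u N w y L n)) = I L n powr (1 / q)" if L: "enat L \<le> \<Lambda>" for L n
    proof -
      have m1: "(\<lambda>(x::real^'n, s). \<bar>s\<bar> powr q) \<in> borel_measurable (borel \<Otimes>\<^sub>M borel)" by measurable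
      have m2: "(\<lambda>x. v n x - (\<Sum>l\<le>L. \<omega> l (x - y l n))) \<in> borel_measurable borel"
        using v(1) \<omega>(1) down[OF L] by (intro borel_measurable_diff borel_measurable_sum borel_measurable_shift) auto
      have "AE x in lebesgue. wd \<alpha> (remainder u N w y L n) x = wd \<alpha> (u (N n)) x - (\<Sum>l\<le>L. wd \<alpha> (w l) (x - y l n))"
        by (rule wd_AE_eq[OF is_wderiv_remainder[OF wd_u wd_w]]) (rule down[OF L])
      moreover have "AE x in lebesgue. \<forall>l\<in>{..L}. wd \<alpha> (w l) (x + - y l n) = \<omega> l (x + - y l n)"
      proof (rule AE_finite_allI)
        fix l assume "l \<in> {..L}"
        then have "enat l \<le> \<Lambda>" using down[OF L] by simp
        then show "AE x in lebesgue. wd \<alpha> (w l) (x + - y l n) = \<omega> l (x + - y l n)"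
          by (rule AE_lebesgue_shift[OF AE_completion[OF \<omega>(2)]])
      qed simp
      moreover have "AE x in lebesgue. wd \<alpha> (u (N n)) x = v n x" by (rule AE_completion[OF v(2)])
      ultimately have "AE x in lebesgue. wd \<alpha> (remainder u N w y L n) x = v n x - (\<Sum>l\<le>L. \<omega> l (x - y l n))"
        by eventually_elim (auto intro!: sum.cong)
      then have "AE x in lborel. wd \<alpha> (remainder u N w y L n) x = v n x - (\<Sum>l\<le>L. \<omega> l (x - y l n))"
        by (simp add: AE_completion_iff)
      from lebesgue_eq_lborel_cong[OF m1 m2 this] show ?thesis using L by (simp add: Lp_norm_def I_def)
    qed
    have "case \<Lambda> of enat K \<Rightarrow> limsup (\<lambda>n. ereal (Lp_norm q (wd \<alpha> (remainder u N w y K n)))) = 0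
         | \<infinity> \<Rightarrow> (\<lambda>L. limsup (\<lambda>n. ereal (Lp_norm q (wd \<alpha> (remainder u N w y L n))))) \<longlonglongrightarrow> 0"
      using pd alpha q unfolding profile_decomp_def by simp
    then have small: "case \<Lambda> of enat K \<Rightarrow> limsup (\<lambda>n. ereal (I K n powr (1 / q))) = 0
         | \<infinity> \<Rightarrow> (\<lambda>L. limsup (\<lambda>n. ereal (I L n powr (1 / q)))) \<longlonglongrightarrow> 0"
      using eq by (cases \<Lambda>) simp_all
    have q0: "0 < q" and I0: "0 \<le> I L n" for L n using q p by (simp_all add: I_def)
    obtain L0 where "enat L0 \<le> \<Lambda>" "\<And>L. L \<ge> L0 \<Longrightarrow> enat L \<le> \<Lambda> \<Longrightarrow> \<forall>\<^sub>F n in sequentially. I L n < e"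
      using remainder_eventually_small[OF q0 e small I0] by blast
    then show "\<exists>L0. enat L0 \<le> \<Lambda> \<and> (\<forall>L\<ge>L0. enat L \<le> \<Lambda> \<longrightarrow>
        (\<forall>\<^sub>F n in sequentially. (\<integral>x. \<bar>v n x - (\<Sum>l\<le>L. \<omega> l (x - y l n))\<bar> powr q \<partial>lborel) < e))"
      by (intro exI[of _ L0]) (auto simp: I_def)
  qed
qed

section \<open>Integrals of primitives along translates\<close>

lemma prim_0: "prim h 0 = 0"
  by (simp add: interval_integral_eq_ker primitive_ker_def)

lemma measurable_Nemytskii:
  assumes F: "(\<lambda>(x, s). F x s) \<in> borel_measurable (borel \<Otimes>\<^sub>M borel)" and g: "g \<in> borel_measurable borel"
  shows "(\<lambda>x. F x (g x)) \<in> borel_measurable borel"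
  using measurable_compose[OF measurable_Pair[OF measurable_ident_sets[OF refl] g] F] by simp

lemma integral_translate_Nemytskii:
  fixes F :: "'a::euclidean_space \<Rightarrow> real \<Rightarrow> real"
  assumes F: "(\<lambda>(x, s). F x s) \<in> borel_measurable (borel \<Otimes>\<^sub>M borel)" and g: "g \<in> borel_measurable borel"
  shows "(\<integral>x. F x (g (x - c)) \<partial>lborel) = (\<integral>x. F (x + c) (g x) \<partial>lborel)"
  using lborel_shift(1)[OF measurable_Nemytskii[OF F borel_measurable_shift[OF g, of c]], of c] by simp

text \<open>Dominated convergence twice: in t with majorant \<open>\<phi> \<bar>s\<bar>\<close> on a
  bounded interval, which gives pointwise convergence of the primitives, and in x with the majorant
  that \<open>growth_mod\<close> provides at b = 0. Both majorants are uniform in the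
  translation.\<close>

lemma vanishing_translate_limit:
  fixes f :: "'a::euclidean_space \<Rightarrow> real \<Rightarrow> real"
  assumes fm: "(\<lambda>(x, s). f x s) \<in> borel_measurable (borel \<Otimes>\<^sub>M borel)"
    and fmx: "\<And>x. f x \<in> borel_measurable borel"
    and bound: "\<And>x t. \<bar>f x t\<bar> \<le> \<phi> \<bar>t\<bar>" and \<phi>: "\<And>s t. 0 \<le> s \<Longrightarrow> s \<le> t \<Longrightarrow> \<phi> s \<le> \<phi> t"
    and finf: "\<And>s. ((\<lambda>x. f x s) \<longlongrightarrow> finf s) at_infinity"
    and finfm: "finf \<in> borel_measurable borel"
    and E: "finite E" "growth_mod E (\<lambda>x s. prim (f x) s)" and g: "\<And>r. r \<in> E \<Longrightarrow> Lpb r g" "g \<in> borel_measurable borel"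
    and z: "filterlim (\<lambda>n. norm (z n)) at_top sequentially"
  shows "(\<lambda>n. \<integral>x. prim (f (x + z n)) (g x) \<partial>lborel) \<longlonglongrightarrow> (\<integral>x. prim finf (g x) \<partial>lborel)"
proof -
  have pt: "(\<lambda>n. prim (f (x + z n)) s) \<longlonglongrightarrow> prim finf s" for x s
    unfolding interval_integral_eq_ker
  proof (rule integral_dominated_convergence[where w="\<lambda>t. \<phi> \<bar>s\<bar> * indicator {-\<bar>s\<bar>..\<bar>s\<bar>} t"])
    show "integrable lborel (\<lambda>t. \<phi> \<bar>s\<bar> * indicator {-\<bar>s\<bar>..\<bar>s\<bar>} t)"
      by (intro integrable_mult_right) (simp add: integrable_indicator_iff)
    have "filterlim (\<lambda>n. x + z n) at_infinity sequentially"
      by (rule tendsto_add_filterlim_at_infinity[OF tendsto_const filterlim_norm_at_top_imp_at_infinity[OF z]])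
    then have "(\<lambda>n. f (x + z n) t) \<longlonglongrightarrow> finf t" for t
      by (rule filterlim_compose[OF finf])
    then show "AE t in lborel. (\<lambda>n. primitive_ker s t * f (x + z n) t) \<longlonglongrightarrow> primitive_ker s t * finf t"
      by (intro AE_I2 tendsto_mult tendsto_const)
    show "AE t in lborel. norm (primitive_ker s t * f (x + z n) t) \<le> \<phi> \<bar>s\<bar> * indicator {-\<bar>s\<bar>..\<bar>s\<bar>} t" for n
    proof (rule AE_I2)
      fix t
      have k: "\<bar>primitive_ker s t\<bar> \<le> indicator {-\<bar>s\<bar>..\<bar>s\<bar>} t" by (auto simp: primitive_ker_def indicator_def)
      show "norm (primitive_ker s t * f (x + z n) t) \<le> \<phi> \<bar>s\<bar> * indicator {-\<bar>s\<bar>..\<bar>s\<bar>} t"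
      proof (cases "\<bar>t\<bar> \<le> \<bar>s\<bar>")
        case True
        then have "\<bar>f (x + z n) t\<bar> \<le> \<phi> \<bar>s\<bar>" using bound[of "x + z n" t] \<phi>[of "\<bar>t\<bar>" "\<bar>s\<bar>"] by simp
        then have "\<bar>primitive_ker s t\<bar> * \<bar>f (x + z n) t\<bar> \<le> indicator {-\<bar>s\<bar>..\<bar>s\<bar>} t * \<phi> \<bar>s\<bar>"
          using k by (intro mult_mono) auto
        then show ?thesis by (simp add: abs_mult mult.commute)
      next
        case False
        then have "t \<notin> {-\<bar>s\<bar>..\<bar>s\<bar>}" by auto
        then show ?thesis using k by simp
      qed
    qed
  qed (use fmx finfm in measurable)
  obtain C where C: "C \<ge> 0" "\<And>x a b. \<bar>prim (f x) a - prim (f x) b\<bar> \<le> (\<Sum>r\<in>E. 1 * (\<bar>a\<bar> + \<bar>b\<bar>) powr r + C * \<bar>a - b\<bar> powr r)"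
    using E(2) unfolding growth_mod_def by (metis zero_less_one)
  show ?thesis
  proof (rule integral_dominated_convergence[where w="\<lambda>x. \<Sum>r\<in>E. 1 * \<bar>g x\<bar> powr r + C * \<bar>g x\<bar> powr r"])
    show "integrable lborel (\<lambda>x. \<Sum>r\<in>E. 1 * \<bar>g x\<bar> powr r + C * \<bar>g x\<bar> powr r)"
      using g(1) by (intro integrable_mult_right Bochner_Integration.integrable_sum Bochner_Integration.integrable_add Lpb_integrable)
    show "AE x in lborel. (\<lambda>n. prim (f (x + z n)) (g x)) \<longlonglongrightarrow> prim finf (g x)" by (intro AE_I2 pt)
    show "AE x in lborel. norm (prim (f (x + z n)) (g x)) \<le> (\<Sum>r\<in>E. 1 * \<bar>g x\<bar> powr r + C * \<bar>g x\<bar> powr r)" for n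
    proof (rule AE_I2)
      fix x
      show "norm (prim (f (x + z n)) (g x)) \<le> (\<Sum>r\<in>E. 1 * \<bar>g x\<bar> powr r + C * \<bar>g x\<bar> powr r)"
        using C(2)[where x="x + z n" and a="g x" and b=0] by (simp add: prim_0)
    qed
    have Fm: "(\<lambda>(x, s). prim (f x) s) \<in> borel_measurable (borel \<Otimes>\<^sub>M borel)" by (rule measurable_primitive[OF fm])
    show "(\<lambda>x. prim (f (x + z n)) (g x)) \<in> borel_measurable lborel" for n
      using measurable_Nemytskii[OF Fm borel_measurable_shift[OF g(2), of "z n"]]
        borel_measurable_shift[of "\<lambda>x. prim (f x) (g (x - z n))" "- z n"] by simp
    have "(\<lambda>(x::'a, s). finf s) \<in> borel_measurable (borel \<Otimes>\<^sub>M borel)" using finfm by measurable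
    then show "(\<lambda>x. prim finf (g x)) \<in> borel_measurable lborel"
      using measurable_Nemytskii[OF measurable_primitive[of "\<lambda>_::'a. finf"] g(2)] by simp
  qed
qed

lemma sob_exp_ge: "0 < p \<Longrightarrow> 0 < N \<Longrightarrow> ereal p \<le> sob_exp p N k"
  by (auto simp: sob_exp_def field_simps)

theorem mainTheorem18:
  fixes p :: real and m :: nat
    and u :: "nat \<Rightarrow> real^'n::finite \<Rightarrow> real"
    and \<Lambda> :: enat and N :: "nat \<Rightarrow> nat"
    and w :: "nat \<Rightarrow> real^'n \<Rightarrow> real" and y :: "nat \<Rightarrow> nat \<Rightarrow> real^'n"
    and \<alpha> :: "'n \<Rightarrow> nat"
    and f :: "real^'n \<Rightarrow> real \<Rightarrow> real"
    and finf :: "real \<Rightarrow> real"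
  assumes p: "1 < p"
    and m: "1 \<le> m"
    and bdd: "W_bounded_seq m p u"
    and pd: "profile_decomp m p u \<Lambda> N w y"
    and alpha: "mi_abs \<alpha> < m"
    and fcont: "continuous_on UNIV (\<lambda>(x, s). f x s)"
    and growth: "\<forall>\<epsilon>>0. \<exists>q C. ereal p < ereal q \<and> ereal q < sob_exp p CARD('n) (m - mi_abs \<alpha>) \<and> C > 0 \<and>
        (\<forall>x s. (if sob_exp p CARD('n) (m - mi_abs \<alpha>) = \<infinity>
                 then \<bar>f x s\<bar> \<le> \<epsilon> * \<bar>s\<bar> powr (p - 1) + C * \<bar>s\<bar> powr (q - 1)
                 else \<bar>f x s\<bar> \<le> \<epsilon> * (\<bar>s\<bar> powr (p - 1)
                        + \<bar>s\<bar> powr (real_of_ereal (sob_exp p CARD('n) (m - mi_abs \<alpha>)) - 1))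
                        + C * \<bar>s\<bar> powr (q - 1)))"
  shows
   "((\<forall>y' \<in> int_lattice. \<forall>x s. f (x + y') s = f x s) \<longrightarrow>
      (\<exists>S. (\<lambda>n. \<integral>x. (LBINT t=0..wd \<alpha> (u (N n)) x. f x t) \<partial>lebesgue) \<longlonglongrightarrow> S \<and>
           sum_upto \<Lambda> (\<lambda>l. \<integral>x. (LBINT t=0..wd \<alpha> (w l) x. f x t) \<partial>lebesgue) S))
    \<and>
    ((\<forall>s. ((\<lambda>x. f x s) \<longlongrightarrow> finf s) at_infinity) \<longrightarrow>
      (\<exists>S. (\<lambda>n. \<integral>x. (LBINT t=0..wd \<alpha> (u (N n)) x. f x t) \<partial>lebesgue) \<longlonglongrightarrow> S \<and>
           sum_upto \<Lambda> (\<lambda>l. if l = 0 then \<integral>x. (LBINT t=0..wd \<alpha> (w 0) x. f x t) \<partial>lebesgue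
                              else \<integral>x. (LBINT t=0..wd \<alpha> (w l) x. finf t) \<partial>lebesgue) S))"
proof -
  define P where "P = sob_exp p CARD('n) (m - mi_abs \<alpha>)"
  \<comment> \<open>\<open>real_of_ereal\<close> sends infinity to 0, so the infinite case has its
    own value; p is always an admissible exponent.\<close>
  define R where "R = (if P = \<infinity> then p else real_of_ereal P)"
  define Q where "Q = {q. ereal p < ereal q \<and> ereal q < P}"
  have pP: "ereal p \<le> P" unfolding P_def using p by (intro sob_exp_ge) auto
  have R: "p \<le> R" "ereal R \<le> P" using pP by (cases P; auto simp: R_def)+
  have Q1: "1 < q" "p \<le> q" "ereal q \<le> P" "p < q" if "q \<in> Q" for q using that p by (auto simp: Q_def)
  have R1: "1 < R" using p R by simp
  have pg: "power_growth p R Q f"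
    unfolding power_growth_def
  proof (intro allI impI)
    fix \<epsilon> :: real assume \<epsilon>: "0 < \<epsilon>"
    obtain q C where q: "q \<in> Q" and C: "C > 0" and
      b: "\<And>x s. if P = \<infinity> then \<bar>f x s\<bar> \<le> \<epsilon> * \<bar>s\<bar> powr (p - 1) + C * \<bar>s\<bar> powr (q - 1)
                 else \<bar>f x s\<bar> \<le> \<epsilon> * (\<bar>s\<bar> powr (p - 1) + \<bar>s\<bar> powr (real_of_ereal P - 1)) + C * \<bar>s\<bar> powr (q - 1)"
      using growth[rule_format, OF \<epsilon>] unfolding Q_def P_def[symmetric] by blast
    have "\<bar>f x s\<bar> \<le> \<epsilon> * (\<bar>s\<bar> powr (p - 1) + \<bar>s\<bar> powr (R - 1)) + C * \<bar>s\<bar> powr (q - 1)" for x s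
    proof (cases "P = \<infinity>")
      case True
      have "\<epsilon> * \<bar>s\<bar> powr (p - 1) \<le> \<epsilon> * (\<bar>s\<bar> powr (p - 1) + \<bar>s\<bar> powr (R - 1))" using \<epsilon> by (intro mult_left_mono) auto
      then show ?thesis using b[of x s] True by simp
    qed (use b[of x s] in \<open>simp add: R_def\<close>)
    with q C show "\<exists>q\<in>Q. \<exists>C>0. \<forall>x s. \<bar>f x s\<bar> \<le> \<epsilon> * (\<bar>s\<bar> powr (p - 1) + \<bar>s\<bar> powr (R - 1)) + C * \<bar>s\<bar> powr (q - 1)" by blast
  qed
  \<comment> \<open>The instance \<epsilon> = 1: a fixed crude bound that gives integrability, the
    modulus for the splitting, and the majorant \<phi> in the second part.\<close>
  obtain q1 C1 where q1: "q1 \<in> Q" and C1: "0 < C1"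
    and f1: "\<And>x s. \<bar>f x s\<bar> \<le> 1 * (\<bar>s\<bar> powr (p - 1) + \<bar>s\<bar> powr (R - 1)) + C1 * \<bar>s\<bar> powr (q1 - 1)"
    using pg unfolding power_growth_def by (meson zero_less_one)
  have fm: "(\<lambda>(x, s). f x s) \<in> borel_measurable (borel \<Otimes>\<^sub>M borel)"
    unfolding borel_prod by (rule borel_measurable_continuous_onI[OF fcont])
  have fmx: "f x \<in> borel_measurable borel" for x
    using measurable_compose[OF measurable_Pair1'[of x borel borel] fm] by simp
  define F where "F x s = prim (f x) s" for x s
  have Fm: "(\<lambda>(x, s). F x s) \<in> borel_measurable (borel \<Otimes>\<^sub>M borel)"
    unfolding F_def by (rule measurable_primitive[OF fm])
  have gm: "growth_mod {p, R, q1} F"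
    unfolding F_def[abs_def] by (rule primitive_growth_mod[OF p R1 Q1(1)[OF q1] fmx less_imp_le[OF C1] f1])
  obtain v \<omega> where v: "\<And>n. v n \<in> borel_measurable borel" "\<And>n. AE x in lborel. wd \<alpha> (u (N n)) x = v n x"
    and \<omega>: "\<And>l. enat l \<le> \<Lambda> \<Longrightarrow> \<omega> l \<in> borel_measurable borel"
    "\<And>l. enat l \<le> \<Lambda> \<Longrightarrow> AE x in lborel. wd \<alpha> (w l) x = \<omega> l x"
    and bd: "\<And>r. p \<le> r \<Longrightarrow> ereal r \<le> P \<Longrightarrow> \<exists>M. \<forall>n. Lpb r (v n) \<and> (\<integral>x. \<bar>v n x\<bar> powr r \<partial>lborel) \<le> M"
    and \<omega>L: "\<And>l r. enat l \<le> \<Lambda> \<Longrightarrow> p \<le> r \<Longrightarrow> ereal r \<le> P \<Longrightarrow> Lpb r (\<omega> l)"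
    and weak: "\<And>l g B k. enat l \<le> \<Lambda> \<Longrightarrow> g \<in> borel_measurable borel \<Longrightarrow> (\<And>x. \<bar>g x\<bar> \<le> B) \<Longrightarrow> (\<And>x. x \<notin> ball 0 (real k) \<Longrightarrow> g x = 0) \<Longrightarrow>
       (\<lambda>n. \<integral>x. v n (x + y l n) * g x \<partial>lborel) \<longlonglongrightarrow> (\<integral>x. \<omega> l x * g x \<partial>lborel)"
    and rem: "\<And>q e. p < q \<Longrightarrow> ereal q < P \<Longrightarrow> 0 < e \<Longrightarrow> \<exists>L0. enat L0 \<le> \<Lambda> \<and> (\<forall>L\<ge>L0. enat L \<le> \<Lambda> \<longrightarrow>
        (\<forall>\<^sub>F n in sequentially. (\<integral>x. \<bar>v n x - (\<Sum>l\<le>L. \<omega> l (x - y l n))\<bar> powr q \<partial>lborel) < e))"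
    using profile_borel_versions[OF p bdd pd alpha] unfolding P_def by blast
  have sep: "filterlim (\<lambda>n. norm (y l n - y k n)) at_top sequentially" if "enat l \<le> \<Lambda>" "enat k \<le> \<Lambda>" "l \<noteq> k" for l k
    using pd that by (simp add: profile_decomp_def)
  have \<omega>i: "integrable lborel (\<lambda>x. indicator (ball 0 (real k)) x * \<omega> l x)" if l: "enat l \<le> \<Lambda>" for l k
  proof -
    have "indicator (ball 0 (real k)) \<in> borel_measurable (borel :: (real^'n) measure)"
      by (rule borel_measurable_indicator) simp
    from integral_bounded_support_le(1)[OF p \<omega>L[OF l order_refl pP] this, of 1 "real k"]
    show ?thesis by (simp add: mult.commute)
  qed
  \<comment> \<open>Common to both parts: it remains to find the limit of each single profile
    integral, where the translation has been moved from the profile to the first argument of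
    F.\<close>
  have main: "\<exists>S. (\<lambda>n. \<integral>x. F x (wd \<alpha> (u (N n)) x) \<partial>lebesgue) \<longlonglongrightarrow> S \<and> sum_upto \<Lambda> a S"
    if lim: "\<And>l. enat l \<le> \<Lambda> \<Longrightarrow> (\<lambda>n. \<integral>x. F (x + y l n) (\<omega> l x) \<partial>lborel) \<longlonglongrightarrow> a l" for a
  proof -
    have "\<exists>S. (\<lambda>n. \<integral>x. F x (v n x) \<partial>lborel) \<longlonglongrightarrow> S \<and> sum_upto \<Lambda> a S"
    proof (rule profile_integral_limit[OF p R1 Q1(1) _ \<omega>(1) \<omega>i sep weak _ Fm _ _ q1 gm])
      show "\<exists>M. \<forall>n. Lpb r (v n) \<and> (\<integral>x. \<bar>v n x\<bar> powr r \<partial>lborel) \<le> M" if "r \<in> {p, R} \<union> Q" for r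
        using that R pP Q1 by (intro bd) auto
      show "\<exists>L0. enat L0 \<le> \<Lambda> \<and> (\<forall>L\<ge>L0. enat L \<le> \<Lambda> \<longrightarrow>
        (\<forall>\<^sub>F n in sequentially. (\<integral>x. \<bar>v n x - (\<Sum>l\<le>L. \<omega> l (x - y l n))\<bar> powr q \<partial>lborel) < e))" if "q \<in> Q" "0 < e" for q e
        using that by (intro rem) (auto simp: Q_def)
      show "F x 0 = 0" for x by (simp add: F_def prim_0)
      show "\<exists>q\<in>Q. \<forall>\<delta>>0. \<exists>C\<ge>0. \<forall>x a b. \<bar>F x a - F x b\<bar> \<le>
        \<epsilon> * ((\<bar>a\<bar> + \<bar>b\<bar>) powr p + (\<bar>a\<bar> + \<bar>b\<bar>) powr R) + \<delta> * (\<bar>a\<bar> + \<bar>b\<bar>) powr q + C * \<bar>a - b\<bar> powr q" if "0 < \<epsilon>" for \<epsilon>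
        unfolding F_def by (rule primitive_growth_fine[OF p R1 Q1(1) fmx pg that])
      show "(\<lambda>n. \<integral>x. F x (\<omega> l (x - y l n)) \<partial>lborel) \<longlonglongrightarrow> a l" if "enat l \<le> \<Lambda>" for l
        unfolding integral_translate_Nemytskii[OF Fm \<omega>(1)[OF that]] by (rule lim[OF that])
    qed
    then show ?thesis unfolding lebesgue_eq_lborel_cong[OF Fm v] .
  qed
  show ?thesis
  proof (intro conjI impI)
    assume per: "\<forall>y' \<in> int_lattice. \<forall>x s. f (x + y') s = f x s"
    have "(\<lambda>n. \<integral>x. F (x + y l n) (\<omega> l x) \<partial>lborel) \<longlonglongrightarrow> (\<integral>x. F x (wd \<alpha> (w l) x) \<partial>lebesgue)" if l: "enat l \<le> \<Lambda>" for l
      unfolding lebesgue_eq_lborel_cong[OF Fm \<omega>[OF l]]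
    proof (rule tendsto_eventually, rule eventually_mono[OF eventually_ge_at_top[of l]])
      \<comment> \<open>Lattice membership of \<open>y l n\<close> is granted for n \<ge> l only, so
        the integral is eventually constant.\<close>
      fix n assume "l \<le> n"
      then have "y l n \<in> int_lattice" using pd l by (simp add: profile_decomp_def)
      then have "f (x + y l n) = f x" for x using per by (intro ext) blast
      then show "(\<integral>x. F (x + y l n) (\<omega> l x) \<partial>lborel) = (\<integral>x. F x (\<omega> l x) \<partial>lborel)" by (simp add: F_def)
    qed
    from main[OF this]
    show "\<exists>S. (\<lambda>n. \<integral>x. (LBINT t=0..wd \<alpha> (u (N n)) x. f x t) \<partial>lebesgue) \<longlonglongrightarrow> S \<and>
           sum_upto \<Lambda> (\<lambda>l. \<integral>x. (LBINT t=0..wd \<alpha> (w l) x. f x t) \<partial>lebesgue) S"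
      unfolding F_def .
  next
    assume fi: "\<forall>s. ((\<lambda>x. f x s) \<longlongrightarrow> finf s) at_infinity"
    obtain i :: 'n where True by simp
    have inf: "filterlim (\<lambda>n::nat. real n *\<^sub>R (axis i 1 :: real^'n)) at_infinity sequentially"
      by (rule filterlim_norm_at_top_imp_at_infinity) (simp add: norm_axis_1 filterlim_real_sequentially)
    \<comment> \<open>Along one ray to infinity, \<open>finf\<close> is a pointwise limit of a
      sequence of Borel functions, hence Borel.\<close>
    have "(\<lambda>n::nat. f (real n *\<^sub>R (axis i 1 :: real^'n)) s) \<longlonglongrightarrow> finf s" for s
      by (rule filterlim_compose[OF fi[rule_format, of s] inf])
    then have finfm: "finf \<in> borel_measurable borel"
      by (rule borel_measurable_LIMSEQ_real) (rule fmx)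
    have "(\<lambda>(x::real^'n, s). finf s) \<in> borel_measurable (borel \<Otimes>\<^sub>M borel)" using finfm by measurable
    then have finfm2: "(\<lambda>(x::real^'n, s). prim finf s) \<in> borel_measurable (borel \<Otimes>\<^sub>M borel)"
      by (rule measurable_primitive[of "\<lambda>_. finf"])
    define a where "a l = (if l = 0 then \<integral>x. F x (wd \<alpha> (w 0) x) \<partial>lebesgue else \<integral>x. prim finf (wd \<alpha> (w l) x) \<partial>lebesgue)" for l
    have "(\<lambda>n. \<integral>x. F (x + y l n) (\<omega> l x) \<partial>lborel) \<longlonglongrightarrow> a l" if l: "enat l \<le> \<Lambda>" for l
    proof (cases "l = 0")
      case True
      have "y 0 n = 0" for n using pd by (simp add: profile_decomp_def)
      then show ?thesis using True lebesgue_eq_lborel_cong[OF Fm \<omega>[OF l]] by (simp add: a_def)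
    next
      case False
      \<comment> \<open>Since \<open>y 0 n = 0\<close>, separation from the profile of index 0 says
        that the translations of every other profile tend to infinity.\<close>
      have "enat 0 \<le> \<Lambda>" by (simp add: zero_enat_def[symmetric])
      then have "filterlim (\<lambda>n. norm (y l n - y 0 n)) at_top sequentially" using sep l False by blast
      moreover have "y 0 n = 0" for n using pd by (simp add: profile_decomp_def)
      ultimately have z: "filterlim (\<lambda>n. norm (y l n)) at_top sequentially" by simp
      have "(\<lambda>n. \<integral>x. prim (f (x + y l n)) (\<omega> l x) \<partial>lborel) \<longlonglongrightarrow> (\<integral>x. prim finf (\<omega> l x) \<partial>lborel)"
      proof (rule vanishing_translate_limit[OF fm fmx _ _ _ finfm _ gm[unfolded F_def[abs_def]] _ \<omega>(1)[OF l] z])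
        show "\<bar>f x t\<bar> \<le> 1 * (\<bar>t\<bar> powr (p - 1) + \<bar>t\<bar> powr (R - 1)) + C1 * \<bar>t\<bar> powr (q1 - 1)" for x t by (rule f1)
        show "1 * (s powr (p - 1) + s powr (R - 1)) + C1 * s powr (q1 - 1) \<le> 1 * (t powr (p - 1) + t powr (R - 1)) + C1 * t powr (q1 - 1)"
          if "0 \<le> s" "s \<le> t" for s t
          using that p R1 Q1(1)[OF q1] C1 by (intro add_mono mult_left_mono powr_mono2) auto
        show "Lpb r (\<omega> l)" if "r \<in> {p, R, q1}" for r
          using that R pP Q1[OF q1] by (intro \<omega>L[OF l]) auto
      qed (use fi in auto)
      then show ?thesis using False lebesgue_eq_lborel_cong[OF finfm2 \<omega>[OF l]] by (simp add: a_def F_def)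
    qed
    from main[OF this]
    show "\<exists>S. (\<lambda>n. \<integral>x. (LBINT t=0..wd \<alpha> (u (N n)) x. f x t) \<partial>lebesgue) \<longlonglongrightarrow> S \<and>
           sum_upto \<Lambda> (\<lambda>l. if l = 0 then \<integral>x. (LBINT t=0..wd \<alpha> (w 0) x. f x t) \<partial>lebesgue
                              else \<integral>x. (LBINT t=0..wd \<alpha> (w l) x. finf t) \<partial>lebesgue) S"
      unfolding F_def a_def .
  qed
qed

end
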